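(* Let $s\ge1$, and for $j=1,\dots,s$ let $\mathcal{X}^{(j)}\subset\mathbb{R}^{d_j}$ be bounded with $\mathrm{vol}(\mathcal{X}^{(j)})=1$. Let $\mathbb{X}_j$ be a convergent recursive split of $\mathcal{X}^{(j)}$ in base $b_j\ge2$ with transformation $\phi_j:[0,1)\to\mathcal{X}^{(j)}$. For $n=b^m$, let $\boldsymbol{u}_1,\dots,\boldsymbol{u}_n$ be a nested uniform scramble of a $(t,m,s)$-net in base $b\ge2$, and let $\boldsymbol{x}_i=\phi(\boldsymbol{u}_i)=(\phi_1(u_{i1}),\dots,\phi_s(u_{is}))$. Then for any $f\in L^2(\mathcal{X}^{1:s})$, where $\mathcal{X}^{1:s}=\prod_{j=1}^s\mathcal{X}^{(j)}$, the estimate $\hat\mu=\frac1n\sum_{i=1}^nf(\boldsymbol{x}_i)$ satisfies $$\mathrm{Var}(\hat\mu)=o\Bigl(\frac1n\Bigr)$$ as $n=b^m\to\infty$ (with $b$, $t$, $s$ fixed).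
   Context: Notation: $\mathbb{N}=\{0,1,2,\dots\}$, $\mathbb{Z}_b=\{0,\dots,b-1\}$, $\mathrm{vol}$ is Lebesgue measure. The bases $b_j$ need not equal each other or $b$. Nets. A $b$-adic box is $\prod_{j=1}^s[c_jb^{-k_j},(c_j+1)b^{-k_j})$ with $k_j\in\mathbb{N}$, $c_j\in\mathbb{Z}_{b^{k_j}}$. For $m\ge t\ge0$, points $\boldsymbol{a}_1,\dots,\boldsymbol{a}_{b^m}\in[0,1)^s$ form a $(t,m,s)$-net in base $b$ if every $b$-adic box of volume $b^{t-m}$ contains exactly $b^t$ of them. Nested uniform scramble. Write $a\in[0,1)$ in base $b$ as $a=\sum_{k\ge1}a_kb^{-k}$ (choosing the expansion with trailing zeros if there are two). Its nested uniform scramble is $x=\sum_{k\ge1}x_kb^{-k}$, with $x_1=\pi_{\bullet}(a_1)$ and $x_{k+1}=\pi_{\bullet a_1\cdots a_k}(a_{k+1})$, where all the permutations $\pi_{\bullet a_1\cdots a_k}$ of $\mathbb{Z}_b$ are independent and uniformly distributed over the $b!$ permutations. For points in $[0,1)^s$, independent scrambles are applied to the $s$ components, and the same set of permutations is used for all $n$ points. Splits. For $\mathcal{X}\subset\mathbb{R}^d$ of finite positive volume, a $b$-fold split of $\mathcal{X}$ is a collection of Borel sets $\mathcal{X}_a$, $a\in\mathbb{Z}_b$, with $\mathcal{X}=\bigcup_a\mathcal{X}_a$, $\mathrm{vol}(\mathcal{X}_a)=\mathrm{vol}(\mathcal{X})/b$ and $\mathrm{vol}(\mathcal{X}_a\cap\mathcal{X}_{a'})=0$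 for $a\ne a'$. A recursive split $\mathbb{X}$ in base $b$ consists of $\mathcal{X}$ and exactly one $b$-fold split of every set in the collection; its members are called cells. The level-$k$ cells are $\mathcal{X}_{a_1,\dots,a_k}$, where $\mathcal{X}_{a_1,\dots,a_k,a}$, $a\in\mathbb{Z}_b$, is the split of $\mathcal{X}_{a_1,\dots,a_k}$. Borel sets $\mathcal{S}_k\subset\mathbb{R}^d$ converge nicely to $\boldsymbol{x}$ if there are $\alpha<\infty$ and $d$-dimensional cubes $\mathcal{C}_k$ with $\boldsymbol{x}\in\mathcal{C}_k$, $\mathcal{S}_k\subseteq\mathcal{C}_k$, $0<\mathrm{vol}(\mathcal{C}_k)\le\alpha\,\mathrm{vol}(\mathcal{S}_k)$ and $\lim_k\mathrm{diam}(\mathcal{S}_k)=0$. $\mathbb{X}$ is convergent if for every infinite sequence $a_1,a_2,\dots\in\mathbb{Z}_b$ the cells $\mathcal{X}_{a_1,\dots,a_K}$ converge nicely to a point as $K\to\infty$, denoted $\lim_K\mathcal{X}_{a_1,\dots,a_K}$. Its transformation is $\phi:[0,1)\to\mathcal{X}$, $\phi(x)=\lim_{K}\mathcal{X}_{x_1,\dots,x_K}$, where $x=0.x_1x_2\dots$ in base $b$ (using the expansion with trailing zeros if there are two). *)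

theory Defs
  imports "HOL-Probability.Probability" "HOL-Library.Landau_Symbols"
    "HOL-Combinatorics.Permutations"
begin

text \<open>
  The dimensions \<open>d j\<close> vary with \<open>j\<close>, so points of the Euclidean space of dimension \<open>d\<close> are
  represented as functions in \<open>{..<d} \<rightarrow>\<^sub>E UNIV\<close>, and points of a product of \<open>s\<close> such spaces as
  functions in \<open>{..<s} \<rightarrow>\<^sub>E (space of such functions)\<close>. Components are numbered from \<open>0\<close>.
\<close>

definition vol :: "nat \<Rightarrow> (nat \<Rightarrow> real) measure" where
  "vol d = (\<Pi>\<^sub>M i\<in>{..<d}. lborel)"

definition bounded_vec :: "nat \<Rightarrow> (nat \<Rightarrow> real) set \<Rightarrow> bool" where
  "bounded_vec d S \<longleftrightarrow> (\<exists>B. \<forall>x\<in>S. L2_set x {..<d} \<le> B)"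

text \<open>Taken in \<open>ennreal\<close> so that unbounded sets have infinite diameter.\<close>

definition diam :: "nat \<Rightarrow> (nat \<Rightarrow> real) set \<Rightarrow> ennreal" where
  "diam d S = (SUP x\<in>S. SUP y\<in>S. ennreal (L2_set (\<lambda>i. x i - y i) {..<d}))"

definition is_cube :: "nat \<Rightarrow> (nat \<Rightarrow> real) set \<Rightarrow> bool" where
  "is_cube d C \<longleftrightarrow> (\<exists>c h. 0 \<le> h \<and> C = (\<Pi>\<^sub>E i\<in>{..<d}. {c i..c i + h}))"

definition L2_functions :: "'a measure \<Rightarrow> ('a \<Rightarrow> real) set" where
  "L2_functions N = {f. f \<in> borel_measurable N \<and> integrable N (\<lambda>x. (f x)\<^sup>2)}"

text \<open>
  \<open>digit b k x\<close> is the \<open>k\<close>-th digit (\<open>k \<ge> 1\<close>) after the radix point; taking floors selects the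
  expansion with trailing zeros when there are two.
\<close>

definition digit :: "nat \<Rightarrow> nat \<Rightarrow> real \<Rightarrow> nat" where
  "digit b k x = nat (\<lfloor>x * real b ^ k\<rfloor> mod int b)"

definition digits :: "nat \<Rightarrow> real \<Rightarrow> nat \<Rightarrow> nat list" where
  "digits b x K = map (\<lambda>k. digit b k x) [1..<Suc K]"

definition adic_box :: "nat \<Rightarrow> nat \<Rightarrow> (nat \<Rightarrow> nat) \<Rightarrow> (nat \<Rightarrow> nat) \<Rightarrow> (nat \<Rightarrow> real) set" where
  "adic_box b s k c =
     (\<Pi>\<^sub>E j\<in>{..<s}. {real (c j) / real b ^ k j ..< (real (c j) + 1) / real b ^ k j})"

definition is_net :: "nat \<Rightarrow> nat \<Rightarrow> nat \<Rightarrow> nat \<Rightarrow> (nat \<Rightarrow> nat \<Rightarrow> real) \<Rightarrow> bool" where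
  "is_net b t m s a \<longleftrightarrow>
     t \<le> m \<and>
     (\<forall>i<b ^ m. a i \<in> (\<Pi>\<^sub>E j\<in>{..<s}. {0..<1})) \<and>
     (\<forall>k c. (\<forall>j<s. c j < b ^ k j) \<longrightarrow>
        measure (vol s) (adic_box b s k c) = real b ^ t / real b ^ m \<longrightarrow>
        card {i. i < b ^ m \<and> a i \<in> adic_box b s k c} = b ^ t)"

text \<open>
  \<open>p w\<close> is the permutation attached to the digit prefix \<open>w\<close>. The value is the sum of an infinite
  digit series, so it can be \<open>1\<close> or an expansion without trailing zeros.
\<close>

definition nested_scramble :: "nat \<Rightarrow> (nat list \<Rightarrow> nat \<Rightarrow> nat) \<Rightarrow> real \<Rightarrow> real" where
  "nested_scramble b p x =
     (\<Sum>k. real (p (digits b x k) (digit b (Suc k) x)) / real b ^ Suc k)"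

definition perms :: "nat \<Rightarrow> (nat \<Rightarrow> nat) set" where
  "perms b = {p. p permutes {..<b}}"

text \<open>
  One random permutation for every component \<open>j < s\<close> and every finite word over \<open>{..<b}\<close>, all
  jointly independent.
\<close>

definition uniform_permutations ::
    "'w measure \<Rightarrow> nat \<Rightarrow> nat \<Rightarrow> (nat \<Rightarrow> nat list \<Rightarrow> 'w \<Rightarrow> nat \<Rightarrow> nat) \<Rightarrow> bool" where
  "uniform_permutations M b s \<pi> \<longleftrightarrow>
     prob_space.indep_vars M (\<lambda>_. count_space (perms b)) (\<lambda>(j, w). \<pi> j w)
       ({..<s} \<times> lists {..<b}) \<and>
     (\<forall>j<s. \<forall>w\<in>lists {..<b}.
        distr M (count_space (perms b)) (\<pi> j w) = uniform_count_measure (perms b))"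

definition is_split ::
    "nat \<Rightarrow> nat \<Rightarrow> (nat \<Rightarrow> real) set \<Rightarrow> (nat \<Rightarrow> (nat \<Rightarrow> real) set) \<Rightarrow> bool" where
  "is_split d b X Y \<longleftrightarrow>
     0 < emeasure (vol d) X \<and> emeasure (vol d) X < \<infinity> \<and>
     (\<forall>a<b. Y a \<in> sets (vol d)) \<and>
     X = (\<Union>a<b. Y a) \<and>
     (\<forall>a<b. emeasure (vol d) (Y a) = emeasure (vol d) X / of_nat b) \<and>
     (\<forall>a<b. \<forall>a'<b. a \<noteq> a' \<longrightarrow> emeasure (vol d) (Y a \<inter> Y a') = 0)"

text \<open>\<open>Y w\<close> is the cell with address \<open>w\<close>; the empty word addresses the whole set.\<close>

definition recursive_split ::
    "nat \<Rightarrow> nat \<Rightarrow> (nat \<Rightarrow> real) set \<Rightarrow> (nat list \<Rightarrow> (nat \<Rightarrow> real) set) \<Rightarrow> bool" where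
  "recursive_split d b X Y \<longleftrightarrow>
     Y [] = X \<and> (\<forall>w\<in>lists {..<b}. is_split d b (Y w) (\<lambda>a. Y (w @ [a])))"

definition converges_nicely ::
    "nat \<Rightarrow> (nat \<Rightarrow> (nat \<Rightarrow> real) set) \<Rightarrow> (nat \<Rightarrow> real) \<Rightarrow> bool" where
  "converges_nicely d S x \<longleftrightarrow>
     (\<forall>k. S k \<in> sets (vol d)) \<and>
     (\<exists>(\<alpha>::real) C. \<forall>k. is_cube d (C k) \<and> x \<in> C k \<and> S k \<subseteq> C k \<and>
        0 < emeasure (vol d) (C k) \<and>
        emeasure (vol d) (C k) \<le> ennreal \<alpha> * emeasure (vol d) (S k)) \<and>
     (\<lambda>k. diam d (S k)) \<longlonglongrightarrow> 0"

definition convergent_split :: "nat \<Rightarrow> nat \<Rightarrow> (nat list \<Rightarrow> (nat \<Rightarrow> real) set) \<Rightarrow> bool" where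
  "convergent_split d b Y \<longleftrightarrow>
     (\<forall>a. (\<forall>k. a k < b) \<longrightarrow> (\<exists>x. converges_nicely d (\<lambda>K. Y (map a [1..<Suc (Suc K)])) x))"

text \<open>
  Nice limits are unique: the volumes of the sets, hence of the cubes, tend to \<open>0\<close>.
\<close>

definition split_map :: "nat \<Rightarrow> nat \<Rightarrow> (nat list \<Rightarrow> (nat \<Rightarrow> real) set) \<Rightarrow> real \<Rightarrow> nat \<Rightarrow> real" where
  "split_map d b Y x = (THE y. converges_nicely d (\<lambda>K. Y (digits b x (Suc K))) y)"

definition product_set :: "nat \<Rightarrow> (nat \<Rightarrow> (nat \<Rightarrow> real) set) \<Rightarrow> (nat \<Rightarrow> nat \<Rightarrow> real) set" where
  "product_set s X = (\<Pi>\<^sub>E j\<in>{..<s}. X j)"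

text \<open>The completion makes all Lebesgue measurable integrands admissible, not only Borel ones.\<close>

definition product_measure ::
    "nat \<Rightarrow> (nat \<Rightarrow> nat) \<Rightarrow> (nat \<Rightarrow> (nat \<Rightarrow> real) set) \<Rightarrow> (nat \<Rightarrow> nat \<Rightarrow> real) measure" where
  "product_measure s d X =
     restrict_space (completion (\<Pi>\<^sub>M j\<in>{..<s}. vol (d j))) (product_set s X)"

text \<open>\<open>\<pi> j w\<close> is the permutation for component \<open>j\<close> and prefix \<open>w\<close>, shared by all points \<open>a i\<close>.\<close>

definition sample_point ::
    "nat \<Rightarrow> nat \<Rightarrow> (nat \<Rightarrow> nat) \<Rightarrow> (nat \<Rightarrow> nat) \<Rightarrow> (nat \<Rightarrow> nat list \<Rightarrow> (nat \<Rightarrow> real) set) \<Rightarrow>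
     (nat \<Rightarrow> nat list \<Rightarrow> 'w \<Rightarrow> nat \<Rightarrow> nat) \<Rightarrow> (nat \<Rightarrow> real) \<Rightarrow> 'w \<Rightarrow> nat \<Rightarrow> nat \<Rightarrow> real" where
  "sample_point b s d bs Y \<pi> a \<omega> =
     (\<lambda>j\<in>{..<s}. split_map (d j) (bs j) (Y j) (nested_scramble b (\<lambda>w. \<pi> j w \<omega>) (a j)))"

definition estimate ::
    "nat \<Rightarrow> nat \<Rightarrow> nat \<Rightarrow> (nat \<Rightarrow> nat) \<Rightarrow> (nat \<Rightarrow> nat) \<Rightarrow> (nat \<Rightarrow> nat list \<Rightarrow> (nat \<Rightarrow> real) set) \<Rightarrow>
     ((nat \<Rightarrow> nat \<Rightarrow> real) \<Rightarrow> real) \<Rightarrow> (nat \<Rightarrow> nat list \<Rightarrow> 'w \<Rightarrow> nat \<Rightarrow> nat) \<Rightarrow>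
     (nat \<Rightarrow> nat \<Rightarrow> real) \<Rightarrow> 'w \<Rightarrow> real" where
  "estimate b m s d bs Y f \<pi> a \<omega> =
     (\<Sum>i<b ^ m. f (sample_point b s d bs Y \<pi> (a i) \<omega>)) / real (b ^ m)"

end

theory Submission imports Defs begin

text \<open>
  Each transformation pushes the uniform distribution forward to the uniform distribution on the
  split set: the address of a uniform random point of the set has independent uniform digits, and
  almost surely the cells along the address shrink to the point. So \<open>f\<close> may be replaced by a square
  integrable function \<open>g\<close> on the unit cube.

  A function \<open>q\<close> of finitely many base-\<open>b\<close> digits is a sum of components \<open>q\<^sub>A\<close> that depend on a set
  \<open>A\<close> of digits only and average to zero over each digit in \<open>A\<close>. In a scramble, the values of
  \<open>q\<^sub>A\<close> at one point and of \<open>q\<^sub>B\<close> at another are uncorrelated unless \<open>A = B\<close> and, for every digit in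
  \<open>A\<close>, the two points share all digits before it in the same coordinate: otherwise a rotation of one
  random permutation affects only one of the two factors. If the last digits in \<open>A\<close> span a box of
  volume at least \<open>b\<^bsup>t-m\<^esup>\<close> and \<open>A\<close> is not empty, then equidistribution makes the sum of \<open>q\<^sub>A\<close> over
  the net vanish; if not, then at most \<open>b\<^bsup>t+s\<^esup>\<close> points correlate with a given one. Hence the
  variance is at most \<open>b\<^bsup>t+s\<^esup>/n\<close> times the squared norm of \<open>q\<close>, and it is zero for large \<open>m\<close>.
  Functions of finitely many digits are dense in the square integrable functions.
\<close>

section \<open>Digits and uniform numbers\<close>

text \<open>The cylinder bound alone gives O(1/n), with a constant proportional to the squared norm
  of the function. The little-o comes from subtracting a cylinder function that is chosen from the
  tolerance alone, so that large nets integrate it exactly, and applying the bound to what is left.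
  What is left need not be a cylinder function, and beyond cylinder functions only Cauchy-Schwarz is
  at hand, which loses a factor n. The second approximation is therefore made to accuracy epsilon /
  n. Its digits depend on n, and this is harmless because the constant in the cylinder bound does
  not see how many digits are used.

  The bases of the splits never interact with \<open>b\<close>: the transformations enter only
  through the measures that they push forward. Two kinds of null sets need care. A scramble may
  produce a digit series that is not the expansion chosen by floors, but only at a
  base-\<open>b\<close> rational. And a Lebesgue measurable integrand agrees with a Borel one only
  almost everywhere, which is why the final statement lives on the completion of
  \<open>M\<close>.\<close>

lemma digit_less: "b > 0 \<Longrightarrow> digit b k x < b"
proof -
  assume b: "b > 0"
  then have "0 \<le> \<lfloor>x * real b ^ k\<rfloor> mod int b" "\<lfloor>x * real b ^ k\<rfloor> mod int b < int b" by simp_all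
  then show ?thesis unfolding digit_def by linarith
qed

lemma floor_power_Suc:
  assumes "b > 0"
  shows "\<lfloor>x * real b ^ Suc k\<rfloor> = int b * \<lfloor>x * real b ^ k\<rfloor> + int (digit b (Suc k) x)"
proof -
  let ?y = "x * real b ^ Suc k"
  have "\<lfloor>?y\<rfloor> div int b = \<lfloor>?y / real_of_int (int b)\<rfloor>"
    by (rule floor_divide_real_eq_div[symmetric]) simp
  also have "?y / real_of_int (int b) = x * real b ^ k" using assms by simp
  finally have "\<lfloor>?y\<rfloor> div int b = \<lfloor>x * real b ^ k\<rfloor>" .
  moreover have "int (digit b (Suc k) x) = \<lfloor>?y\<rfloor> mod int b"
    using assms by (simp add: digit_def)
  ultimately show ?thesis by (metis mult_div_mod_eq)
qed

lemma length_digits [simp]: "length (digits b x k) = k"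
  by (simp add: digits_def)

lemma digits_0 [simp]: "digits b x 0 = []"
  by (simp add: digits_def)

lemma digits_Suc: "digits b x (Suc k) = digits b x k @ [digit b (Suc k) x]"
  by (simp add: digits_def)

lemma digits_in_lists: "b > 0 \<Longrightarrow> digits b x k \<in> lists {..<b}"
  by (auto simp: digits_def digit_less)

lemma digits_eq_iff:
  assumes b: "b > 0" and x: "x \<in> {0..<1}" and y: "y \<in> {0..<1}"
  shows "digits b x k = digits b y k \<longleftrightarrow> \<lfloor>x * real b ^ k\<rfloor> = \<lfloor>y * real b ^ k\<rfloor>"
proof (induction k)
  case 0
  have "\<lfloor>x\<rfloor> = 0" "\<lfloor>y\<rfloor> = 0" using x y by (auto simp: floor_eq_iff)
  then show ?case by simp
next
  case (Suc k)
  have "int b * u + int v = int b * u' + int v' \<longleftrightarrow> u = u' \<and> v = v'"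
    if "v < b" "v' < b" for u u' v v'
  proof -
    have "int b * u + int v = int b * u' + int v' \<Longrightarrow> u = u'"
    proof -
      assume e: "int b * u + int v = int b * u' + int v'"
      have "(int b * u + int v) div int b = u" "(int b * u' + int v') div int b = u'"
        using that by simp_all
      with e show "u = u'" by simp
    qed
    then show ?thesis by auto
  qed
  then show ?case
    using Suc b unfolding floor_power_Suc[OF b] digits_Suc by (auto simp: digit_less)
qed

section \<open>Digit series and their partial sums\<close>

definition digit_sum :: "nat \<Rightarrow> (nat \<Rightarrow> nat) \<Rightarrow> real" where
  "digit_sum b D = (\<Sum>k. real (D k) / real b ^ Suc k)"

primrec digit_num :: "nat \<Rightarrow> (nat \<Rightarrow> nat) \<Rightarrow> nat \<Rightarrow> nat" where
  "digit_num b D 0 = 0"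
| "digit_num b D (Suc L) = b * digit_num b D L + D L"

lemma nested_scramble_eq:
  "nested_scramble b p x = digit_sum b (\<lambda>k. p (digits b x k) (digit b (Suc k) x))"
  by (simp add: nested_scramble_def digit_sum_def)

lemma digit_num_partial_sum:
  assumes "b > 0"
  shows "(\<Sum>k<L. real (D k) / real b ^ Suc k) = real (digit_num b D L) / real b ^ L"
  using assms by (induction L) (simp_all add: field_simps)

text \<open>The tail after \<open>L\<close> digits is dominated by a geometric series with sum b^-L.
  The upper bound is attained when all later digits are \<open>b - 1\<close>, so it cannot be strict
  in general.\<close>

lemma digit_sum_bounds:
  assumes b: "b \<ge> 2" and D: "\<And>k. D k < b"
  shows "real (digit_num b D L) / real b ^ L \<le> digit_sum b D"
    and "digit_sum b D \<le> (real (digit_num b D L) + 1) / real b ^ L"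
proof -
  let ?f = "\<lambda>k. real (D k) / real b ^ Suc k"
  let ?g = "\<lambda>k. (real b - 1) / real b * (1 / real b) ^ k"
  have geo: "(\<lambda>k. (1 / real b) ^ k) sums (1 / (1 - 1 / real b))"
    using b by (intro geometric_sums) auto
  have g1: "?g sums 1"
    using sums_mult[OF geo, of "(real b - 1) / real b"] b by (simp add: field_simps)
  have le: "?f k \<le> ?g k" for k
  proof -
    have "real (D k) \<le> real b - 1" using D[of k] by linarith
    then have "?f k \<le> (real b - 1) / real b ^ Suc k" by (intro divide_right_mono) auto
    then show ?thesis by (simp add: power_one_over field_simps)
  qed
  have sf: "summable ?f"
    by (rule summable_comparison_test'[OF sums_summable[OF g1], of 0]) (use le in auto)
  have split: "digit_sum b D = (\<Sum>k. ?f (k + L)) + real (digit_num b D L) / real b ^ L"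
    unfolding digit_sum_def
    using suminf_split_initial_segment[OF sf, of L] digit_num_partial_sum[of b D L] b by simp
  have tail0: "0 \<le> (\<Sum>k. ?f (k + L))"
    by (intro suminf_nonneg summable_ignore_initial_segment sf) auto
  show "real (digit_num b D L) / real b ^ L \<le> digit_sum b D" using split tail0 by simp
  have "(\<lambda>k. ?g k * (1 / real b) ^ L) sums (1 * (1 / real b) ^ L)"
    by (rule sums_mult2[OF g1])
  then have gL: "(\<lambda>k. ?g (k + L)) sums (1 / real b ^ L)"
    by (simp add: power_add mult.assoc power_one_over)
  have "(\<Sum>k. ?f (k + L)) \<le> (\<Sum>k. ?g (k + L))"
    by (intro suminf_le le summable_ignore_initial_segment[OF sf] sums_summable[OF gL])
  then show "digit_sum b D \<le> (real (digit_num b D L) + 1) / real b ^ L"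
    using split sums_unique[OF gL] by (simp add: add_divide_distrib)
qed

text \<open>The points where a digit series can disagree with the digits obtained by floors. The
  numerator is unrestricted, so the value 1 belongs to the set as well.\<close>

definition adic_rats :: "nat \<Rightarrow> real set" where
  "adic_rats b = (\<lambda>(c, k). real c / real b ^ k) ` (UNIV :: (nat \<times> nat) set)"

lemma countable_adic_rats: "countable (adic_rats b)"
  unfolding adic_rats_def by auto

text \<open>Away from the base-\<open>b\<close> rationals the upper bound of
  \<open>digit_sum_bounds\<close> is strict, so scaling by b^L and taking the floor recovers
  \<open>digit_num\<close> exactly; consecutive floors then give the digit.\<close>

lemma digit_digit_sum:
  assumes b: "b \<ge> 2" and D: "\<And>k. D k < b" and x: "digit_sum b D \<notin> adic_rats b"
  shows "digit b (Suc k) (digit_sum b D) = D k"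
proof -
  let ?x = "digit_sum b D"
  have fl: "\<lfloor>?x * real b ^ L\<rfloor> = int (digit_num b D L)" for L
  proof -
    have "?x \<noteq> (real (digit_num b D L) + 1) / real b ^ L"
    proof
      assume "?x = (real (digit_num b D L) + 1) / real b ^ L"
      then have "?x = (\<lambda>(c, k). real c / real b ^ k) (digit_num b D L + 1, L)" by (simp add: add.commute)
      then show False using x unfolding adic_rats_def by blast
    qed
    then have "?x < (real (digit_num b D L) + 1) / real b ^ L"
      using digit_sum_bounds(2)[of b D, OF b D, of L] by simp
    then show ?thesis
      using digit_sum_bounds(1)[of b D, OF b D, of L] b
      by (intro floor_unique) (simp_all add: field_simps)
  qed
  have "int b * int (digit_num b D k) + int (D k)
      = int b * int (digit_num b D k) + int (digit b (Suc k) ?x)"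
    using floor_power_Suc[of b ?x k] b unfolding fl by simp
  then show ?thesis by simp
qed

text \<open>Turns an event about the integer \<open>digit_num\<close> into one about finitely many
  digits, whose probability is known. The word \<open>y\<close> is kept below \<open>b\<close> also
  beyond \<open>L\<close>, where it is arbitrary, because \<open>distr_digit_sum\<close> speaks of
  infinite digit sequences.\<close>

lemma digit_num_eq_iff:
  assumes "b > 0" "c < b ^ L"
  shows "\<exists>y. (\<forall>k. y k < b) \<and>
    (\<forall>D. (\<forall>k. D k < b) \<longrightarrow> (digit_num b D L = c \<longleftrightarrow> (\<forall>k<L. D k = y k)))"
  using assms(2)
proof (induction L arbitrary: c)
  case 0
  then show ?case using \<open>b > 0\<close> by (intro exI[of _ "\<lambda>_. 0"]) auto
next
  case (Suc L)
  have "c div b < b ^ L" using Suc.prems by (simp add: less_mult_imp_div_less mult.commute)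
  then obtain y where y: "\<And>k. y k < b"
    "\<And>D. (\<And>k. D k < b) \<Longrightarrow> digit_num b D L = c div b \<longleftrightarrow> (\<forall>k<L. D k = y k)"
    using Suc.IH[of "c div b"] by metis
  have "digit_num b D (Suc L) = c \<longleftrightarrow> (\<forall>k<Suc L. D k = (y(L := c mod b)) k)"
    if D: "\<And>k. D k < b" for D
  proof -
    have "digit_num b D (Suc L) = c \<longleftrightarrow> digit_num b D L = c div b \<and> D L = c mod b"
    proof
      assume e: "digit_num b D (Suc L) = c"
      show "digit_num b D L = c div b \<and> D L = c mod b"
        using D[of L] e[symmetric] by simp
    qed (simp)
    also have "\<dots> \<longleftrightarrow> (\<forall>k<Suc L. D k = (y(L := c mod b)) k)"
      unfolding y(2)[OF D] by (auto simp: less_Suc_eq)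
    finally show ?thesis .
  qed
  then show ?case using y(1) \<open>b > 0\<close> by (intro exI[of _ "y(L := c mod b)"]) auto
qed

section \<open>The uniform distribution on the unit interval\<close>

definition unif :: "real measure" where
  "unif = uniform_measure lborel {0..1}"

lemma sets_unif [measurable_cong, simp]: "sets unif = sets borel"
  by (simp add: unif_def)

lemma space_unif [simp]: "space unif = UNIV"
  by (simp add: unif_def)

lemma prob_space_unif: "prob_space unif"
  unfolding unif_def by (rule prob_space_uniform_measure) auto

lemma measure_unif: "A \<in> sets borel \<Longrightarrow> measure unif A = measure lborel ({0..1} \<inter> A)"
  by (simp add: unif_def measure_uniform_measure)

lemma AE_unif_not_countable:
  assumes "countable A"
  shows "AE x in unif. x \<notin> A"
proof -
  have "A \<in> null_sets lborel" by (rule countable_imp_null_set_lborel[OF assms])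
  then have "AE x in lborel. x \<notin> A" by (rule AE_not_in)
  then show ?thesis unfolding unif_def
    by (intro AE_uniform_measureI) auto
qed

lemma cdf_unif: "cdf unif x = min 1 (max 0 x)"
proof -
  have "{0..1} \<inter> {..x} = (if x \<ge> 0 then {0..min 1 x} else {})" by (auto simp: min_def)
  then show ?thesis by (simp add: cdf_def measure_unif min_def max_def)
qed

text \<open>The hypothesis \<open>prob\<close> expresses independent uniform digits. The truncation
  to \<open>L\<close> digits is then uniform on a grid of mesh b^-L and within b^-L of the sum,
  which pins down the distribution function at every point in the limit.\<close>

lemma distr_digit_sum:
  fixes D :: "nat \<Rightarrow> 'w \<Rightarrow> nat"
  assumes M: "prob_space M" and b: "b \<ge> 2"
    and meas [measurable]: "\<And>k. D k \<in> M \<rightarrow>\<^sub>M count_space UNIV"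
    and less: "\<And>k \<omega>. \<omega> \<in> space M \<Longrightarrow> D k \<omega> < b"
    and prob: "\<And>L y. (\<And>k. y k < b) \<Longrightarrow>
      measure M {\<omega>\<in>space M. \<forall>k<L. D k \<omega> = y k} = 1 / real b ^ L"
  shows "distr M borel (\<lambda>\<omega>. digit_sum b (\<lambda>k. D k \<omega>)) = unif"
proof -
  interpret prob_space M by fact
  let ?U = "\<lambda>\<omega>. digit_sum b (\<lambda>k. D k \<omega>)"
  let ?N = "\<lambda>L \<omega>. digit_num b (\<lambda>k. D k \<omega>) L"
  have U [measurable]: "?U \<in> borel_measurable M"
    unfolding digit_sum_def by measurable
  have N [measurable]: "(\<lambda>\<omega>. ?N L \<omega>) \<in> M \<rightarrow>\<^sub>M count_space UNIV" for L
    by (induction L) simp_all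
  have eq: "prob {\<omega>\<in>space M. ?N L \<omega> = c} = 1 / real b ^ L" if "c < b ^ L" for c L
  proof -
    have "b > 0" using b by simp
    from digit_num_eq_iff[OF this that] obtain y where y: "\<And>k. y k < b"
      "\<And>D. (\<And>k. D k < b) \<Longrightarrow> digit_num b D L = c \<longleftrightarrow> (\<forall>k<L. D k = y k)"
      by metis
    have "{\<omega>\<in>space M. ?N L \<omega> = c} = {\<omega>\<in>space M. \<forall>k<L. D k \<omega> = y k}"
      using y(2)[of "\<lambda>k. D k _", OF less] by (intro Collect_cong) blast
    then show ?thesis using prob[OF y(1)] by simp
  qed
  have lt: "prob {\<omega>\<in>space M. ?N L \<omega> < c} = real c / real b ^ L" if "c \<le> b ^ L" for c L
    using that
  proof (induction c)
    case (Suc c)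
    have "{\<omega>\<in>space M. ?N L \<omega> < Suc c}
        = {\<omega>\<in>space M. ?N L \<omega> < c} \<union> {\<omega>\<in>space M. ?N L \<omega> = c}" by auto
    then have "prob {\<omega>\<in>space M. ?N L \<omega> < Suc c}
        = prob {\<omega>\<in>space M. ?N L \<omega> < c} + prob {\<omega>\<in>space M. ?N L \<omega> = c}"
      by (simp only:) (intro finite_measure_Union; auto)
    then show ?case using Suc eq[of c L] by (simp add: add_divide_distrib)
  qed simp
  interpret U: prob_space "distr M borel ?U" by (rule prob_space_distr) simp
  interpret un: prob_space unif by (rule prob_space_unif)
  have pos: "real b ^ L > 0" for L using b by simp
  have bd: "real (?N L \<omega>) / real b ^ L \<le> ?U \<omega>" "?U \<omega> \<le> (real (?N L \<omega>) + 1) / real b ^ L"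
    if "\<omega> \<in> space M" for \<omega> L
    using digit_sum_bounds[of b "\<lambda>k. D k \<omega>" L] b less[OF that] by auto
  have cdfU: "cdf (distr M borel ?U) x = prob {\<omega>\<in>space M. ?U \<omega> \<le> x}" for x
    unfolding cdf_def by (subst measure_distr) (auto intro!: arg_cong[where f=prob])
  have "cdf (distr M borel ?U) x = cdf unif x" for x
  proof -
    consider "x < 0" | "x \<ge> 1" | "0 \<le> x" "x < 1" by linarith
    then show ?thesis
    proof cases
      case 1
      have e: "{\<omega>\<in>space M. ?U \<omega> \<le> x} = {}" using bd(1)[of _ 0] 1 by fastforce
      then show ?thesis using 1 unfolding cdfU e by (simp add: cdf_unif)
    next
      case 2
      have e: "{\<omega>\<in>space M. ?U \<omega> \<le> x} = space M" using bd(2)[of _ 0] 2 by fastforce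
      then show ?thesis using 2 unfolding cdfU e by (simp add: cdf_unif prob_space)
    next
      case 3
      have close: "\<bar>prob {\<omega>\<in>space M. ?U \<omega> \<le> x} - x\<bar> \<le> 1 / real b ^ L" for L
      proof -
        \<comment> \<open>The grid cell that contains \<open>x\<close>. Since \<open>x < 1\<close>,
          both \<open>c\<close> and \<open>Suc c\<close> are at most b^L, as \<open>lt\<close>
          demands.\<close>
        define c where "c = nat \<lfloor>x * real b ^ L\<rfloor>"
        have c: "real c \<le> x * real b ^ L" "x * real b ^ L < real c + 1"
          using 3 pos[of L] unfolding c_def by (auto simp: of_nat_nat)
        have "x * real b ^ L < real (b ^ L)" using 3 pos[of L] by simp
        then have cb: "c < b ^ L" using c(1) by (metis le_less_trans of_nat_less_iff)
        have "real c / real b ^ L = prob {\<omega>\<in>space M. ?N L \<omega> < c}" using lt[of c L] cb by simp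
        also have "\<dots> \<le> prob {\<omega>\<in>space M. ?U \<omega> \<le> x}"
        proof (intro finite_measure_mono subsetI CollectI conjI; (elim CollectE conjE)?)
          fix \<omega> assume w: "\<omega> \<in> space M" "?N L \<omega> < c"
          have "?U \<omega> \<le> (real (?N L \<omega>) + 1) / real b ^ L" by (rule bd(2)[OF w(1)])
          also have "\<dots> \<le> real c / real b ^ L" using w(2) pos[of L] by (intro divide_right_mono) auto
          also have "\<dots> \<le> x" using c(1) pos[of L] by (simp add: field_simps)
          finally show "?U \<omega> \<le> x" .
        qed auto
        finally have 1: "real c / real b ^ L \<le> prob {\<omega>\<in>space M. ?U \<omega> \<le> x}" .
        have "prob {\<omega>\<in>space M. ?U \<omega> \<le> x} \<le> prob {\<omega>\<in>space M. ?N L \<omega> < Suc c}"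
        proof (intro finite_measure_mono subsetI CollectI conjI; (elim CollectE conjE)?)
          fix \<omega> assume w: "\<omega> \<in> space M" "?U \<omega> \<le> x"
          have "real (?N L \<omega>) \<le> ?U \<omega> * real b ^ L" using bd(1)[OF w(1), of L] pos[of L] by (simp add: field_simps)
          also have "\<dots> \<le> x * real b ^ L" using w(2) pos[of L] by (intro mult_right_mono) auto
          also have "\<dots> < real c + 1" by (rule c(2))
          finally show "?N L \<omega> < Suc c" by linarith
        qed auto
        also have "\<dots> = (real c + 1) / real b ^ L" using lt[of "Suc c" L] cb by (simp add: add.commute)
        finally have 2: "prob {\<omega>\<in>space M. ?U \<omega> \<le> x} \<le> (real c + 1) / real b ^ L" .
        have 3: "real c / real b ^ L \<le> x" "x \<le> (real c + 1) / real b ^ L"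
          using c pos[of L] by (simp_all add: field_simps)
        show ?thesis using 1 2 3 by (simp add: add_divide_distrib)
      qed
      have "(\<lambda>L. (1 / real b) ^ L) \<longlonglongrightarrow> 0" using b by (intro LIMSEQ_realpow_zero) auto
      then have "(\<lambda>L. 1 / real b ^ L) \<longlonglongrightarrow> 0" by (simp add: power_one_over)
      then have "\<bar>prob {\<omega>\<in>space M. ?U \<omega> \<le> x} - x\<bar> \<le> 0"
        by (rule LIMSEQ_le_const) (use close in auto)
      then show ?thesis using 3 unfolding cdfU by (simp add: cdf_unif)
    qed
  qed
  then show ?thesis
    by (intro cdf_unique) (auto simp: real_distribution_def real_distribution_axioms_def
        intro: U.prob_space_axioms un.prob_space_axioms)
qed

section \<open>The transformation of a convergent recursive split\<close>

lemma space_vol: "space (vol d) = {..<d} \<rightarrow>\<^sub>E UNIV"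
  by (simp add: vol_def space_PiM)

lemma is_cube_diam:
  assumes "is_cube d C" "0 < emeasure (vol d) C"
  obtains h where "0 \<le> h" "emeasure (vol d) C = ennreal (h ^ d)" "C \<subseteq> space (vol d)"
    "\<And>x y i. x \<in> C \<Longrightarrow> y \<in> C \<Longrightarrow> i < d \<Longrightarrow> \<bar>x i - y i\<bar> \<le> h"
proof -
  from assms(1) obtain c h where h: "0 \<le> h" and C: "C = (\<Pi>\<^sub>E i\<in>{..<d}. {c i..c i + h})"
    unfolding is_cube_def by blast
  interpret product_sigma_finite "\<lambda>_. lborel :: real measure"
    by (simp add: product_sigma_finite_def sigma_finite_lborel)
  have "emeasure (vol d) C = (\<Prod>i<d. emeasure lborel {c i..c i + h})"
    unfolding vol_def C by (rule emeasure_PiM) auto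
  also have "\<dots> = ennreal (h ^ d)" using h by (simp add: prod_ennreal ennreal_power)
  finally have "emeasure (vol d) C = ennreal (h ^ d)" .
  moreover have "\<bar>x i - y i\<bar> \<le> h" if "x \<in> C" "y \<in> C" "i < d" for x y i
  proof -
    have "x i \<in> {c i..c i + h}" "y i \<in> {c i..c i + h}"
      using that PiE_mem[of _ "{..<d}" _ i] unfolding C by (metis lessThan_iff)+
    then show ?thesis by auto
  qed
  moreover have "C \<subseteq> space (vol d)" unfolding C space_vol by (auto simp: PiE_iff)
  ultimately show thesis using h that by blast
qed

locale convergent_recursive_split =
  fixes d b :: nat and X and Y :: "nat list \<Rightarrow> (nat \<Rightarrow> real) set"
  assumes b: "b \<ge> 2"
    and vol_X: "emeasure (vol d) X = 1"
    and split: "recursive_split d b X Y"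
    and conv: "convergent_split d b Y"
begin

lemma Y_Nil: "Y [] = X"
  using split by (simp add: recursive_split_def)

lemma is_split_Y: "w \<in> lists {..<b} \<Longrightarrow> is_split d b (Y w) (\<lambda>a. Y (w @ [a]))"
  using split by (simp add: recursive_split_def)

lemma Y_Union: "w \<in> lists {..<b} \<Longrightarrow> Y w = (\<Union>a<b. Y (w @ [a]))"
  using is_split_Y by (simp add: is_split_def)

lemma sets_Y:
  assumes w: "w \<in> lists {..<b}"
  shows "Y w \<in> sets (vol d)"
  unfolding Y_Union[OF w] using is_split_Y[OF w] by (intro sets.finite_UN) (auto simp: is_split_def)

lemma sets_X: "X \<in> sets (vol d)"
  using sets_Y[of "[]"] by (simp add: Y_Nil)

lemma emeasure_Y: "w \<in> lists {..<b} \<Longrightarrow> emeasure (vol d) (Y w) = ennreal (1 / real b ^ length w)"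
proof (induction w rule: rev_induct)
  case (snoc a w)
  then have "emeasure (vol d) (Y (w @ [a])) = emeasure (vol d) (Y w) / of_nat b"
    using is_split_Y[of w] by (auto simp: is_split_def)
  also have "\<dots> = ennreal (1 / real b ^ length w) / ennreal (real b)"
    using snoc by (simp add: ennreal_of_nat_eq_real_of_nat)
  also have "\<dots> = ennreal (1 / real b ^ length w / real b)"
    using b by (intro divide_ennreal) auto
  finally show ?case by (simp add: mult.commute)
qed (simp add: Y_Nil vol_X)

lemma Y_nonempty: "w \<in> lists {..<b} \<Longrightarrow> Y w \<noteq> {}"
  using emeasure_Y[of w] b by (auto simp flip: ennreal_0)

lemma digits_lists: "digits b x k \<in> lists {..<b}"
  using b by (intro digits_in_lists) simp

text \<open>The limit point need not lie in the cells, so small diameters alone do not bring it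
  close to them. The cubes contain both, and their volumes are at most a multiple of the cell
  volumes, which decay geometrically; hence their sides tend to 0.\<close>

lemma nice_limit:
  assumes nice: "converges_nicely d (\<lambda>K. Y (digits b x (Suc K))) z"
    and y: "\<And>K. y K \<in> Y (digits b x (Suc K))" and i: "i < d"
  shows "(\<lambda>K. y K i) \<longlonglongrightarrow> z i"
proof -
  from nice obtain \<alpha> C where C: "\<And>k. is_cube d (C k)" "\<And>k. z \<in> C k"
      "\<And>k. Y (digits b x (Suc k)) \<subseteq> C k" "\<And>k. 0 < emeasure (vol d) (C k)"
      "\<And>k. emeasure (vol d) (C k) \<le> ennreal \<alpha> * emeasure (vol d) (Y (digits b x (Suc k)))"
    unfolding converges_nicely_def by blast
  have "\<exists>h\<ge>0. emeasure (vol d) (C k) = ennreal (h ^ d) \<and>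
      (\<forall>x y i. x \<in> C k \<longrightarrow> y \<in> C k \<longrightarrow> i < d \<longrightarrow> \<bar>x i - y i\<bar> \<le> h)" for k
    using is_cube_diam[OF C(1,4), of k] by metis
  then obtain h where h: "\<And>k. 0 \<le> h k" "\<And>k. emeasure (vol d) (C k) = ennreal (h k ^ d)"
      "\<And>k x y i. x \<in> C k \<Longrightarrow> y \<in> C k \<Longrightarrow> i < d \<Longrightarrow> \<bar>x i - y i\<bar> \<le> h k"
    by metis
  \<comment> \<open>A negative \<open>\<alpha>\<close> is not excluded by its type; the absolute
    value keeps the bound a product of nonnegative reals.\<close>
  have hd: "h k ^ d \<le> \<bar>\<alpha>\<bar> * (1 / real b) ^ Suc k" for k
  proof -
    have "ennreal (h k ^ d) \<le> ennreal \<alpha> * ennreal (1 / real b ^ Suc k)"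
      using C(5)[of k] unfolding h(2) emeasure_Y[OF digits_lists] by simp
    also have "\<dots> \<le> ennreal \<bar>\<alpha>\<bar> * ennreal (1 / real b ^ Suc k)"
      by (intro mult_right_mono ennreal_leI) auto
    also have "\<dots> = ennreal (\<bar>\<alpha>\<bar> * (1 / real b) ^ Suc k)"
      unfolding power_one_over by (rule ennreal_mult'[symmetric]) simp
    finally show ?thesis by (subst (asm) ennreal_le_iff) auto
  qed
  have "(\<lambda>k. (1 / real b) ^ k) \<longlonglongrightarrow> 0" using b by (intro LIMSEQ_realpow_zero) auto
  then have "(\<lambda>k. \<bar>\<alpha>\<bar> * (1 / real b) ^ Suc k) \<longlonglongrightarrow> 0"
    by (intro tendsto_mult_right_zero) (rule LIMSEQ_Suc)
  then have "(\<lambda>k. h k ^ d) \<longlonglongrightarrow> 0"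
    by (rule tendsto_sandwich[OF _ _ tendsto_const, rotated 2]) (use h(1) hd in auto)
  then have "(\<lambda>k. root d (h k ^ d)) \<longlonglongrightarrow> root d 0" by (intro tendsto_real_root)
  \<comment> \<open>From \<open>i < d\<close> the dimension is positive, so the d-th root undoes the
    power.\<close>
  then have h0: "h \<longlonglongrightarrow> 0" using h(1) i by (simp add: real_root_power_cancel)
  have "\<bar>y k i - z i\<bar> \<le> h k" for k
    using h(3)[of "y k" k z i] y[of k] C(2,3)[of k] i by blast
  then have "(\<lambda>k. y k i - z i) \<longlonglongrightarrow> 0"
    by (intro Lim_null_comparison[OF _ h0]) auto
  then show ?thesis by (simp add: LIM_zero_iff)
qed

lemma nice_limit_space:
  assumes "converges_nicely d S z"
  shows "z \<in> {..<d} \<rightarrow>\<^sub>E UNIV"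
proof -
  from assms obtain C where C: "is_cube d C" "z \<in> C" "0 < emeasure (vol d) C"
    unfolding converges_nicely_def by blast
  from is_cube_diam[OF C(1,3)] C(2) show ?thesis unfolding space_vol[symmetric] by blast
qed

lemma nice_limit_unique:
  assumes "converges_nicely d (\<lambda>K. Y (digits b x (Suc K))) z"
    "converges_nicely d (\<lambda>K. Y (digits b x (Suc K))) z'"
  shows "z = z'"
proof (rule PiE_ext)
  define y where "y K = (SOME z. z \<in> Y (digits b x (Suc K)))" for K
  have y: "y K \<in> Y (digits b x (Suc K))" for K
    unfolding y_def some_in_eq by (intro Y_nonempty digits_lists)
  show "z i = z' i" if "i \<in> {..<d}" for i
    using LIMSEQ_unique[OF nice_limit[OF assms(1) y] nice_limit[OF assms(2) y]] that by auto
qed (use nice_limit_space[OF assms(1)] nice_limit_space[OF assms(2)] in \<open>simp_all\<close>)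

lemma split_map_nice: "converges_nicely d (\<lambda>K. Y (digits b x (Suc K))) (split_map d b Y x)"
proof -
  have "\<forall>k. digit b k x < b" using b digit_less by simp
  then have "\<exists>z. converges_nicely d (\<lambda>K. Y (map (\<lambda>k. digit b k x) [1..<Suc (Suc K)])) z"
    using conv unfolding convergent_split_def by (elim allE[of _ "\<lambda>k. digit b k x"]) simp
  then have "\<exists>!z. converges_nicely d (\<lambda>K. Y (digits b x (Suc K))) z"
    using nice_limit_unique unfolding digits_def by blast
  then show ?thesis unfolding split_map_def by (rule theI')
qed

lemma measurable_digit [measurable]: "digit b k \<in> borel \<rightarrow>\<^sub>M count_space UNIV"
  unfolding digit_def by measurable

lemma measurable_digits [measurable]: "(\<lambda>x. digits b x k) \<in> borel \<rightarrow>\<^sub>M count_space UNIV"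
proof (induction k)
  case (Suc k)
  have [measurable]: "(\<lambda>x. w @ [digit b (Suc k) x]) \<in> borel \<rightarrow>\<^sub>M count_space UNIV" for w
    by (rule measurable_compose[OF measurable_digit]) simp
  show ?case unfolding digits_Suc
    by (rule measurable_compose_countable[OF _ Suc]) measurable
qed simp

text \<open>A limit of maps with countably many values: each digit prefix is sent to a chosen point
  of its cell, and by \<open>nice_limit\<close> these points converge to the value in every
  coordinate.\<close>

lemma measurable_split_map: "split_map d b Y \<in> borel \<rightarrow>\<^sub>M vol d"
proof -
  define r where "r w = (SOME z. z \<in> Y w)" for w
  have r: "r w \<in> Y w" if "w \<in> lists {..<b}" for w
    unfolding r_def some_in_eq using that by (rule Y_nonempty)
  have "split_map d b Y \<in> borel \<rightarrow>\<^sub>M (\<Pi>\<^sub>M i\<in>{..<d}. lborel)"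
  proof (rule measurable_PiM_single')
    show "(\<lambda>x. split_map d b Y x i) \<in> borel \<rightarrow>\<^sub>M lborel" if "i \<in> {..<d}" for i
    proof -
      have "(\<lambda>x. split_map d b Y x i) \<in> borel_measurable borel"
      proof (rule borel_measurable_LIMSEQ_real)
        show "(\<lambda>K. r (digits b x (Suc K)) i) \<longlonglongrightarrow> split_map d b Y x i" for x
          by (rule nice_limit[OF split_map_nice]) (use r digits_lists that in auto)
        show "(\<lambda>x. r (digits b x (Suc K)) i) \<in> borel_measurable borel" for K
          by (rule measurable_compose[OF measurable_digits]) simp
      qed
      then show ?thesis by simp
    qed
    show "split_map d b Y \<in> space borel \<rightarrow> {..<d} \<rightarrow>\<^sub>E space lborel"
      using nice_limit_space[OF split_map_nice] by simp
  qed
  then show ?thesis by (simp add: vol_def)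
qed

text \<open>
  Taking the least admissible digit makes the overlaps of the cells irrelevant. The alternative
  \<open>a = b\<close> gives the least element a value on points outside the cell.
\<close>

definition next_digit :: "nat list \<Rightarrow> (nat \<Rightarrow> real) \<Rightarrow> nat" where
  "next_digit w x = (LEAST a. a < b \<and> w \<in> lists {..<b} \<and> x \<in> Y (w @ [a]) \<or> a = b)"

primrec addr :: "nat \<Rightarrow> (nat \<Rightarrow> real) \<Rightarrow> nat list" where
  "addr 0 x = []"
| "addr (Suc k) x = addr k x @ [next_digit (addr k x) x]"

definition addr_digit :: "nat \<Rightarrow> (nat \<Rightarrow> real) \<Rightarrow> nat" where
  "addr_digit k x = next_digit (addr k x) x"

lemma addr_Suc: "addr (Suc k) x = addr k x @ [addr_digit k x]"
  by (simp add: addr_digit_def)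

declare addr.simps(2) [simp del]

lemma length_addr [simp]: "length (addr k x) = k"
  by (induction k) (simp_all add: addr_Suc)

lemma addr_in:
  assumes "x \<in> X"
  shows "addr k x \<in> lists {..<b} \<and> x \<in> Y (addr k x)"
proof (induction k)
  case (Suc k)
  let ?P = "\<lambda>a. a < b \<and> addr k x \<in> lists {..<b} \<and> x \<in> Y (addr k x @ [a]) \<or> a = b"
  from Suc Y_Union[of "addr k x"] obtain a where "a < b" "x \<in> Y (addr k x @ [a])" by auto
  then have *: "?P a" using Suc by blast
  have "addr_digit k x \<le> a" unfolding addr_digit_def next_digit_def by (rule Least_le[of ?P, OF *])
  moreover have "?P (addr_digit k x)"
    unfolding addr_digit_def next_digit_def by (rule LeastI[of ?P, OF *])
  ultimately have "addr_digit k x < b \<and> x \<in> Y (addr k x @ [addr_digit k x])"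
    using \<open>a < b\<close> by linarith
  then show ?case using Suc unfolding addr_Suc by simp
qed (use assms Y_Nil in auto)

lemma addr_digit_less: "x \<in> X \<Longrightarrow> addr_digit k x < b"
  using addr_in[of x "Suc k"] by (simp add: addr_Suc)

definition unif_X :: "(nat \<Rightarrow> real) measure" where
  "unif_X = uniform_measure (vol d) X"

lemma prob_space_unif_X: "prob_space unif_X"
  unfolding unif_X_def by (rule prob_space_uniform_measure) (simp_all add: vol_X)

lemma emeasure_unif_X: "A \<in> sets (vol d) \<Longrightarrow> emeasure unif_X A = emeasure (vol d) (X \<inter> A)"
  unfolding unif_X_def using sets_X by (simp add: vol_X divide_ennreal_def)

lemma sets_unif_X [measurable_cong]: "sets unif_X = sets (vol d)"
  by (simp add: unif_X_def)

lemma AE_unif_X: "AE x in unif_X. x \<in> X"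
  unfolding unif_X_def using sets_X by (intro AE_uniform_measureI) (auto simp: vol_X)

lemma measurable_next_digit: "next_digit w \<in> vol d \<rightarrow>\<^sub>M count_space UNIV"
proof -
  have "Measurable.pred (vol d) (\<lambda>x. a < b \<and> w \<in> lists {..<b} \<and> x \<in> Y (w @ [a]) \<or> a = b)" for a
  proof (cases "a < b \<and> w \<in> lists {..<b}")
    case True
    then have "Y (w @ [a]) \<in> sets (vol d)" by (intro sets_Y) auto
    then have "Measurable.pred (vol d) (\<lambda>x. x \<in> Y (w @ [a]))" by measurable
    then show ?thesis using True by simp
  next
    case False
    then have "(\<lambda>x. a < b \<and> w \<in> lists {..<b} \<and> x \<in> Y (w @ [a]) \<or> a = b) = (\<lambda>x. a = b)"
      by blast
    then show ?thesis by simp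
  qed
  then show ?thesis unfolding next_digit_def by (rule measurable_Least)
qed

lemma measurable_addr: "addr k \<in> vol d \<rightarrow>\<^sub>M count_space UNIV"
proof (induction k)
  case (Suc k)
  have "(\<lambda>x. w @ [next_digit w x]) \<in> vol d \<rightarrow>\<^sub>M count_space UNIV" for w
    by (rule measurable_compose[OF measurable_next_digit]) simp
  then show ?case unfolding addr.simps
    by (rule measurable_compose_countable[OF _ Suc])
qed simp

lemma measurable_addr_digit: "addr_digit k \<in> vol d \<rightarrow>\<^sub>M count_space UNIV"
  unfolding addr_digit_def
  by (rule measurable_compose_countable[OF measurable_next_digit measurable_addr])

text \<open>Points with address \<open>w\<close> lie in the cell \<open>Y w\<close>, so each of the
  b^k events has probability at most b^-k. They partition \<open>X\<close>, which has probability 1,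
  so no inequality can be strict.\<close>

lemma prob_addr:
  assumes "length w = k" "w \<in> lists {..<b}"
  shows "measure unif_X {x\<in>X. addr k x = w} = 1 / real b ^ k"
proof -
  interpret prob_space unif_X by (rule prob_space_unif_X)
  let ?W = "{w\<in>lists {..<b}. length w = k}"
  let ?A = "\<lambda>w. {x\<in>X. addr k x = w}"
  have fin: "finite ?W" and card: "card ?W = b ^ k"
  proof -
    have "?W = {w. set w \<subseteq> {..<b} \<and> length w = k}" by (auto simp: lists_eq_set)
    then show "finite ?W" "card ?W = b ^ k"
      using finite_lists_length_eq[of "{..<b}" k] card_lists_length_eq[of "{..<b}" k] by simp_all
  qed
  have sub: "X \<subseteq> space (vol d)" using sets_X by (rule sets.sets_into_space)
  have sets: "?A w \<in> sets unif_X" for w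
  proof -
    have "{x\<in>space (vol d). addr k x = w} \<in> sets (vol d)"
      using measurable_sets[OF measurable_addr, of "{w}" k] by (simp add: vimage_def Int_def conj_commute)
    moreover have "?A w = X \<inter> {x\<in>space (vol d). addr k x = w}" using sub by auto
    ultimately show ?thesis using sets_X by (simp add: sets_unif_X)
  qed
  have le: "prob (?A w) \<le> 1 / real b ^ k" if "w \<in> ?W" for w
  proof -
    have "X \<inter> ?A w \<subseteq> Y w" using addr_in[of _ k] by auto
    then have "emeasure (vol d) (X \<inter> ?A w) \<le> emeasure (vol d) (Y w)"
      using that by (intro emeasure_mono sets_Y) auto
    then have "emeasure unif_X (?A w) \<le> emeasure (vol d) (Y w)"
      using sets[of w] unfolding sets_unif_X by (subst emeasure_unif_X) simp_all
    also have "\<dots> = ennreal (1 / real b ^ k)" using that by (subst emeasure_Y) auto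
    finally show ?thesis by (simp add: emeasure_eq_measure)
  qed
  have "(\<Sum>w\<in>?W. prob (?A w)) = prob (\<Union>w\<in>?W. ?A w)"
    using sets fin by (intro finite_measure_finite_Union[symmetric]) (auto simp: disjoint_family_on_def)
  also have "(\<Union>w\<in>?W. ?A w) = X" using addr_in[of _ k] by auto
  also have "prob X = 1"
    using emeasure_unif_X[OF sets_X] vol_X by (simp add: emeasure_eq_measure)
  finally have sum: "(\<Sum>w\<in>?W. 1 / real b ^ k - prob (?A w)) = 0"
    using card b by (simp add: sum_subtractf)
  have "\<forall>w\<in>?W. 1 / real b ^ k - prob (?A w) = 0"
    using sum_nonneg_eq_0_iff[of ?W "\<lambda>w. 1 / real b ^ k - prob (?A w)"] fin le sum by simp
  then show ?thesis using assms by simp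
qed

lemma addr_eq_iff: "addr k x = map y [0..<k] \<longleftrightarrow> (\<forall>i<k. addr_digit i x = y i)"
  by (induction k) (auto simp: addr_Suc less_Suc_eq)

text \<open>An almost sure inverse of the transformation. Outside \<open>X\<close> an address digit
  may equal \<open>b\<close>, hence the default 0.\<close>

definition addr_point :: "(nat \<Rightarrow> real) \<Rightarrow> real" where
  "addr_point x = (if x \<in> X then digit_sum b (\<lambda>k. addr_digit k x) else 0)"

lemma distr_addr_point:
  shows "distr unif_X borel addr_point = unif" and "addr_point \<in> borel_measurable unif_X"
proof -
  \<comment> \<open>\<open>distr_digit_sum\<close> wants digits below \<open>b\<close> on the whole
    space, also outside \<open>X\<close>.\<close>
  let ?D = "\<lambda>k x. if x \<in> X then addr_digit k x else 0"
  note sets_X [measurable] measurable_addr_digit [measurable]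
  have eq: "addr_point = (\<lambda>x. digit_sum b (\<lambda>k. ?D k x))"
    by (auto simp: addr_point_def fun_eq_iff digit_sum_def)
  have D [measurable]: "?D k \<in> unif_X \<rightarrow>\<^sub>M count_space UNIV" for k
    by measurable
  show "addr_point \<in> borel_measurable unif_X"
    unfolding eq digit_sum_def by measurable
  show "distr unif_X borel addr_point = unif"
    unfolding eq
  proof (rule distr_digit_sum[OF prob_space_unif_X b D])
    fix L :: nat and y :: "nat \<Rightarrow> nat" assume y: "\<And>k. y k < b"
    have "measure unif_X {x\<in>space unif_X. \<forall>k<L. ?D k x = y k}
        = measure unif_X {x\<in>X. addr L x = map y [0..<L]}"
    proof (rule measure_eq_AE)
      show "AE x in unif_X. x \<in> {x\<in>space unif_X. \<forall>k<L. ?D k x = y k} \<longleftrightarrow>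
          x \<in> {x\<in>X. addr L x = map y [0..<L]}"
        using AE_unif_X AE_space by eventually_elim (auto simp: addr_eq_iff)
      show "{x\<in>space unif_X. \<forall>k<L. ?D k x = y k} \<in> sets unif_X" by measurable
      have "{x\<in>X. addr L x = map y [0..<L]}
          = X \<inter> {x\<in>space (vol d). \<forall>k<L. addr_digit k x = y k}"
        using sets.sets_into_space[OF sets_X] by (auto simp: addr_eq_iff)
      also have "\<dots> \<in> sets unif_X" unfolding sets_unif_X by measurable
      finally show "{x\<in>X. addr L x = map y [0..<L]} \<in> sets unif_X" .
    qed
    also have "\<dots> = 1 / real b ^ L" using y by (intro prob_addr) auto
    finally show "measure unif_X {x\<in>space unif_X. \<forall>k<L. ?D k x = y k} = 1 / real b ^ L" .
  qed (use addr_digit_less b in auto)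
qed

text \<open>The point \<open>x\<close> lies in all cells of its own address, so the constant
  sequence \<open>x\<close> must converge to the nice limit. Excluding base-\<open>b\<close>
  rationals ensures that the floor digits of \<open>addr_point x\<close> spell that address.\<close>

lemma split_map_addr_point:
  assumes x: "x \<in> X" and nr: "addr_point x \<notin> adic_rats b"
  shows "split_map d b Y (addr_point x) = x"
proof (rule PiE_ext)
  have dig: "digit b (Suc k) (addr_point x) = addr_digit k x" for k
    using x nr addr_digit_less b unfolding addr_point_def by (auto intro!: digit_digit_sum)
  have "digits b (addr_point x) k = addr k x" for k
    by (induction k) (simp_all add: digits_Suc addr_Suc dig)
  then have "x \<in> Y (digits b (addr_point x) (Suc K))" for K
    using addr_in[OF x] by simp
  from nice_limit[OF split_map_nice this]
  show "split_map d b Y (addr_point x) i = x i" if "i \<in> {..<d}" for i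
    using that LIMSEQ_unique[OF _ tendsto_const] by (metis LIMSEQ_const_iff lessThan_iff)
  show "x \<in> {..<d} \<rightarrow>\<^sub>E UNIV"
    using sets.sets_into_space[OF sets_X] x space_vol by auto
  show "split_map d b Y (addr_point x) \<in> {..<d} \<rightarrow>\<^sub>E UNIV"
    by (rule nice_limit_space[OF split_map_nice])
qed

text \<open>Preimages under the transformation are never computed: the address map carries the
  uniform distribution on \<open>X\<close> to that on the unit interval, and following it by the
  transformation is almost surely the identity.\<close>

lemma distr_split_map: "distr unif (vol d) (split_map d b Y) = uniform_measure (vol d) X"
proof -
  have m: "addr_point \<in> unif_X \<rightarrow>\<^sub>M borel" "split_map d b Y \<in> borel \<rightarrow>\<^sub>M vol d"
    using distr_addr_point(2) measurable_split_map by auto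
  have "AE u in distr unif_X borel addr_point. u \<notin> adic_rats b"
    unfolding distr_addr_point(1) by (rule AE_unif_not_countable[OF countable_adic_rats])
  then have "AE x in unif_X. addr_point x \<notin> adic_rats b"
    by (rule AE_distrD[OF m(1)])
  then have AE: "AE x in unif_X. (split_map d b Y \<circ> addr_point) x = x"
    using AE_unif_X by eventually_elim (simp add: split_map_addr_point)
  have "distr unif (vol d) (split_map d b Y) = distr unif_X (vol d) (split_map d b Y \<circ> addr_point)"
    unfolding distr_addr_point(1)[symmetric] using m by (intro distr_distr)
  also have "\<dots> = distr unif_X (vol d) (\<lambda>x. x)"
    using m AE by (intro distr_cong_AE) (auto simp: sets_unif_X)
  also have "\<dots> = unif_X"
    by (rule distr_id2) (simp add: sets_unif_X)
  finally show ?thesis by (simp add: unif_X_def)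
qed

end

section \<open>Analysis of variance and random permutations\<close>

definition depends_on :: "(('i \<Rightarrow> 'v) \<Rightarrow> 'r) \<Rightarrow> 'i set \<Rightarrow> bool" where
  "depends_on q A \<longleftrightarrow> (\<forall>x y. (\<forall>c\<in>A. x c = y c) \<longrightarrow> q x = q y)"

lemma depends_onD: "depends_on q A \<Longrightarrow> (\<And>c. c \<in> A \<Longrightarrow> x c = y c) \<Longrightarrow> q x = q y"
  unfolding depends_on_def by blast

lemma depends_on_mono: "depends_on q A \<Longrightarrow> A \<subseteq> B \<Longrightarrow> depends_on q B"
  unfolding depends_on_def by blast

text \<open>
  Only the coordinates in \<open>J\<close> are decomposed, so every component may also depend on those in \<open>I - J\<close>.
\<close>

definition anova ::
    "nat \<Rightarrow> 'i set \<Rightarrow> 'i set \<Rightarrow> (('i \<Rightarrow> nat) \<Rightarrow> real) \<Rightarrow> ('i set \<Rightarrow> ('i \<Rightarrow> nat) \<Rightarrow> real) \<Rightarrow> bool" where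
  "anova b I J q qA \<longleftrightarrow>
    (\<forall>A. A \<subseteq> J \<longrightarrow> depends_on (qA A) (A \<union> (I - J))) \<and>
    (\<forall>A c x. A \<subseteq> J \<longrightarrow> c \<in> A \<longrightarrow> (\<Sum>v<b. qA A (x(c := v))) = 0) \<and>
    (\<forall>x. q x = (\<Sum>A\<in>Pow J. qA A x))"

text \<open>One coordinate \<open>c\<close> is decomposed at a time: each component splits into its
  average over \<open>c\<close>, kept for \<open>A\<close>, and the deviation from it, assigned to
  \<open>insert c A\<close>. Averaging over \<open>c\<close> preserves the vanishing sums in other
  coordinates because the two sums commute.\<close>

lemma anova_exists:
  fixes q :: "('i \<Rightarrow> nat) \<Rightarrow> real"
  assumes fin: "finite I" and b: "b > 0" and q: "depends_on q I"
  shows "\<exists>qA. anova b I I q qA"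
proof -
  have "\<exists>qA. anova b I J q qA" if "finite J" "J \<subseteq> I" for J
    using that
  proof (induction J)
    case empty
    have "anova b I {} q (\<lambda>_. q)" unfolding anova_def using q by simp
    then show ?case by (rule exI[of _ "\<lambda>_. q"])
  next
    case (insert c J)
    have "J \<subseteq> I" using insert.prems by auto
    from insert.IH[OF this] obtain qA where qA: "anova b I J q qA" ..
    from qA have dep: "A \<subseteq> J \<Longrightarrow> depends_on (qA A) (A \<union> (I - J))"
      and van: "A \<subseteq> J \<Longrightarrow> c' \<in> A \<Longrightarrow> (\<Sum>v<b. qA A (x(c' := v))) = 0"
      and sum: "q x = (\<Sum>A\<in>Pow J. qA A x)" for A c' x
      unfolding anova_def by simp_all
    define avg where "avg A x = (\<Sum>v<b. qA A (x(c := v))) / real b" for A x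
    define rA where "rA A = (if c \<in> A then \<lambda>x. qA (A - {c}) x - avg (A - {c}) x else avg A)" for A
    have dep_avg: "depends_on (avg A) (A \<union> (I - insert c J))" if "A \<subseteq> J" for A
      unfolding depends_on_def
    proof (intro allI impI)
      fix x y :: "'i \<Rightarrow> nat" assume xy: "\<forall>c\<in>A \<union> (I - insert c J). x c = y c"
      have "qA A (x(c := v)) = qA A (y(c := v))" for v
        by (rule depends_onD[OF dep[OF that]]) (use xy in auto)
      then show "avg A x = avg A y" by (simp add: avg_def)
    qed
    have avg_upd: "avg A (x(c := v)) = avg A x" for A x v
      by (simp add: avg_def)
    have van_avg: "(\<Sum>v<b. avg A (x(c' := v))) = 0" if "A \<subseteq> J" "c' \<in> A" for A c' x
    proof -
      have "c' \<noteq> c" using that insert.hyps by auto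
      then have "(\<Sum>v<b. avg A (x(c' := v))) = (\<Sum>w<b. \<Sum>v<b. qA A (x(c := w, c' := v))) / real b"
        unfolding avg_def sum_divide_distrib[symmetric]
        by (subst sum.swap) (simp add: fun_upd_twist)
      then show ?thesis using van[OF that] by simp
    qed
    have "depends_on (rA A) (A \<union> (I - insert c J))" if A: "A \<subseteq> insert c J" for A
    proof (cases "c \<in> A")
      case True
      have sub: "A - {c} \<subseteq> J" using A by auto
      have "depends_on (qA (A - {c})) (A \<union> (I - insert c J))"
        by (rule depends_on_mono[OF dep[OF sub]]) (use True in auto)
      moreover have "depends_on (avg (A - {c})) (A \<union> (I - insert c J))"
        by (rule depends_on_mono[OF dep_avg[OF sub]]) auto
      ultimately have "depends_on (\<lambda>x. qA (A - {c}) x - avg (A - {c}) x) (A \<union> (I - insert c J))"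
        unfolding depends_on_def by (intro allI impI arg_cong2[where f=minus]) blast+
      then show ?thesis using True by (simp add: rA_def cong: if_cong)
    next
      case False
      then have "A \<subseteq> J" using A by auto
      then show ?thesis using dep_avg False by (simp add: rA_def cong: if_cong)
    qed
    moreover have "(\<Sum>v<b. rA A (x(c' := v))) = 0" if A: "A \<subseteq> insert c J" and c': "c' \<in> A" for A c' x
    proof (cases "c \<in> A")
      case True
      have sub: "A - {c} \<subseteq> J" using A by auto
      show ?thesis
      proof (cases "c' = c")
        case True
        then show ?thesis using \<open>c \<in> A\<close> b by (simp add: rA_def sum_subtractf avg_upd) (simp add: avg_def)
      next
        case False
        then show ?thesis using True c' van[OF sub, of c'] van_avg[OF sub, of c']
          by (simp add: rA_def sum_subtractf)
      qed
    next
      case False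
      then have "A \<subseteq> J" using A by auto
      then show ?thesis using False van_avg c' by (simp add: rA_def)
    qed
    moreover have "q x = (\<Sum>A\<in>Pow (insert c J). rA A x)" for x
    proof -
      have inj: "inj_on (insert c) (Pow J)" using insert.hyps by (auto simp: inj_on_def)
      have disj: "Pow J \<inter> insert c ` Pow J = {}" using insert.hyps by auto
      have "(\<Sum>A\<in>Pow (insert c J). rA A x) = (\<Sum>A\<in>Pow J. rA A x) + (\<Sum>A\<in>Pow J. rA (insert c A) x)"
        unfolding Pow_insert using insert.hyps disj
        by (subst sum.union_disjoint) (auto simp: sum.reindex[OF inj])
      also have "\<dots> = (\<Sum>A\<in>Pow J. rA A x + rA (insert c A) x)" by (simp add: sum.distrib)
      also have "\<dots> = (\<Sum>A\<in>Pow J. qA A x)"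
      proof (rule sum.cong)
        fix A assume "A \<in> Pow J"
        then have "c \<notin> A" using insert.hyps by auto
        then show "rA A x + rA (insert c A) x = qA A x" by (simp add: rA_def)
      qed simp
      finally show ?thesis using sum by simp
    qed
    ultimately have "anova b I (insert c J) q rA" unfolding anova_def by simp
    then show ?case by (rule exI[of _ rA])
  qed
  from this[OF fin subset_refl] show ?thesis .
qed

section \<open>Uniform permutations and rotations\<close>

lemma finite_perms: "finite (perms b)"
  unfolding perms_def by (rule finite_permutations) simp

lemma card_perms: "card (perms b) = fact b"
  unfolding perms_def by (subst card_permutations[OF refl]) auto

text \<open>Composing with the transposition of \<open>z\<close> and \<open>y\<close> maps the
  permutations sending \<open>x\<close> to \<open>z\<close> bijectively to those sending
  \<open>x\<close> to \<open>y\<close>, so the \<open>b\<close> fibres over the possible values have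
  equal size.\<close>

lemma card_perms_eval:
  assumes "x < b" "y < b"
  shows "real (card {p\<in>perms b. p x = y}) / real (card (perms b)) = 1 / real b"
proof -
  let ?A = "\<lambda>y. {p\<in>perms b. p x = y}"
  have eq: "card (?A z) = card (?A y)" if "z < b" for z
  proof (rule bij_betw_same_card[of "\<lambda>p. Transposition.transpose z y \<circ> p"])
    have t: "Transposition.transpose z y permutes {..<b}" using that assms by (intro permutes_swap_id) auto
    show "bij_betw (\<lambda>p. Transposition.transpose z y \<circ> p) (?A z) (?A y)"
      by (rule bij_betw_byWitness[where f'="\<lambda>p. Transposition.transpose z y \<circ> p"])
        (use t in \<open>auto simp: perms_def comp_assoc[symmetric] transpose_comp_involutory permutes_compose\<close>)
  qed
  have "card (perms b) = card (\<Union>z<b. ?A z)"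
  proof (intro arg_cong[where f=card] set_eqI iffI)
    fix p assume p: "p \<in> perms b"
    then have "p x \<in> {..<b}" using assms unfolding perms_def using permutes_in_image[of p "{..<b}" x] by simp
    then show "p \<in> (\<Union>z<b. ?A z)" using p by auto
  qed auto
  also have "\<dots> = (\<Sum>z<b. card (?A z))"
    using finite_perms by (intro card_UN_disjoint) auto
  also have "\<dots> = b * card (?A y)" using eq by simp
  finally have c: "card (perms b) = b * card (?A y)" .
  have "card (perms b) > 0" by (simp add: card_perms)
  then show ?thesis using c assms by (simp add: field_simps)
qed

text \<open>Only \<open>b\<close> permutations, yet together they send each digit to every value
  once, so they suffice for averaging. Outside the digits a rotation is the identity, as
  \<open>permutes\<close> demands.\<close>

definition rotation :: "nat \<Rightarrow> nat \<Rightarrow> nat \<Rightarrow> nat" where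
  "rotation b v x = (if x < b then (x + v) mod b else x)"

lemma inj_on_add_mod: "inj_on (\<lambda>x. (x + v) mod b) {..<b}" for v b :: nat
proof (rule inj_onI)
  fix x y assume xy: "x \<in> {..<b}" "y \<in> {..<b}" "(x + v) mod b = (y + v) mod b"
  have "(int x + int v) mod int b = (int y + int v) mod int b"
    using xy(3) by (metis of_nat_add of_nat_mod)
  then have "int x mod int b = int y mod int b"
    by (metis add_diff_cancel_right' mod_diff_left_eq)
  then show "x = y" using xy by simp
qed

lemma bij_betw_add_mod: "bij_betw (\<lambda>x. (x + v) mod b) {..<b} {..<b}" for v b :: nat
  by (rule bij_betw_imageI[OF inj_on_add_mod])
    (rule endo_inj_surj[OF _ _ inj_on_add_mod], use inj_on_add_mod in auto)

lemma rotation_permutes: "rotation b v permutes {..<b}"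
proof (rule bij_imp_permutes)
  show "bij_betw (rotation b v) {..<b} {..<b}"
    using bij_betw_add_mod[of v b] by (subst bij_betw_cong[of _ _ "\<lambda>x. (x + v) mod b"]) (auto simp: rotation_def)
qed (simp add: rotation_def)

lemma sum_rotation: "x < b \<Longrightarrow> (\<Sum>v<b. h (rotation b v x)) = (\<Sum>v<b. h v)" for h :: "nat \<Rightarrow> real"
  using sum.reindex_bij_betw[OF bij_betw_add_mod[of x b], of h] by (simp add: rotation_def add.commute)

section \<open>Random nested scrambles\<close>

text \<open>Positions \<open>(j, k)\<close> count the digits of a coordinate from \<open>0\<close>, whereas \<open>digit\<close> counts them from \<open>1\<close>.\<close>

definition digit_array :: "nat \<Rightarrow> (nat \<Rightarrow> real) \<Rightarrow> nat \<times> nat \<Rightarrow> nat" where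
  "digit_array b u = (\<lambda>(j, k). digit b (Suc k) (u j))"

text \<open>The index of the permutation that is applied to a digit. Two points have a digit moved
  by the same permutation exactly if their addresses there agree, that is, if they share all earlier
  digits of that coordinate.\<close>

definition digit_address :: "nat \<Rightarrow> (nat \<Rightarrow> real) \<Rightarrow> nat \<times> nat \<Rightarrow> nat \<times> nat list" where
  "digit_address b x = (\<lambda>(j, k). (j, digits b (x j) k))"

text \<open>The permuted digits before they are summed to a real number. Working with them avoids
  null sets; they agree with the floor digits of the scrambled point only almost surely.\<close>

definition scrambled_digits ::
    "nat \<Rightarrow> (nat \<times> nat list \<Rightarrow> nat \<Rightarrow> nat) \<Rightarrow> (nat \<Rightarrow> real) \<Rightarrow> nat \<times> nat \<Rightarrow> nat" where
  "scrambled_digits b \<sigma> x = (\<lambda>c. \<sigma> (digit_address b x c) (digit_array b x c))"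

definition uniform_point :: "nat \<Rightarrow> (nat \<Rightarrow> real) measure" where
  "uniform_point s = (\<Pi>\<^sub>M j\<in>{..<s}. unif)"

lemma digit_address_eq_iff:
  "digit_address b x (j, k) = digit_address b y (j', k') \<longleftrightarrow>
    j = j' \<and> k = k' \<and> digits b (x j) k = digits b (y j) k"
proof -
  have "digits b (x j) k = digits b (y j') k' \<Longrightarrow> k = k'"
    by (metis length_digits)
  then show ?thesis unfolding digit_address_def by auto
qed

lemma inj_digit_address: "inj (digit_address b x)"
  by (rule injI) (auto simp: digit_address_eq_iff)

lemma depends_on_scrambled_digits:
  assumes "depends_on q A"
  shows "depends_on (\<lambda>\<sigma>. q (scrambled_digits b \<sigma> x)) (digit_address b x ` A)"
  unfolding depends_on_def
proof (intro allI impI)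
  fix \<sigma> \<tau> :: "nat \<times> nat list \<Rightarrow> nat \<Rightarrow> nat" assume "\<forall>c\<in>digit_address b x ` A. \<sigma> c = \<tau> c"
  then show "q (scrambled_digits b \<sigma> x) = q (scrambled_digits b \<tau> x)"
    by (intro depends_onD[OF assms]) (simp add: scrambled_digits_def)
qed

lemma depends_on_mult:
  fixes F G :: "('i \<Rightarrow> 'v) \<Rightarrow> real"
  assumes "depends_on F A" "depends_on G B"
  shows "depends_on (\<lambda>x. F x * G x) (A \<union> B)"
  unfolding depends_on_def
proof (intro allI impI)
  fix x y :: "'i \<Rightarrow> 'v" assume "\<forall>c\<in>A \<union> B. x c = y c"
  then show "F x * G x = F y * G y"
    by (intro arg_cong2[where f=times] depends_onD[OF assms(1)] depends_onD[OF assms(2)]) auto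
qed

locale random_scramble = prob_space M for M :: "'w measure" +
  fixes b s :: nat and \<pi> :: "nat \<Rightarrow> nat list \<Rightarrow> 'w \<Rightarrow> nat \<Rightarrow> nat"
  assumes b: "b \<ge> 2" and s: "s \<ge> 1"
    and unif_perms: "uniform_permutations M b s \<pi>"
begin

definition idx :: "(nat \<times> nat list) set" where
  "idx = {..<s} \<times> lists {..<b}"

definition perm_at :: "'w \<Rightarrow> nat \<times> nat list \<Rightarrow> nat \<Rightarrow> nat" where
  "perm_at \<omega> = (\<lambda>(j, w). \<pi> j w \<omega>)"

lemma b_pos: "b > 0"
  using b by simp

lemma indep_perms: "indep_vars (\<lambda>_. count_space (perms b)) (\<lambda>c \<omega>. perm_at \<omega> c) idx"
proof -
  have "(\<lambda>c \<omega>. perm_at \<omega> c) = (\<lambda>(j, w). \<pi> j w)"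
    by (auto simp: perm_at_def fun_eq_iff)
  then show ?thesis using unif_perms unfolding uniform_permutations_def idx_def by simp
qed

lemma measurable_perm_at: "c \<in> idx \<Longrightarrow> (\<lambda>\<omega>. perm_at \<omega> c) \<in> M \<rightarrow>\<^sub>M count_space (perms b)"
  using indep_perms unfolding indep_vars_def by blast

lemma perm_at_perms: "c \<in> idx \<Longrightarrow> \<omega> \<in> space M \<Longrightarrow> perm_at \<omega> c \<in> perms b"
  using measurable_space[OF measurable_perm_at] by simp

lemma prob_perm_at:
  assumes "c \<in> idx" "P \<subseteq> perms b"
  shows "prob ((\<lambda>\<omega>. perm_at \<omega> c) -` P \<inter> space M) = real (card P) / real (card (perms b))"
proof -
  obtain j w where c: "c = (j, w)" "j < s" "w \<in> lists {..<b}"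
    using assms unfolding idx_def by auto
  have d: "distr M (count_space (perms b)) (\<lambda>\<omega>. perm_at \<omega> c) = uniform_count_measure (perms b)"
    using unif_perms c unfolding uniform_permutations_def perm_at_def by simp
  have "prob ((\<lambda>\<omega>. perm_at \<omega> c) -` P \<inter> space M)
      = measure (distr M (count_space (perms b)) (\<lambda>\<omega>. perm_at \<omega> c)) P"
    using assms by (subst measure_distr) (auto intro: measurable_perm_at)
  then show ?thesis
    unfolding d using assms finite_perms by (simp add: measure_uniform_count_measure)
qed

lemma digit_address_idx: "fst c < s \<Longrightarrow> digit_address b x c \<in> idx"
  using digits_in_lists[OF b_pos] by (auto simp: idx_def digit_address_def split: prod.split)

lemma address_image_idx: "A \<subseteq> {..<s} \<times> UNIV \<Longrightarrow> digit_address b x ` A \<subseteq> idx"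
  using digit_address_idx by fastforce

lemma prob_perms_eq:
  assumes "finite J" "J \<subseteq> idx" "\<sigma> \<in> PiE J (\<lambda>_. perms b)"
  shows "prob {\<omega>\<in>space M. \<forall>c\<in>J. perm_at \<omega> c = \<sigma> c} = (1 / real (card (perms b))) ^ card J"
proof (cases "J = {}")
  case False
  have "{\<omega>\<in>space M. \<forall>c\<in>J. perm_at \<omega> c = \<sigma> c} = (\<Inter>c\<in>J. (\<lambda>\<omega>. perm_at \<omega> c) -` {\<sigma> c} \<inter> space M)"
    using False by auto
  also have "prob \<dots> = (\<Prod>c\<in>J. prob ((\<lambda>\<omega>. perm_at \<omega> c) -` {\<sigma> c} \<inter> space M))"
    using assms False by (intro indep_varsD[OF indep_perms]) auto
  also have "\<dots> = (\<Prod>c\<in>J. 1 / real (card (perms b)))"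
    using assms by (intro prod.cong refl) (subst prob_perm_at, auto)
  finally show ?thesis by simp
qed (simp add: prob_space)

text \<open>A function of finitely many permutations takes finitely many values, and by independence
  all configurations are equally likely, so its expectation is a plain average over a finite
  set.\<close>

lemma perms_integral:
  fixes F :: "(nat \<times> nat list \<Rightarrow> nat \<Rightarrow> nat) \<Rightarrow> real"
  assumes J: "finite J" "J \<subseteq> idx" and F: "depends_on F J"
  shows "integrable M (\<lambda>\<omega>. F (perm_at \<omega>))"
    and "expectation (\<lambda>\<omega>. F (perm_at \<omega>)) =
      (\<Sum>\<sigma>\<in>PiE J (\<lambda>_. perms b). F \<sigma>) * (1 / real (card (perms b))) ^ card J"
proof -
  let ?S = "PiE J (\<lambda>_. perms b)"
  let ?E = "\<lambda>\<sigma>. {\<omega>\<in>space M. \<forall>c\<in>J. perm_at \<omega> c = \<sigma> c}"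
  have fin: "finite ?S" using J(1) finite_perms by (intro finite_PiE) auto
  have eq: "F (perm_at \<omega>) = (\<Sum>\<sigma>\<in>?S. F \<sigma> * indicator (?E \<sigma>) \<omega>)" if w: "\<omega> \<in> space M" for \<omega>
  proof -
    let ?\<sigma> = "restrict (perm_at \<omega>) J"
    have S: "?\<sigma> \<in> ?S" using w J perm_at_perms by auto
    have "(\<Sum>\<sigma>\<in>?S. F \<sigma> * indicator (?E \<sigma>) \<omega>) = (\<Sum>\<sigma>\<in>{?\<sigma>}. F \<sigma> * indicator (?E \<sigma>) \<omega>)"
    proof (rule sum.mono_neutral_right[OF fin])
      show "{?\<sigma>} \<subseteq> ?S" using S by simp
      show "\<forall>\<sigma>\<in>?S - {?\<sigma>}. F \<sigma> * indicator (?E \<sigma>) \<omega> = 0"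
      proof
        fix \<sigma> assume s: "\<sigma> \<in> ?S - {?\<sigma>}"
        have "\<omega> \<notin> ?E \<sigma>"
        proof
          assume "\<omega> \<in> ?E \<sigma>"
          then have "\<sigma> = ?\<sigma>" using s S by (intro PiE_ext[of \<sigma> J _ ?\<sigma>]) auto
          with s show False by simp
        qed
        then show "F \<sigma> * indicator (?E \<sigma>) \<omega> = 0" by simp
      qed
    qed
    also have "\<dots> = F ?\<sigma>" using w by simp
    also have "\<dots> = F (perm_at \<omega>)" by (rule depends_onD[OF F]) simp
    finally show ?thesis by simp
  qed
  have meas: "?E \<sigma> \<in> sets M" if "\<sigma> \<in> ?S" for \<sigma>
  proof (intro sets.sets_Collect_finite_All J(1))
    fix c assume c: "c \<in> J"
    have "(\<lambda>\<omega>. perm_at \<omega> c) -` {\<sigma> c} \<inter> space M \<in> sets M"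
      using c J(2) that by (intro measurable_sets[OF measurable_perm_at]) auto
    then show "{\<omega>\<in>space M. perm_at \<omega> c = \<sigma> c} \<in> sets M" by (simp add: vimage_def Int_def conj_commute)
  qed
  have "integrable M (\<lambda>\<omega>. \<Sum>\<sigma>\<in>?S. F \<sigma> * indicator (?E \<sigma>) \<omega>)"
    using meas by (intro Bochner_Integration.integrable_sum integrable_mult_right integrable_real_indicator) (auto simp: less_top[symmetric])
  then show "integrable M (\<lambda>\<omega>. F (perm_at \<omega>))"
    by (subst Bochner_Integration.integrable_cong[OF refl eq]) 
  have "expectation (\<lambda>\<omega>. F (perm_at \<omega>)) = expectation (\<lambda>\<omega>. \<Sum>\<sigma>\<in>?S. F \<sigma> * indicator (?E \<sigma>) \<omega>)"
    by (intro Bochner_Integration.integral_cong refl eq)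
  also have "\<dots> = (\<Sum>\<sigma>\<in>?S. expectation (\<lambda>\<omega>. F \<sigma> * indicator (?E \<sigma>) \<omega>))"
    using meas by (intro Bochner_Integration.integral_sum integrable_mult_right integrable_real_indicator) (auto simp: less_top[symmetric])
  also have "\<dots> = (\<Sum>\<sigma>\<in>?S. F \<sigma> * prob (?E \<sigma>))"
    using meas by (intro sum.cong refl) simp
  also have "\<dots> = (\<Sum>\<sigma>\<in>?S. F \<sigma> * (1 / real (card (perms b))) ^ card J)"
    using J by (intro sum.cong refl) (simp add: prob_perms_eq)
  finally show "expectation (\<lambda>\<omega>. F (perm_at \<omega>)) =
      (\<Sum>\<sigma>\<in>?S. F \<sigma>) * (1 / real (card (perms b))) ^ card J"
    by (simp add: sum_distrib_right)
qed

text \<open>The uniform distribution on a finite group is invariant under translation: composing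
  with \<open>\<tau>\<close> at \<open>c\<close> merely reorders the configurations over which
  \<open>perms_integral\<close> averages.\<close>

lemma expectation_compose_perm:
  fixes F :: "(nat \<times> nat list \<Rightarrow> nat \<Rightarrow> nat) \<Rightarrow> real"
  assumes J: "finite J" "J \<subseteq> idx" and F: "depends_on F J" and c: "c \<in> idx"
    and \<tau>: "\<tau> permutes {..<b}"
  shows "expectation (\<lambda>\<omega>. F (perm_at \<omega>)) = expectation (\<lambda>\<omega>. F ((perm_at \<omega>)(c := \<tau> \<circ> perm_at \<omega> c)))"
proof -
  let ?J = "insert c J" let ?S = "PiE ?J (\<lambda>_. perms b)"
  have J': "finite ?J" "?J \<subseteq> idx" using J c by auto
  have F': "depends_on F ?J" by (rule depends_on_mono[OF F]) auto
  have F'': "depends_on (\<lambda>\<sigma>. F (\<sigma>(c := \<tau> \<circ> \<sigma> c))) ?J"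
    unfolding depends_on_def by (intro allI impI depends_onD[OF F']) auto
  have inv: "inv \<tau> permutes {..<b}" using \<tau> by (rule permutes_inv)
  have "(\<Sum>\<sigma>\<in>?S. F (\<sigma>(c := \<tau> \<circ> \<sigma> c))) = (\<Sum>\<sigma>\<in>?S. F \<sigma>)"
  proof (rule sum.reindex_bij_witness[where i="\<lambda>\<sigma>. \<sigma>(c := inv \<tau> \<circ> \<sigma> c)" and j="\<lambda>\<sigma>. \<sigma>(c := \<tau> \<circ> \<sigma> c)"])
    fix \<sigma> assume s: "\<sigma> \<in> ?S"
    show "(\<sigma>(c := \<tau> \<circ> \<sigma> c))(c := inv \<tau> \<circ> (\<sigma>(c := \<tau> \<circ> \<sigma> c)) c) = \<sigma>"
      using permutes_inv_o(2)[OF \<tau>] by (simp add: comp_assoc[symmetric])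
    show "\<sigma>(c := \<tau> \<circ> \<sigma> c) \<in> ?S"
      using s \<tau> PiE_mem[OF s, of c] by (auto simp: PiE_iff perms_def extensional_def intro: permutes_compose)
    show "(\<sigma>(c := inv \<tau> \<circ> \<sigma> c))(c := \<tau> \<circ> (\<sigma>(c := inv \<tau> \<circ> \<sigma> c)) c) = \<sigma>"
      using permutes_inv_o(1)[OF \<tau>] by (simp add: comp_assoc[symmetric])
    show "\<sigma>(c := inv \<tau> \<circ> \<sigma> c) \<in> ?S"
      using s inv PiE_mem[OF s, of c] by (auto simp: PiE_iff perms_def extensional_def intro: permutes_compose)
  qed simp
  then show ?thesis
    unfolding perms_integral(2)[OF J' F'] perms_integral(2)[OF J' F''] by simp
qed

text \<open>
  Averaging over the rotations of the permutation that produces digit \<open>c\<close> of the first point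
  averages \<open>q\<close> over its coordinate \<open>c\<close> and leaves the second factor unchanged.
\<close>

lemma expectation_scrambled_product_eq_0:
  fixes q r :: "(nat \<times> nat \<Rightarrow> nat) \<Rightarrow> real"
  assumes A: "finite A" "A \<subseteq> {..<s} \<times> UNIV" "depends_on q A"
    and B: "finite B" "B \<subseteq> {..<s} \<times> UNIV" "depends_on r B"
    and c: "c \<in> A" and van: "\<And>x. (\<Sum>v<b. q (x(c := v))) = 0"
    and indep: "c \<notin> B \<or> digit_address b y c \<noteq> digit_address b x c"
  shows "expectation (\<lambda>\<omega>. q (scrambled_digits b (perm_at \<omega>) x) * r (scrambled_digits b (perm_at \<omega>) y)) = 0"
    (is "expectation (\<lambda>\<omega>. ?F (perm_at \<omega>)) = 0")
proof -
  let ?J = "digit_address b x ` A \<union> digit_address b y ` B"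
  let ?a = "digit_address b x c"
  let ?rot = "\<lambda>v \<sigma>. \<sigma>(?a := rotation b v \<circ> \<sigma> ?a)"
  have J: "finite ?J" "?J \<subseteq> idx" using A B address_image_idx by auto
  have F: "depends_on ?F ?J"
    by (intro depends_on_mult depends_on_scrambled_digits A B)
  have a: "?a \<in> idx" using A c by (intro digit_address_idx) auto
  have Frot: "depends_on (\<lambda>\<sigma>. ?F (?rot v \<sigma>)) (insert ?a ?J)" for v
    unfolding depends_on_def by (intro allI impI depends_onD[OF F]) auto
  have aJ: "finite (insert ?a ?J)" "insert ?a ?J \<subseteq> idx" using J a by auto
  \<comment> \<open>Addresses within one point are distinct, so the rotated permutation acts on
    digit \<open>c\<close> of \<open>x\<close> and on no other digit of \<open>x\<close>.\<close>
  have q_eq: "q (scrambled_digits b (?rot v \<sigma>) x)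
      = q ((scrambled_digits b \<sigma> x)(c := rotation b v (scrambled_digits b \<sigma> x c)))" for v \<sigma>
    by (rule depends_onD[OF A(3)])
      (auto simp: scrambled_digits_def dest: injD[OF inj_digit_address])
  \<comment> \<open>A digit of \<open>y\<close> with the address of \<open>c\<close> in
    \<open>x\<close> would have to sit at position \<open>c\<close>, which \<open>indep\<close>
    rules out.\<close>
  have r_eq: "r (scrambled_digits b (?rot v \<sigma>) y) = r (scrambled_digits b \<sigma> y)" for v \<sigma>
  proof (rule depends_onD[OF B(3)])
    fix c' assume "c' \<in> B"
    then have "digit_address b y c' \<noteq> ?a"
      using indep by (metis digit_address_eq_iff prod.exhaust)
    then show "scrambled_digits b (?rot v \<sigma>) y c' = scrambled_digits b \<sigma> y c'"
      by (simp add: scrambled_digits_def)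
  qed
  have "real b * expectation (\<lambda>\<omega>. ?F (perm_at \<omega>))
      = (\<Sum>v<b. expectation (\<lambda>\<omega>. ?F (?rot v (perm_at \<omega>))))"
    using expectation_compose_perm[OF J F a rotation_permutes, symmetric] by simp
  also have "\<dots> = expectation (\<lambda>\<omega>. \<Sum>v<b. ?F (?rot v (perm_at \<omega>)))"
    by (rule Bochner_Integration.integral_sum[symmetric]) (rule perms_integral(1)[OF aJ Frot])
  also have "\<dots> = expectation (\<lambda>\<omega>. 0)"
  proof (rule Bochner_Integration.integral_cong[OF refl])
    fix \<omega> assume w: "\<omega> \<in> space M"
    let ?z = "scrambled_digits b (perm_at \<omega>) x"
    have "digit_array b x c < b"
      using digit_less[OF b_pos] by (simp add: digit_array_def split: prod.split)
    then have less: "?z c < b"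
      using perm_at_perms[OF a w] permutes_in_image[of "perm_at \<omega> ?a" "{..<b}" "digit_array b x c"]
      unfolding scrambled_digits_def perms_def by simp
    show "(\<Sum>v<b. ?F (?rot v (perm_at \<omega>))) = 0"
      unfolding q_eq r_eq sum_distrib_right[symmetric]
      using sum_rotation[OF less, of "\<lambda>v. q (?z(c := v))"] van by simp
  qed
  finally show ?thesis using b by simp
qed

lemma scrambled_digits_less:
  assumes "fst c < s" "\<omega> \<in> space M"
  shows "scrambled_digits b (perm_at \<omega>) x c < b"
proof -
  have "digit_array b x c < b"
    using digit_less[OF b_pos] by (simp add: digit_array_def split: prod.split)
  then show ?thesis
    using perm_at_perms[OF digit_address_idx[OF assms(1)] assms(2), of x]
      permutes_in_image[of "perm_at \<omega> (digit_address b x c)" "{..<b}" "digit_array b x c"]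
    unfolding scrambled_digits_def perms_def by simp
qed

lemma measurable_scrambled_digits:
  assumes "fst c < s"
  shows "(\<lambda>\<omega>. scrambled_digits b (perm_at \<omega>) x c) \<in> M \<rightarrow>\<^sub>M count_space UNIV"
  unfolding scrambled_digits_def
  by (rule measurable_compose[OF measurable_perm_at[OF digit_address_idx[OF assms]]]) simp

text \<open>Digits at different depths use prefixes of different lengths, hence different and
  therefore independent permutations. Each sends a fixed digit to a uniform one.\<close>

lemma prob_scrambled_digits:
  assumes j: "j < s" and y: "\<And>k. y k < b"
  shows "prob {\<omega>\<in>space M. \<forall>k<L. scrambled_digits b (perm_at \<omega>) x (j, k) = y k} = 1 / real b ^ L"
proof (cases "L = 0")
  case False
  let ?a = "\<lambda>k. digit_address b x (j, k)"
  \<comment> \<open>Indexed by the address instead of \<open>k\<close>, as independence is over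
    addresses; the length of the prefix recovers \<open>k\<close>.\<close>
  let ?P = "\<lambda>c. {p\<in>perms b. p (digit_array b x (j, length (snd c))) = y (length (snd c))}"
  have inj: "inj_on ?a {..<L}" by (auto simp: inj_on_def digit_address_eq_iff)
  have len: "length (snd (?a k)) = k" for k by (simp add: digit_address_def)
  have a: "?a k \<in> idx" for k using j by (intro digit_address_idx) simp
  have dig: "digit_array b x c < b" for c
    using digit_less[OF b_pos] by (simp add: digit_array_def split: prod.split)
  have key: "scrambled_digits b (perm_at \<omega>) x (j, k) = y k \<longleftrightarrow> perm_at \<omega> (?a k) \<in> ?P (?a k)"
    if "\<omega> \<in> space M" for \<omega> k
    unfolding len scrambled_digits_def using perm_at_perms[OF a that] by simp
  have "{\<omega>\<in>space M. \<forall>k<L. scrambled_digits b (perm_at \<omega>) x (j, k) = y k}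
      = (\<Inter>k\<in>{..<L}. (\<lambda>\<omega>. perm_at \<omega> (?a k)) -` ?P (?a k) \<inter> space M)"
  proof (rule set_eqI)
    fix \<omega>
    show "\<omega> \<in> {\<omega>\<in>space M. \<forall>k<L. scrambled_digits b (perm_at \<omega>) x (j, k) = y k} \<longleftrightarrow>
        \<omega> \<in> (\<Inter>k\<in>{..<L}. (\<lambda>\<omega>. perm_at \<omega> (?a k)) -` ?P (?a k) \<inter> space M)"
    proof (cases "\<omega> \<in> space M")
      case True
      then show ?thesis using key[OF True] by (simp only: mem_Collect_eq INT_iff vimage_eq Int_iff lessThan_iff) blast
    next
      case notin: False
      have "0 \<in> {..<L}" using False by simp
      then show ?thesis using notin by blast
    qed
  qed
  also have "\<dots> = (\<Inter>c\<in>?a ` {..<L}. (\<lambda>\<omega>. perm_at \<omega> c) -` ?P c \<inter> space M)"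
    by (simp only: image_image)
  finally have "prob {\<omega>\<in>space M. \<forall>k<L. scrambled_digits b (perm_at \<omega>) x (j, k) = y k}
      = prob (\<Inter>c\<in>?a ` {..<L}. (\<lambda>\<omega>. perm_at \<omega> c) -` ?P c \<inter> space M)"
    by (rule arg_cong)
  also have "\<dots> = (\<Prod>c\<in>?a ` {..<L}. prob ((\<lambda>\<omega>. perm_at \<omega> c) -` ?P c \<inter> space M))"
  proof (rule indep_varsD[OF indep_perms])
    show "?a ` {..<L} \<noteq> {}" using False by (simp add: lessThan_empty_iff)
    show "?a ` {..<L} \<subseteq> idx" using a by blast
    show "?P c \<in> sets (count_space (perms b))" for c by (simp only: sets_count_space Pow_iff) blast
  qed simp
  also have "\<dots> = (\<Prod>c\<in>?a ` {..<L}. 1 / real b)"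
  proof (intro prod.cong refl)
    fix c assume "c \<in> ?a ` {..<L}"
    then have "c \<in> idx" using a by auto
    then have "prob ((\<lambda>\<omega>. perm_at \<omega> c) -` ?P c \<inter> space M)
        = real (card (?P c)) / real (card (perms b))" by (rule prob_perm_at) auto
    also have "\<dots> = 1 / real b" by (rule card_perms_eval[OF dig y])
    finally show "prob ((\<lambda>\<omega>. perm_at \<omega> c) -` ?P c \<inter> space M) = 1 / real b" .
  qed
  also have "\<dots> = 1 / real b ^ L" using card_image[OF inj] by (simp add: power_one_over)
  finally show ?thesis .
qed (simp add: prob_space)

definition scrambled_point :: "(nat \<Rightarrow> real) \<Rightarrow> 'w \<Rightarrow> nat \<Rightarrow> real" where
  "scrambled_point x \<omega> = (\<lambda>j\<in>{..<s}. nested_scramble b (\<lambda>w. \<pi> j w \<omega>) (x j))"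

lemma scrambled_point_eq:
  "j < s \<Longrightarrow> scrambled_point x \<omega> j = digit_sum b (\<lambda>k. scrambled_digits b (perm_at \<omega>) x (j, k))"
  by (simp add: scrambled_point_def nested_scramble_eq scrambled_digits_def perm_at_def
      digit_address_def digit_array_def)

lemma distr_scrambled_component:
  assumes j: "j < s"
  shows "distr M borel (\<lambda>\<omega>. scrambled_point x \<omega> j) = unif"
  unfolding scrambled_point_eq[OF j]
  using j by (intro distr_digit_sum prob_space_axioms b measurable_scrambled_digits
      prob_scrambled_digits scrambled_digits_less) auto

lemma measurable_scrambled_component:
  "j < s \<Longrightarrow> (\<lambda>\<omega>. scrambled_point x \<omega> j) \<in> borel_measurable M"
proof -
  assume j: "j < s"
  note measurable_scrambled_digits[of "(j, _)" x, simplified, OF j, measurable]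
  show ?thesis unfolding scrambled_point_eq[OF j] digit_sum_def by measurable
qed

text \<open>Coordinate \<open>j\<close> reads only permutations whose first index is
  \<open>j\<close>, and functions of disjoint blocks of an independent family are
  independent.\<close>

lemma indep_scrambled_components:
  "indep_vars (\<lambda>_. borel) (\<lambda>j \<omega>. scrambled_point x \<omega> j) {..<s}"
proof -
  let ?K = "\<lambda>j. {j} \<times> lists {..<b}"
  let ?X = "\<lambda>j \<omega>. restrict (perm_at \<omega>) (?K j)"
  let ?g = "\<lambda>j \<sigma>. digit_sum b (\<lambda>k. scrambled_digits b \<sigma> x (j, k))"
  have "indep_vars (\<lambda>j. PiM (?K j) (\<lambda>_. count_space (perms b))) ?X {..<s}"
    by (rule indep_vars_restrict[OF indep_perms]) (auto simp: idx_def disjoint_family_on_def)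
  then have "indep_vars (\<lambda>_. borel) (\<lambda>j \<omega>. ?g j (?X j \<omega>)) {..<s}"
  proof (rule indep_vars_compose2)
    fix j assume "j \<in> {..<s}"
    have "(\<lambda>\<sigma>. scrambled_digits b \<sigma> x (j, k))
        \<in> PiM (?K j) (\<lambda>_. count_space (perms b)) \<rightarrow>\<^sub>M count_space UNIV" for k
      unfolding scrambled_digits_def
      by (rule measurable_compose[OF measurable_component_singleton])
        (auto simp: digit_address_def digits_in_lists[OF b_pos] simp del: in_lists_conv_set)
    note this[measurable]
    show "?g j \<in> borel_measurable (PiM (?K j) (\<lambda>_. count_space (perms b)))"
      unfolding digit_sum_def by measurable
  qed
  also have "?this \<longleftrightarrow> ?thesis"
  proof (rule indep_vars_cong[OF refl _ refl])
    fix j assume "j \<in> {..<s}"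
    then show "(\<lambda>\<omega>. ?g j (?X j \<omega>)) = (\<lambda>\<omega>. scrambled_point x \<omega> j)"
      using digits_in_lists[OF b_pos]
      by (auto simp: scrambled_point_eq scrambled_digits_def digit_address_def fun_eq_iff
          simp del: in_lists_conv_set)
  qed
  finally show ?thesis .
qed

lemma distr_scrambled_point:
  "distr M (\<Pi>\<^sub>M j\<in>{..<s}. borel) (scrambled_point x) = uniform_point s"
proof -
  have ne: "{..<s} \<noteq> {}" using s by (auto simp: lessThan_empty_iff)
  have "distr M (\<Pi>\<^sub>M j\<in>{..<s}. borel) (\<lambda>\<omega>. \<lambda>j\<in>{..<s}. scrambled_point x \<omega> j)
      = (\<Pi>\<^sub>M j\<in>{..<s}. distr M borel (\<lambda>\<omega>. scrambled_point x \<omega> j))"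
    using indep_scrambled_components[of x]
    by (subst (asm) indep_vars_iff_distr_eq_PiM'[OF ne]) (auto intro: measurable_scrambled_component)
  also have "\<dots> = uniform_point s"
    unfolding uniform_point_def by (rule PiM_cong) (auto simp: distr_scrambled_component)
  also have "(\<lambda>\<omega>. \<lambda>j\<in>{..<s}. scrambled_point x \<omega> j) = scrambled_point x"
    by (auto simp: scrambled_point_def fun_eq_iff)
  finally show ?thesis .
qed

lemma measurable_scrambled_point: "scrambled_point x \<in> M \<rightarrow>\<^sub>M (\<Pi>\<^sub>M j\<in>{..<s}. borel)"
proof (rule measurable_PiM_single')
  show "scrambled_point x \<in> space M \<rightarrow> {..<s} \<rightarrow>\<^sub>E space borel"
    unfolding scrambled_point_def by auto
qed (auto intro: measurable_scrambled_component)

text \<open>Each coordinate is uniform, so almost surely it avoids the countable set on which series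
  and floor digits may differ.\<close>

lemma AE_digit_array_scrambled_point:
  "AE \<omega> in M. \<forall>j<s. \<forall>k. digit_array b (scrambled_point x \<omega>) (j, k) = scrambled_digits b (perm_at \<omega>) x (j, k)"
proof -
  have "AE \<omega> in M. scrambled_point x \<omega> j \<notin> adic_rats b" if j: "j < s" for j
  proof (rule AE_distrD[OF measurable_scrambled_component[OF j]])
    show "AE u in distr M borel (\<lambda>\<omega>. scrambled_point x \<omega> j). u \<notin> adic_rats b"
      unfolding distr_scrambled_component[OF j]
      by (rule AE_unif_not_countable[OF countable_adic_rats])
  qed
  then have "AE \<omega> in M. \<forall>j\<in>{..<s}. scrambled_point x \<omega> j \<notin> adic_rats b"
    by (intro AE_finite_allI) auto
  then show ?thesis
    using AE_space
  proof eventually_elim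
    case (elim \<omega>)
    then show ?case
      using digit_digit_sum[OF b, of "\<lambda>k. scrambled_digits b (perm_at \<omega>) x (_, k)"]
      by (auto simp: digit_array_def scrambled_point_eq scrambled_digits_less)
  qed
qed

end

section \<open>Nets\<close>

text \<open>Serves to shorten digit prefixes to a total length at which equidistribution of the net
  can be applied.\<close>

lemma exists_le_with_sum:
  fixes \<kappa> :: "nat \<Rightarrow> nat"
  assumes "N \<le> (\<Sum>j<s. \<kappa> j)"
  shows "\<exists>\<kappa>'. (\<forall>j<s. \<kappa>' j \<le> \<kappa> j) \<and> (\<Sum>j<s. \<kappa>' j) = N"
  using assms
proof (induction s arbitrary: N)
  case (Suc s)
  have "N - min N (\<kappa> s) \<le> (\<Sum>j<s. \<kappa> j)" using Suc.prems by simp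
  from Suc.IH[OF this] obtain \<kappa>' where k: "\<forall>j<s. \<kappa>' j \<le> \<kappa> j" "(\<Sum>j<s. \<kappa>' j) = N - min N (\<kappa> s)"
    by blast
  have "(\<Sum>j<Suc s. (\<kappa>'(s := min N (\<kappa> s))) j) = (\<Sum>j<s. \<kappa>' j) + min N (\<kappa> s)" by simp
  then show ?case using k by (intro exI[of _ "\<kappa>'(s := min N (\<kappa> s))"]) (auto simp: less_Suc_eq)
qed simp

definition same_prefix :: "nat \<Rightarrow> nat \<Rightarrow> (nat \<Rightarrow> nat) \<Rightarrow> (nat \<Rightarrow> real) \<Rightarrow> (nat \<Rightarrow> real) \<Rightarrow> bool" where
  "same_prefix b s \<kappa> x y \<longleftrightarrow> (\<forall>j<s. digits b (x j) (\<kappa> j) = digits b (y j) (\<kappa> j))"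

lemma digits_eq_mono: "k \<le> l \<Longrightarrow> digits b x l = digits b y l \<Longrightarrow> digits b x k = digits b y k"
proof (induction l rule: dec_induct)
  case (step l)
  then show ?case by (simp add: digits_Suc)
qed

locale digital_net =
  fixes b t m s :: nat and a :: "nat \<Rightarrow> nat \<Rightarrow> real"
  assumes base: "b \<ge> 2" and dim: "s \<ge> 1" and net: "is_net b t m s a"
begin

lemma base_pos: "b > 0"
  using base by simp

lemma t_le_m: "t \<le> m"
  using net by (simp add: is_net_def)

lemma point_in: "i < b ^ m \<Longrightarrow> j < s \<Longrightarrow> a i j \<in> {0..<1}"
  using net unfolding is_net_def by (blast dest: PiE_mem)

lemma in_adic_box_iff:
  assumes "i < b ^ m"
  shows "a i \<in> adic_box b s \<kappa> c \<longleftrightarrow> (\<forall>j<s. \<lfloor>a i j * real b ^ \<kappa> j\<rfloor> = int (c j))"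
proof -
  have ext: "a i \<in> extensional {..<s}"
    using net assms unfolding is_net_def PiE_def by blast
  have pos: "real b ^ k > 0" for k using base by simp
  have "a i j \<in> {real (c j) / real b ^ \<kappa> j ..< (real (c j) + 1) / real b ^ \<kappa> j}
      \<longleftrightarrow> \<lfloor>a i j * real b ^ \<kappa> j\<rfloor> = int (c j)" for j
    using pos[of "\<kappa> j"] by (simp add: floor_eq_iff pos_divide_le_eq pos_less_divide_eq)
  then show ?thesis using ext by (auto simp: adic_box_def PiE_iff)
qed

lemma measure_adic_box:
  "measure (vol s) (adic_box b s \<kappa> c) = 1 / real b ^ (\<Sum>j<s. \<kappa> j)"
proof -
  interpret product_sigma_finite "\<lambda>_. lborel :: real measure"
    by (simp add: product_sigma_finite_def sigma_finite_lborel)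
  have "emeasure (vol s) (adic_box b s \<kappa> c) = (\<Prod>j<s. ennreal (1 / real b ^ \<kappa> j))"
    unfolding vol_def adic_box_def using base
    by (subst emeasure_PiM) (auto simp: divide_right_mono diff_divide_distrib[symmetric])
  also have "\<dots> = ennreal (\<Prod>j<s. 1 / real b ^ \<kappa> j)" by (rule prod_ennreal) simp
  finally have "measure (vol s) (adic_box b s \<kappa> c) = (\<Prod>j<s. 1 / real b ^ \<kappa> j)"
    by (simp add: measure_def prod_nonneg)
  then show ?thesis by (simp add: prod_dividef power_sum)
qed

text \<open>The net property speaks only of boxes with exactly \<open>m - t\<close> digits fixed. A
  larger box is cut along coordinate 0 into \<open>b\<close> boxes with one more fixed digit, and
  the counts add up; hence the induction on the number of missing digits.\<close>

lemma card_box: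
  assumes "(\<Sum>j<s. \<kappa> j) \<le> m - t" "\<And>j. j < s \<Longrightarrow> c j < b ^ \<kappa> j"
  shows "card {i. i < b ^ m \<and> (\<forall>j<s. \<lfloor>a i j * real b ^ \<kappa> j\<rfloor> = int (c j))} = b ^ (m - (\<Sum>j<s. \<kappa> j))"
  using assms
proof (induction "m - t - (\<Sum>j<s. \<kappa> j)" arbitrary: \<kappa> c)
  case 0
  then have sum: "(\<Sum>j<s. \<kappa> j) = m - t" by simp
  have "measure (vol s) (adic_box b s \<kappa> c) = real b ^ t / real b ^ m"
    unfolding measure_adic_box sum using t_le_m base by (simp add: power_diff)
  then have "card {i. i < b ^ m \<and> a i \<in> adic_box b s \<kappa> c} = b ^ t"
    using net 0 unfolding is_net_def by blast
  then show ?case using in_adic_box_iff t_le_m unfolding sum by (simp cong: conj_cong)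
next
  case (Suc r)
  let ?\<kappa> = "\<kappa>(0 := Suc (\<kappa> 0))"
  let ?c = "\<lambda>v. c(0 := b * c 0 + v)"
  have "(\<Sum>j<s. ?\<kappa> j) = (\<Sum>j<s. \<kappa> j + (if j = 0 then 1 else 0))"
    by (intro sum.cong) auto
  also have "\<dots> = Suc (\<Sum>j<s. \<kappa> j)" using dim by (simp add: sum.distrib)
  finally have sum: "(\<Sum>j<s. ?\<kappa> j) = Suc (\<Sum>j<s. \<kappa> j)" .
  let ?S = "\<lambda>v. {i. i < b ^ m \<and> (\<forall>j<s. \<lfloor>a i j * real b ^ ?\<kappa> j\<rfloor> = int (?c v j))}"
  have card: "card (?S v) = b ^ (m - Suc (\<Sum>j<s. \<kappa> j))" if v: "v < b" for v
  proof -
    have "?c v j < b ^ ?\<kappa> j" if "j < s" for j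
    proof (cases "j = 0")
      case True
      have "b * c 0 + v < b * (c 0 + 1)" using v by simp
      also have "\<dots> \<le> b * b ^ \<kappa> 0" using Suc.prems(2)[of 0] dim by (intro mult_left_mono) auto
      finally show ?thesis using True by simp
    qed (use Suc.prems that in auto)
    then show ?thesis using Suc.hyps Suc.prems sum by (subst Suc.hyps(1)) auto
  qed
  have eq: "{i. i < b ^ m \<and> (\<forall>j<s. \<lfloor>a i j * real b ^ \<kappa> j\<rfloor> = int (c j))} = (\<Union>v<b. ?S v)"
  proof (intro set_eqI iffI)
    fix i assume i: "i \<in> {i. i < b ^ m \<and> (\<forall>j<s. \<lfloor>a i j * real b ^ \<kappa> j\<rfloor> = int (c j))}"
    let ?v = "digit b (Suc (\<kappa> 0)) (a i 0)"
    have "\<lfloor>a i 0 * real b ^ \<kappa> 0\<rfloor> = int (c 0)" using i dim by auto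
    then have "\<lfloor>a i 0 * real b ^ Suc (\<kappa> 0)\<rfloor> = int (b * c 0 + ?v)"
      unfolding floor_power_Suc[OF base_pos] by simp
    then have "i \<in> ?S ?v" using i by simp
    then show "i \<in> (\<Union>v<b. ?S v)" using digit_less[OF base_pos] by blast
  next
    fix i assume "i \<in> (\<Union>v<b. ?S v)"
    then obtain v where v: "v < b" "i < b ^ m" "\<And>j. j < s \<Longrightarrow> \<lfloor>a i j * real b ^ ?\<kappa> j\<rfloor> = int (?c v j)"
      by auto
    have "int b * \<lfloor>a i 0 * real b ^ \<kappa> 0\<rfloor> + int (digit b (Suc (\<kappa> 0)) (a i 0)) = int b * int (c 0) + int v"
      using v(3)[of 0] dim unfolding floor_power_Suc[OF base_pos, symmetric] by simp
    then have "(int b * \<lfloor>a i 0 * real b ^ \<kappa> 0\<rfloor> + int (digit b (Suc (\<kappa> 0)) (a i 0))) div int b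
        = (int b * int (c 0) + int v) div int b" by simp
    then have "\<lfloor>a i 0 * real b ^ \<kappa> 0\<rfloor> = int (c 0)"
      using digit_less[OF base_pos] v(1) base_pos by simp
    then have "\<forall>j<s. \<lfloor>a i j * real b ^ \<kappa> j\<rfloor> = int (c j)"
      using v(3) by (metis fun_upd_apply)
    then show "i \<in> {i. i < b ^ m \<and> (\<forall>j<s. \<lfloor>a i j * real b ^ \<kappa> j\<rfloor> = int (c j))}" using v(2) by simp
  qed
  have "card {i. i < b ^ m \<and> (\<forall>j<s. \<lfloor>a i j * real b ^ \<kappa> j\<rfloor> = int (c j))} = card (\<Union>v<b. ?S v)"
    using eq by (rule arg_cong)
  also have "\<dots> = (\<Sum>v<b. card (?S v))"
  proof (rule card_UN_disjoint)
    show "\<forall>v\<in>{..<b}. \<forall>v'\<in>{..<b}. v \<noteq> v' \<longrightarrow> ?S v \<inter> ?S v' = {}"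
    proof (intro ballI impI)
      fix v v' :: nat assume vv: "v \<noteq> v'"
      have "?c v 0 = ?c v' 0" if "i \<in> ?S v" "i \<in> ?S v'" for i
      proof -
        have "0 < s" using dim by simp
        then have "\<lfloor>a i 0 * real b ^ ?\<kappa> 0\<rfloor> = int (?c v 0)" "\<lfloor>a i 0 * real b ^ ?\<kappa> 0\<rfloor> = int (?c v' 0)"
          using that by blast+
        then show ?thesis by linarith
      qed
      then show "?S v \<inter> ?S v' = {}" using vv by fastforce
    qed
  qed auto
  also have "\<dots> = (\<Sum>v<b. b ^ (m - Suc (\<Sum>j<s. \<kappa> j)))"
    by (intro sum.cong refl card) simp
  also have "\<dots> = b * b ^ (m - Suc (\<Sum>j<s. \<kappa> j))" by simp
  also have "\<dots> = b ^ (m - (\<Sum>j<s. \<kappa> j))"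
  proof -
    have "m - (\<Sum>j<s. \<kappa> j) = Suc (m - Suc (\<Sum>j<s. \<kappa> j))" using Suc.hyps(2) by linarith
    then show ?thesis by simp
  qed
  finally show ?case .
qed

lemma floor_less_power:
  assumes "x \<in> {0..<1::real}"
  shows "nat \<lfloor>x * real b ^ k\<rfloor> < b ^ k" "0 \<le> \<lfloor>x * real b ^ k\<rfloor>"
proof -
  have "x * real b ^ k < real (b ^ k)" using assms base by simp
  then have "\<lfloor>x * real b ^ k\<rfloor> < int (b ^ k)" by (simp add: floor_less_iff)
  moreover show "0 \<le> \<lfloor>x * real b ^ k\<rfloor>" using assms by simp
  ultimately show "nat \<lfloor>x * real b ^ k\<rfloor> < b ^ k" by linarith
qed

lemma card_same_prefix:
  assumes i: "i < b ^ m" and \<kappa>: "(\<Sum>j<s. \<kappa> j) \<le> m - t"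
  shows "card {i'. i' < b ^ m \<and> same_prefix b s \<kappa> (a i) (a i')} = b ^ (m - (\<Sum>j<s. \<kappa> j))"
proof -
  let ?c = "\<lambda>j. nat \<lfloor>a i j * real b ^ \<kappa> j\<rfloor>"
  have "same_prefix b s \<kappa> (a i) (a i') \<longleftrightarrow> (\<forall>j<s. \<lfloor>a i' j * real b ^ \<kappa> j\<rfloor> = int (?c j))"
    if "i' < b ^ m" for i'
    unfolding same_prefix_def
    using digits_eq_iff[OF base_pos point_in[OF i] point_in[OF that]] floor_less_power(2)[OF point_in[OF i]]
    by auto
  then have "{i'. i' < b ^ m \<and> same_prefix b s \<kappa> (a i) (a i')}
      = {i'. i' < b ^ m \<and> (\<forall>j<s. \<lfloor>a i' j * real b ^ \<kappa> j\<rfloor> = int (?c j))}" by blast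
  then show ?thesis
    using card_box[OF \<kappa>, of ?c] floor_less_power(1)[OF point_in[OF i]] by simp
qed

text \<open>Fixing the next digit of coordinate \<open>j0\<close> refines the box once, so the count
  is the same for every \<open>v\<close>. This is what makes contributions cancel in
  \<open>sum_scrambled_digits_eq_0\<close>.\<close>

lemma card_same_prefix_digit:
  assumes i: "i < b ^ m" and \<kappa>: "Suc (\<Sum>j<s. \<kappa> j) \<le> m - t" and j: "j0 < s" and v: "v < b"
  shows "card {i'. i' < b ^ m \<and> same_prefix b s \<kappa> (a i) (a i') \<and> digit b (Suc (\<kappa> j0)) (a i' j0) = v}
    = b ^ (m - Suc (\<Sum>j<s. \<kappa> j))"
proof -
  let ?\<kappa> = "\<kappa>(j0 := Suc (\<kappa> j0))"
  let ?f = "\<lambda>j. nat \<lfloor>a i j * real b ^ \<kappa> j\<rfloor>"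
  let ?c = "?f(j0 := b * ?f j0 + v)"
  have "(\<Sum>j<s. ?\<kappa> j) = (\<Sum>j<s. \<kappa> j + (if j = j0 then 1 else 0))"
    by (intro sum.cong) auto
  also have "\<dots> = Suc (\<Sum>j<s. \<kappa> j)" using j by (simp add: sum.distrib)
  finally have sum: "(\<Sum>j<s. ?\<kappa> j) = Suc (\<Sum>j<s. \<kappa> j)" .
  have less: "?c j < b ^ ?\<kappa> j" if "j < s" for j
  proof (cases "j = j0")
    case True
    have "b * ?f j0 + v < b * (?f j0 + 1)" using v by simp
    also have "\<dots> \<le> b * b ^ \<kappa> j0" using floor_less_power(1)[OF point_in[OF i j], of "\<kappa> j0"] by (intro mult_left_mono) auto
    finally show ?thesis using True by simp
  qed (use floor_less_power(1)[OF point_in[OF i]] that in auto)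
  have "same_prefix b s \<kappa> (a i) (a i') \<and> digit b (Suc (\<kappa> j0)) (a i' j0) = v \<longleftrightarrow>
      (\<forall>j<s. \<lfloor>a i' j * real b ^ ?\<kappa> j\<rfloor> = int (?c j))" (is "?L \<longleftrightarrow> ?R")
    if i': "i' < b ^ m" for i'
  proof -
    have sp: "same_prefix b s \<kappa> (a i) (a i') \<longleftrightarrow> (\<forall>j<s. \<lfloor>a i' j * real b ^ \<kappa> j\<rfloor> = int (?f j))"
      unfolding same_prefix_def
      using digits_eq_iff[OF base_pos point_in[OF i] point_in[OF i']] floor_less_power(2)[OF point_in[OF i]]
      by auto
    have j0: "\<lfloor>a i' j0 * real b ^ Suc (\<kappa> j0)\<rfloor> = int (b * ?f j0 + v) \<longleftrightarrow>
        \<lfloor>a i' j0 * real b ^ \<kappa> j0\<rfloor> = int (?f j0) \<and> digit b (Suc (\<kappa> j0)) (a i' j0) = v"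
    proof
      assume "\<lfloor>a i' j0 * real b ^ Suc (\<kappa> j0)\<rfloor> = int (b * ?f j0 + v)"
      then have e: "int b * \<lfloor>a i' j0 * real b ^ \<kappa> j0\<rfloor> + int (digit b (Suc (\<kappa> j0)) (a i' j0))
          = int b * int (?f j0) + int v"
        unfolding floor_power_Suc[OF base_pos] by simp
      then have "(int b * \<lfloor>a i' j0 * real b ^ \<kappa> j0\<rfloor> + int (digit b (Suc (\<kappa> j0)) (a i' j0))) div int b
          = (int b * int (?f j0) + int v) div int b" by (rule arg_cong)
      then have "\<lfloor>a i' j0 * real b ^ \<kappa> j0\<rfloor> = int (?f j0)"
        using digit_less[OF base_pos] v base_pos by simp
      then show "\<lfloor>a i' j0 * real b ^ \<kappa> j0\<rfloor> = int (?f j0) \<and> digit b (Suc (\<kappa> j0)) (a i' j0) = v"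
        using e by simp
    next
      assume "\<lfloor>a i' j0 * real b ^ \<kappa> j0\<rfloor> = int (?f j0) \<and> digit b (Suc (\<kappa> j0)) (a i' j0) = v"
      then show "\<lfloor>a i' j0 * real b ^ Suc (\<kappa> j0)\<rfloor> = int (b * ?f j0 + v)"
        unfolding floor_power_Suc[OF base_pos] by simp
    qed
    have "?R \<longleftrightarrow> \<lfloor>a i' j0 * real b ^ Suc (\<kappa> j0)\<rfloor> = int (b * ?f j0 + v) \<and>
        (\<forall>j<s. j \<noteq> j0 \<longrightarrow> \<lfloor>a i' j * real b ^ \<kappa> j\<rfloor> = int (?f j))"
      using j by (auto simp del: of_nat_add of_nat_mult power_Suc)
    then show ?thesis unfolding sp j0 using j by blast
  qed
  then have "{i'. i' < b ^ m \<and> same_prefix b s \<kappa> (a i) (a i') \<and> digit b (Suc (\<kappa> j0)) (a i' j0) = v}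
      = {i'. i' < b ^ m \<and> (\<forall>j<s. \<lfloor>a i' j * real b ^ ?\<kappa> j\<rfloor> = int (?c j))}" by blast
  then show ?thesis
    using card_box[of ?\<kappa> ?c] less \<kappa> sum by simp
qed

text \<open>
  Points that share all relevant digits except digit \<open>(j0, \<kappa> j0)\<close> are equidistributed with respect
  to that digit, so their contributions cancel.
\<close>

lemma sum_scrambled_digits_eq_0:
  fixes q :: "(nat \<times> nat \<Rightarrow> nat) \<Rightarrow> real"
  assumes q: "depends_on q A" and van: "\<And>x. (\<Sum>v<b. q (x((j0, \<kappa> j0) := v))) = 0"
    and A: "\<And>j k. (j, k) \<in> A \<Longrightarrow> j < s \<and> ((j, k) = (j0, \<kappa> j0) \<or> k < \<kappa> j)"
    and \<kappa>: "Suc (\<Sum>j<s. \<kappa> j) \<le> m - t" and j: "j0 < s"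
    and \<sigma>: "\<And>w. w \<in> lists {..<b} \<Longrightarrow> \<sigma> (j0, w) permutes {..<b}"
  shows "(\<Sum>i<b ^ m. q (scrambled_digits b \<sigma> (a i))) = 0"
proof -
  let ?G = "\<lambda>i. q (scrambled_digits b \<sigma> (a i))"
  let ?pre = "\<lambda>i. \<lambda>j\<in>{..<s}. digits b (a i j) (\<kappa> j)"
  let ?c = "(j0, \<kappa> j0)"
  have fiber: "(\<Sum>i'\<in>{i'\<in>{..<b ^ m}. ?pre i' = y}. ?G i') = 0" if "y \<in> ?pre ` {..<b ^ m}" for y
  proof -
    from that obtain i where i: "i < b ^ m" "y = ?pre i" by auto
    have pre: "?pre i' = y \<longleftrightarrow> same_prefix b s \<kappa> (a i) (a i')" for i'
      unfolding i(2) same_prefix_def by (auto simp: fun_eq_iff restrict_def)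
    let ?F = "{i'. i' < b ^ m \<and> same_prefix b s \<kappa> (a i) (a i')}"
    let ?d = "\<lambda>i'. digit b (Suc (\<kappa> j0)) (a i' j0)"
    let ?z = "scrambled_digits b \<sigma> (a i)"
    let ?p = "\<sigma> (digit_address b (a i) ?c)"
    have p: "?p permutes {..<b}"
      unfolding digit_address_def using \<sigma> digits_in_lists[OF base_pos] by simp
    \<comment> \<open>All points in the fibre share the permutations for every digit in
      \<open>A\<close>. They also share the digits that these act on, except at
      \<open>?c\<close>.\<close>
    have G: "?G i' = q (?z(?c := ?p (?d i')))" if "i' \<in> ?F" for i'
    proof (rule depends_onD[OF q])
      fix c assume "c \<in> A"
      moreover obtain j k where c: "c = (j, k)" by (cases c)
      ultimately have jk: "j < s" "(j, k) = ?c \<or> k < \<kappa> j" using A by auto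
      have pj: "digits b (a i j) (\<kappa> j) = digits b (a i' j) (\<kappa> j)"
        using that jk unfolding same_prefix_def by auto
      show "scrambled_digits b \<sigma> (a i') c = (?z(?c := ?p (?d i'))) c"
      proof (cases "(j, k) = ?c")
        case True
        then show ?thesis using pj by (simp add: c scrambled_digits_def digit_address_def digit_array_def)
      next
        case False
        then have "Suc k \<le> \<kappa> j" using jk by auto
        from digits_eq_mono[OF this pj]
        show ?thesis using False
          by (auto simp: c scrambled_digits_def digit_address_def digit_array_def digits_Suc)
      qed
    qed
    have "(\<Sum>i'\<in>{i'\<in>{..<b ^ m}. ?pre i' = y}. ?G i') = (\<Sum>i'\<in>?F. ?G i')"
      unfolding pre by (intro sum.cong) auto
    also have "\<dots> = (\<Sum>v<b. \<Sum>i'\<in>{i'\<in>?F. ?d i' = v}. ?G i')"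
      using digit_less[OF base_pos] by (intro sum.group[symmetric]) auto
    also have "\<dots> = (\<Sum>v<b. \<Sum>i'\<in>{i'\<in>?F. ?d i' = v}. q (?z(?c := ?p v)))"
      using G by (intro sum.cong) auto
    also have "\<dots> = (\<Sum>v<b. real (b ^ (m - Suc (\<Sum>j<s. \<kappa> j))) * q (?z(?c := ?p v)))"
    proof (intro sum.cong refl)
      fix v assume "v \<in> {..<b}"
      then have "card {i'\<in>?F. ?d i' = v} = b ^ (m - Suc (\<Sum>j<s. \<kappa> j))"
        using card_same_prefix_digit[OF i(1) \<kappa> j, of v] by (simp add: conj_assoc)
      then show "(\<Sum>i'\<in>{i'\<in>?F. ?d i' = v}. q (?z(?c := ?p v)))
          = real (b ^ (m - Suc (\<Sum>j<s. \<kappa> j))) * q (?z(?c := ?p v))" by simp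
    qed
    also have "\<dots> = real (b ^ (m - Suc (\<Sum>j<s. \<kappa> j))) * (\<Sum>v<b. q (?z(?c := ?p v)))"
      by (simp add: sum_distrib_left)
    \<comment> \<open>The sum runs over all digit values, so the permutation only reorders
      it.\<close>
    also have "(\<Sum>v<b. q (?z(?c := ?p v))) = (\<Sum>v<b. q (?z(?c := v)))"
      by (rule sum.reindex_bij_betw[OF permutes_imp_bij[OF p]])
    also have "\<dots> = 0" by (rule van)
    finally show ?thesis by (simp only: mult_zero_right)
  qed
  have "(\<Sum>i<b ^ m. ?G i) = (\<Sum>y\<in>?pre ` {..<b ^ m}. \<Sum>i'\<in>{i'\<in>{..<b ^ m}. ?pre i' = y}. ?G i')"
    by (rule sum.image_gen) simp
  then show ?thesis using fiber by simp
qed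

end

section \<open>Scrambled nets\<close>

lemma (in prob_space) expectation_sum_orthogonal:
  fixes f :: "'i \<Rightarrow> 'a \<Rightarrow> real"
  assumes K: "finite K"
    and int: "\<And>A B. A \<in> K \<Longrightarrow> B \<in> K \<Longrightarrow> integrable M (\<lambda>\<omega>. f A \<omega> * f B \<omega>)"
    and orth: "\<And>A B. A \<in> K \<Longrightarrow> B \<in> K \<Longrightarrow> A \<noteq> B \<Longrightarrow> expectation (\<lambda>\<omega>. f A \<omega> * f B \<omega>) = 0"
  shows "expectation (\<lambda>\<omega>. (\<Sum>A\<in>K. f A \<omega>)\<^sup>2) = (\<Sum>A\<in>K. expectation (\<lambda>\<omega>. (f A \<omega>)\<^sup>2))"
proof -
  have "expectation (\<lambda>\<omega>. (\<Sum>A\<in>K. f A \<omega>)\<^sup>2) = expectation (\<lambda>\<omega>. \<Sum>A\<in>K. \<Sum>B\<in>K. f A \<omega> * f B \<omega>)"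
    by (simp add: power2_eq_square sum_product)
  also have "\<dots> = (\<Sum>A\<in>K. \<Sum>B\<in>K. expectation (\<lambda>\<omega>. f A \<omega> * f B \<omega>))"
    using int by (subst Bochner_Integration.integral_sum; (intro sum.cong refl Bochner_Integration.integral_sum Bochner_Integration.integrable_sum)?) auto
  also have "\<dots> = (\<Sum>A\<in>K. \<Sum>B\<in>K. if A = B then expectation (\<lambda>\<omega>. (f A \<omega>)\<^sup>2) else 0)"
    using orth by (intro sum.cong refl) (auto simp: power2_eq_square)
  also have "\<dots> = (\<Sum>A\<in>K. expectation (\<lambda>\<omega>. (f A \<omega>)\<^sup>2))"
    using K by (simp add: sum.delta)
  finally show ?thesis .
qed

text \<open>The number of leading digits of coordinate \<open>j\<close> that cover those in
  \<open>A\<close>. Positions count from 0, so the last of them sits at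
  \<open>level A j - 1\<close>.\<close>

definition level :: "(nat \<times> nat) set \<Rightarrow> nat \<Rightarrow> nat" where
  "level A j = (if \<exists>k. (j, k) \<in> A then Suc (Max {k. (j, k) \<in> A}) else 0)"

lemma finite_section: "finite A \<Longrightarrow> finite {k. (j, k) \<in> A}"
  by (rule finite_subset[of _ "snd ` A"]) force+

lemma less_level: "finite A \<Longrightarrow> (j, k) \<in> A \<Longrightarrow> k < level A j"
  using Max_ge[OF finite_section, of A k j] by (auto simp: level_def)

lemma level_pred_in: "finite A \<Longrightarrow> level A j > 0 \<Longrightarrow> (j, level A j - 1) \<in> A"
  using Max_in[OF finite_section, of A j] by (auto simp: level_def split: if_splits)

lemma measurable_digit_array_fun:
  fixes q :: "(nat \<times> nat \<Rightarrow> nat) \<Rightarrow> real"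
  assumes A: "finite A" "A \<subseteq> {..<s} \<times> UNIV" "depends_on q A"
  shows "(\<lambda>u. q (digit_array b u)) \<in> borel_measurable (\<Pi>\<^sub>M j\<in>{..<s}. borel)"
proof -
  have "(\<lambda>u. restrict (digit_array b u) A) \<in> (\<Pi>\<^sub>M j\<in>{..<s}. borel) \<rightarrow>\<^sub>M (\<Pi>\<^sub>M c\<in>A. count_space UNIV)"
  proof (rule measurable_restrict)
    fix c assume "c \<in> A"
    then obtain j k where c: "c = (j, k)" "j < s" using A by auto
    have "digit b (Suc k) \<in> borel \<rightarrow>\<^sub>M count_space UNIV"
      unfolding digit_def by measurable
    then show "(\<lambda>u. digit_array b u c) \<in> (\<Pi>\<^sub>M j\<in>{..<s}. borel) \<rightarrow>\<^sub>M count_space UNIV"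
      unfolding c digit_array_def prod.case using c(2)
      by (intro measurable_compose[OF measurable_component_singleton]) auto
  qed
  also have "(\<Pi>\<^sub>M c\<in>A. count_space UNIV) = count_space (\<Pi>\<^sub>E c\<in>A. (UNIV :: nat set))"
    using A(1) by (intro count_space_PiM_finite) auto
  finally have "(\<lambda>u. q (restrict (digit_array b u) A)) \<in> borel_measurable (\<Pi>\<^sub>M j\<in>{..<s}. borel)"
    by (rule measurable_compose) simp
  moreover have "q (restrict x A) = q x" for x by (rule depends_onD[OF A(3)]) simp
  ultimately show ?thesis by simp
qed

context random_scramble
begin

lemma integrable_scrambled_product:
  fixes q r :: "(nat \<times> nat \<Rightarrow> nat) \<Rightarrow> real"
  assumes "finite A" "A \<subseteq> {..<s} \<times> UNIV" "depends_on q A"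
    and "finite B" "B \<subseteq> {..<s} \<times> UNIV" "depends_on r B"
  shows "integrable M (\<lambda>\<omega>. q (scrambled_digits b (perm_at \<omega>) x) * r (scrambled_digits b (perm_at \<omega>) y))"
  using assms address_image_idx
  by (intro perms_integral(1)[where J="digit_address b x ` A \<union> digit_address b y ` B"]
      depends_on_mult depends_on_scrambled_digits) auto

lemma AE_scrambled_digits_eq:
  assumes "A \<subseteq> {..<s} \<times> UNIV" "depends_on q A"
  shows "AE \<omega> in M. q (digit_array b (scrambled_point x \<omega>)) = q (scrambled_digits b (perm_at \<omega>) x)"
  using AE_digit_array_scrambled_point[of x]
proof eventually_elim
  case (elim \<omega>)
  show ?case by (rule depends_onD[OF assms(2)]) (use elim assms(1) in auto)
qed

text \<open>A single scrambled point is uniform whatever the original point, so the value does not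
  depend on \<open>x\<close>.\<close>

lemma expectation_scrambled_square:
  fixes q :: "(nat \<times> nat \<Rightarrow> nat) \<Rightarrow> real"
  assumes A: "finite A" "A \<subseteq> {..<s} \<times> UNIV" "depends_on q A"
  shows "expectation (\<lambda>\<omega>. (q (scrambled_digits b (perm_at \<omega>) x))\<^sup>2)
    = (\<integral>u. (q (digit_array b u))\<^sup>2 \<partial>uniform_point s)"
proof -
  note m = measurable_digit_array_fun[OF A]
  have "(\<integral>u. (q (digit_array b u))\<^sup>2 \<partial>uniform_point s)
      = expectation (\<lambda>\<omega>. (q (digit_array b (scrambled_point x \<omega>)))\<^sup>2)"
    unfolding distr_scrambled_point[of x, symmetric]
    by (rule integral_distr[OF measurable_scrambled_point]) (use m in measurable)
  also have "\<dots> = expectation (\<lambda>\<omega>. (q (scrambled_digits b (perm_at \<omega>) x))\<^sup>2)"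
  proof (rule integral_cong_AE)
    show "AE \<omega> in M. (q (digit_array b (scrambled_point x \<omega>)))\<^sup>2 = (q (scrambled_digits b (perm_at \<omega>) x))\<^sup>2"
      using AE_scrambled_digits_eq[OF A(2,3), of x] by eventually_elim simp
    show "(\<lambda>\<omega>. (q (digit_array b (scrambled_point x \<omega>)))\<^sup>2) \<in> borel_measurable M"
      using measurable_compose[OF measurable_scrambled_point m] by measurable
    show "(\<lambda>\<omega>. (q (scrambled_digits b (perm_at \<omega>) x))\<^sup>2) \<in> borel_measurable M"
      using integrable_scrambled_product[OF A A] unfolding power2_eq_square by (rule borel_measurable_integrable)
  qed
  finally show ?thesis by simp
qed

end

locale scrambled_net = digital_net b t m s a + random_scramble M b s \<pi>
  for b t m s a and M :: "'w measure" and \<pi>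
begin

definition net_sum :: "((nat \<times> nat \<Rightarrow> nat) \<Rightarrow> real) \<Rightarrow> 'w \<Rightarrow> real" where
  "net_sum q \<omega> = (\<Sum>i<b ^ m. q (scrambled_digits b (perm_at \<omega>) (a i)))"

lemma net_sum_mult:
  "net_sum q \<omega> * net_sum r \<omega> = (\<Sum>i<b ^ m. \<Sum>i'<b ^ m.
    q (scrambled_digits b (perm_at \<omega>) (a i)) * r (scrambled_digits b (perm_at \<omega>) (a i')))"
  by (simp add: net_sum_def sum_product)

lemma integrable_net_sum_mult:
  assumes "finite A" "A \<subseteq> {..<s} \<times> UNIV" "depends_on q A"
    and "finite B" "B \<subseteq> {..<s} \<times> UNIV" "depends_on r B"
  shows "integrable M (\<lambda>\<omega>. net_sum q \<omega> * net_sum r \<omega>)"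
  unfolding net_sum_mult
  by (intro Bochner_Integration.integrable_sum integrable_scrambled_product[OF assms])

lemma expectation_net_sum_mult:
  assumes "finite A" "A \<subseteq> {..<s} \<times> UNIV" "depends_on q A"
    and "finite B" "B \<subseteq> {..<s} \<times> UNIV" "depends_on r B"
  shows "expectation (\<lambda>\<omega>. net_sum q \<omega> * net_sum r \<omega>) = (\<Sum>i<b ^ m. \<Sum>i'<b ^ m. expectation (\<lambda>\<omega>.
    q (scrambled_digits b (perm_at \<omega>) (a i)) * r (scrambled_digits b (perm_at \<omega>) (a i'))))"
  unfolding net_sum_mult
  by (subst Bochner_Integration.integral_sum)
    (intro Bochner_Integration.integrable_sum integrable_scrambled_product[OF assms] sum.cong refl
      Bochner_Integration.integral_sum)+

text \<open>Cancellation takes place for every outcome, not just on average. Any coordinate with a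
  digit in \<open>A\<close> serves: its last digit in \<open>A\<close> is the one over which the net
  is equidistributed.\<close>

lemma net_sum_eq_0:
  assumes A: "finite A" "A \<noteq> {}" "A \<subseteq> {..<s} \<times> UNIV" and q: "depends_on q A"
    and van: "\<And>c x. c \<in> A \<Longrightarrow> (\<Sum>v<b. q (x(c := v))) = 0"
    and level: "(\<Sum>j<s. level A j) \<le> m - t" and \<omega>: "\<omega> \<in> space M"
  shows "net_sum q \<omega> = 0"
proof -
  obtain j0 k where jk: "(j0, k) \<in> A" using A(2) by auto
  then have j0: "j0 < s" using A(3) by auto
  have pos: "level A j0 > 0" using less_level[OF A(1) jk] by simp
  \<comment> \<open>Lowering the level by one at \<open>j0\<close> makes \<open>?\<kappa> j0\<close>
    the position of the last digit of \<open>A\<close> in that coordinate; all other digits in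
    \<open>A\<close> lie within the prefixes.\<close>
  let ?\<kappa> = "(level A)(j0 := level A j0 - 1)"
  have in_A: "(j0, ?\<kappa> j0) \<in> A" using level_pred_in[OF A(1) pos] by simp
  have "(\<Sum>j<s. level A j) = (\<Sum>j<s. ?\<kappa> j + (if j = j0 then 1 else 0))"
    using pos by (intro sum.cong) auto
  also have "\<dots> = Suc (\<Sum>j<s. ?\<kappa> j)" using j0 by (simp add: sum.distrib)
  finally have le: "Suc (\<Sum>j<s. ?\<kappa> j) \<le> m - t" using level by simp
  show ?thesis unfolding net_sum_def
  proof (rule sum_scrambled_digits_eq_0[where A=A and ?j0.0=j0 and \<kappa>="?\<kappa>", OF q _ _ le j0])
    show "(\<Sum>v<b. q (x((j0, ?\<kappa> j0) := v))) = 0" for x by (rule van[OF in_A])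
  next
    fix j k assume jk: "(j, k) \<in> A"
    have "k < level A j" by (rule less_level[OF A(1) jk])
    then show "j < s \<and> ((j, k) = (j0, ?\<kappa> j0) \<or> k < ?\<kappa> j)"
      using jk A(3) by auto
  next
    fix w assume "w \<in> lists {..<b}"
    then show "perm_at \<omega> (j0, w) permutes {..<b}"
      using perm_at_perms[of "(j0, w)" \<omega>] \<omega> j0 by (simp add: idx_def perms_def)
  qed
qed

text \<open>Two points can correlate only if they share the first \<open>level A j - 1\<close>
  digits in each coordinate \<open>j\<close>. One digit is lost per coordinate, so these prefixes
  together fall short of \<open>m - t\<close> by less than \<open>s\<close>, which leaves each point
  at most b^(t+s) partners.\<close>

lemma expectation_net_sum_square_le:
  assumes A: "finite A" "A \<noteq> {}" "A \<subseteq> {..<s} \<times> UNIV" and q: "depends_on q A"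
    and van: "\<And>c x. c \<in> A \<Longrightarrow> (\<Sum>v<b. q (x(c := v))) = 0"
  shows "expectation (\<lambda>\<omega>. (net_sum q \<omega>)\<^sup>2)
    \<le> real (b ^ m) * real (b ^ (t + s)) * (\<integral>u. (q (digit_array b u))\<^sup>2 \<partial>uniform_point s)"
proof (cases "(\<Sum>j<s. level A j) \<le> m - t")
  case True
  have "expectation (\<lambda>\<omega>. (net_sum q \<omega>)\<^sup>2) = expectation (\<lambda>\<omega>. 0)"
    by (rule Bochner_Integration.integral_cong[OF refl]) (simp add: net_sum_eq_0[OF A q van True])
  then show ?thesis by simp
next
  case False
  let ?e = "\<integral>u. (q (digit_array b u))\<^sup>2 \<partial>uniform_point s"
  let ?q = "\<lambda>i \<omega>. q (scrambled_digits b (perm_at \<omega>) (a i))"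
  have "(\<Sum>j<s. level A j) \<le> (\<Sum>j<s. (level A j - 1) + 1)" by (intro sum_mono) auto
  then have sum_le: "(\<Sum>j<s. level A j) \<le> (\<Sum>j<s. level A j - 1) + s" by (simp only: sum.distrib) simp
  \<comment> \<open>Counting in the net works only up to \<open>m - t\<close> fixed digits, so
    longer prefixes are truncated. Sharing the shorter prefixes is a weaker condition, so no
    correlated pair is missed.\<close>
  obtain \<kappa> where \<kappa>: "\<And>j. j < s \<Longrightarrow> \<kappa> j \<le> level A j - 1"
      "(\<Sum>j<s. \<kappa> j) = min (m - t) (\<Sum>j<s. level A j - 1)"
    using exists_le_with_sum[of "min (m - t) (\<Sum>j<s. level A j - 1)" "\<lambda>j. level A j - 1" s] by auto
  have \<kappa>_le: "(\<Sum>j<s. \<kappa> j) \<le> m - t" using \<kappa>(2) by simp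
  \<comment> \<open>If the minimum is \<open>m - t\<close>, the difference is \<open>t\<close>;
    otherwise the failed case condition makes it less than \<open>t + s\<close>.\<close>
  have exp_le: "m - (\<Sum>j<s. \<kappa> j) \<le> t + s" using \<kappa>(2) sum_le False by linarith
  have e0: "0 \<le> ?e" by (rule integral_nonneg_AE) simp
  have int: "integrable M (\<lambda>\<omega>. ?q i \<omega> * ?q i' \<omega>)" for i i'
    by (rule integrable_scrambled_product[OF A(1,3) q A(1,3) q])
  have sq: "expectation (\<lambda>\<omega>. (?q i \<omega>)\<^sup>2) = ?e" for i
    by (rule expectation_scrambled_square[OF A(1,3) q])
  have le: "expectation (\<lambda>\<omega>. ?q i \<omega> * ?q i' \<omega>) \<le> ?e" for i i'
  proof -
    have "expectation (\<lambda>\<omega>. ?q i \<omega> * ?q i' \<omega>) \<le> expectation (\<lambda>\<omega>. ((?q i \<omega>)\<^sup>2 + (?q i' \<omega>)\<^sup>2) / 2)"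
    proof (intro integral_mono int)
      show "integrable M (\<lambda>\<omega>. ((?q i \<omega>)\<^sup>2 + (?q i' \<omega>)\<^sup>2) / 2)"
        using int[of i i] int[of i' i'] by (simp add: power2_eq_square)
      show "?q i \<omega> * ?q i' \<omega> \<le> ((?q i \<omega>)\<^sup>2 + (?q i' \<omega>)\<^sup>2) / 2" for \<omega>
        using sum_squares_bound[of "?q i \<omega>" "?q i' \<omega>"] by simp
    qed
    also have "\<dots> = (expectation (\<lambda>\<omega>. (?q i \<omega>)\<^sup>2) + expectation (\<lambda>\<omega>. (?q i' \<omega>)\<^sup>2)) / 2"
      using int[of i i] int[of i' i'] by (simp add: power2_eq_square)
    finally show ?thesis unfolding sq by simp
  qed
  \<comment> \<open>A difference in the shortened prefix is a difference before the last digit of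
    \<open>A\<close> in that coordinate, so the two points use different permutations for that
    digit.\<close>
  have zero: "expectation (\<lambda>\<omega>. ?q i \<omega> * ?q i' \<omega>) = 0"
    if neq: "\<not> same_prefix b s \<kappa> (a i) (a i')" for i i'
  proof -
    obtain j where j: "j < s" "digits b (a i j) (\<kappa> j) \<noteq> digits b (a i' j) (\<kappa> j)"
      using neq unfolding same_prefix_def by auto
    then have "\<kappa> j > 0" by (metis digits_0 gr0I)
    then have pos: "level A j > 0" using \<kappa>(1)[OF j(1)] by linarith
    have "digits b (a i j) (level A j - 1) \<noteq> digits b (a i' j) (level A j - 1)"
      using digits_eq_mono[OF \<kappa>(1)[OF j(1)]] j(2) by blast
    then have ne: "digit_address b (a i') (j, level A j - 1) \<noteq> digit_address b (a i) (j, level A j - 1)"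
      unfolding digit_address_eq_iff by simp
    show ?thesis
      using expectation_scrambled_product_eq_0[OF A(1,3) q A(1,3) q level_pred_in[OF A(1) pos]
          van[OF level_pred_in[OF A(1) pos]] disjI2[OF ne]] .
  qed
  have row: "(\<Sum>i'<b ^ m. expectation (\<lambda>\<omega>. ?q i \<omega> * ?q i' \<omega>)) \<le> real (b ^ (t + s)) * ?e"
    if i: "i < b ^ m" for i
  proof -
    let ?F = "{i'. i' < b ^ m \<and> same_prefix b s \<kappa> (a i) (a i')}"
    have "(\<Sum>i'<b ^ m. expectation (\<lambda>\<omega>. ?q i \<omega> * ?q i' \<omega>)) = (\<Sum>i'\<in>?F. expectation (\<lambda>\<omega>. ?q i \<omega> * ?q i' \<omega>))"
      using zero by (intro sum.mono_neutral_right) auto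
    also have "\<dots> \<le> (\<Sum>i'\<in>?F. ?e)" by (intro sum_mono le)
    also have "\<dots> = real (b ^ (m - (\<Sum>j<s. \<kappa> j))) * ?e"
      by (simp only: sum_constant card_same_prefix[OF i \<kappa>_le])
    also have "\<dots> \<le> real (b ^ (t + s)) * ?e"
      using exp_le base e0 by (intro mult_right_mono) (auto intro: power_increasing)
    finally show ?thesis .
  qed
  have "expectation (\<lambda>\<omega>. (net_sum q \<omega>)\<^sup>2) = (\<Sum>i<b ^ m. \<Sum>i'<b ^ m. expectation (\<lambda>\<omega>. ?q i \<omega> * ?q i' \<omega>))"
    unfolding power2_eq_square by (rule expectation_net_sum_mult[OF A(1,3) q A(1,3) q])
  also have "\<dots> \<le> (\<Sum>i<b ^ m. real (b ^ (t + s)) * ?e)"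
    by (intro sum_mono row) simp
  finally show ?thesis by simp
qed

text \<open>Components for different digit sets are uncorrelated along the net and orthogonal as
  functions, so mean squares add on both sides and the constant does not depend on \<open>I\<close>.
  The number \<open>c\<close> is the component of the empty set, the mean of \<open>q\<close>; the
  last conclusion is exactness for large nets.\<close>

lemma cylinder_bound:
  fixes q :: "(nat \<times> nat \<Rightarrow> nat) \<Rightarrow> real"
  assumes I: "finite I" "I \<subseteq> {..<s} \<times> UNIV" and q: "depends_on q I"
  obtains c where
    "integrable M (\<lambda>\<omega>. (net_sum q \<omega> - real (b ^ m) * c)\<^sup>2)"
    "expectation (\<lambda>\<omega>. (net_sum q \<omega> - real (b ^ m) * c)\<^sup>2)
      \<le> real (b ^ m) * real (b ^ (t + s)) * (\<integral>u. (q (digit_array b u))\<^sup>2 \<partial>uniform_point s)"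
    "(\<Sum>j<s. level I j) \<le> m - t \<Longrightarrow> (\<And>\<omega>. \<omega> \<in> space M \<Longrightarrow> net_sum q \<omega> = real (b ^ m) * c)"
proof -
  obtain qA where qA: "anova b I I q qA" using anova_exists[OF I(1) b_pos q] by blast
  have dep: "depends_on (qA A) A" if "A \<subseteq> I" for A
    using qA that unfolding anova_def by simp
  have van: "(\<Sum>v<b. qA A (x(c := v))) = 0" if "A \<subseteq> I" "c \<in> A" for A c x
    using qA that unfolding anova_def by blast
  have sum: "q x = (\<Sum>A\<in>Pow I. qA A x)" for x
    using qA unfolding anova_def by blast
  have sub: "finite A" "A \<subseteq> {..<s} \<times> UNIV" if "A \<subseteq> I" for A
    using that I finite_subset by auto
  define c where "c = qA {} (\<lambda>_. 0)"
  have c: "qA {} x = c" for x unfolding c_def by (rule depends_onD[OF dep[of "{}"]]) auto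
  let ?K = "Pow I - {{}}"
  let ?e = "\<lambda>q. \<integral>u. (q (digit_array b u))\<^sup>2 \<partial>uniform_point s"
  have K: "finite ?K" "finite (Pow I)" using I by auto
  have q_eq: "q x = c + (\<Sum>A\<in>?K. qA A x)" for x
    using K(2) unfolding sum c[of x, symmetric] by (intro sum.remove) auto
  have ns: "net_sum q \<omega> - real (b ^ m) * c = (\<Sum>A\<in>?K. net_sum (qA A) \<omega>)" for \<omega>
    unfolding net_sum_def q_eq sum.distrib by (subst sum.swap) simp
  \<comment> \<open>Some digit belongs to only one of the two sets; averaging over it kills the
    product for any two points.\<close>
  have orth1: "expectation (\<lambda>\<omega>. qA A (scrambled_digits b (perm_at \<omega>) x) * qA B (scrambled_digits b (perm_at \<omega>) y)) = 0"
    if AB: "A \<subseteq> I" "B \<subseteq> I" "A \<noteq> B" for A B x y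
  proof -
    consider c where "c \<in> A" "c \<notin> B" | c where "c \<in> B" "c \<notin> A" using AB(3) by blast
    then show ?thesis
    proof cases
      case 1
      then show ?thesis
        using expectation_scrambled_product_eq_0[OF sub[OF AB(1)] dep[OF AB(1)] sub[OF AB(2)] dep[OF AB(2)]
            1(1) van[OF AB(1) 1(1)]] by blast
    next
      case 2
      then show ?thesis
        using expectation_scrambled_product_eq_0[OF sub[OF AB(2)] dep[OF AB(2)] sub[OF AB(1)] dep[OF AB(1)]
            2(1) van[OF AB(2) 2(1)], of x y] by (simp add: mult.commute)
    qed
  qed
  have orth: "expectation (\<lambda>\<omega>. net_sum (qA A) \<omega> * net_sum (qA B) \<omega>) = 0"
    if AB: "A \<subseteq> I" "B \<subseteq> I" "A \<noteq> B" for A B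
    using expectation_net_sum_mult[OF sub[OF AB(1)] dep[OF AB(1)] sub[OF AB(2)] dep[OF AB(2)]] orth1[OF AB]
    by simp
  have int: "integrable M (\<lambda>\<omega>. net_sum (qA A) \<omega> * net_sum (qA B) \<omega>)" if "A \<subseteq> I" "B \<subseteq> I" for A B
    using integrable_net_sum_mult[OF sub[OF that(1)] dep[OF that(1)] sub[OF that(2)] dep[OF that(2)]] .
  have eq: "expectation (\<lambda>\<omega>. (net_sum q \<omega> - real (b ^ m) * c)\<^sup>2)
      = (\<Sum>A\<in>?K. expectation (\<lambda>\<omega>. (net_sum (qA A) \<omega>)\<^sup>2))"
    unfolding ns by (rule expectation_sum_orthogonal[OF K(1)]) (use int orth in auto)
  have e_sum: "?e q = (\<Sum>A\<in>Pow I. ?e (qA A))"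
  proof -
    \<comment> \<open>Scrambling any fixed point, here the origin, yields a uniform point, so
      orthogonality under the uniform distribution follows from \<open>orth1\<close>.\<close>
    let ?f = "\<lambda>A \<omega>. qA A (scrambled_digits b (perm_at \<omega>) (\<lambda>_. 0))"
    have "?e q = expectation (\<lambda>\<omega>. (q (scrambled_digits b (perm_at \<omega>) (\<lambda>_. 0)))\<^sup>2)"
      by (rule expectation_scrambled_square[OF I q, symmetric])
    also have "\<dots> = expectation (\<lambda>\<omega>. (\<Sum>A\<in>Pow I. ?f A \<omega>)\<^sup>2)" by (simp only: sum)
    also have "\<dots> = (\<Sum>A\<in>Pow I. expectation (\<lambda>\<omega>. (?f A \<omega>)\<^sup>2))"
    proof (rule expectation_sum_orthogonal[OF K(2)])
      fix A B assume "A \<in> Pow I" "B \<in> Pow I"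
      then have AB: "A \<subseteq> I" "B \<subseteq> I" by auto
      show "integrable M (\<lambda>\<omega>. ?f A \<omega> * ?f B \<omega>)"
        by (rule integrable_scrambled_product[OF sub[OF AB(1)] dep[OF AB(1)] sub[OF AB(2)] dep[OF AB(2)]])
      show "expectation (\<lambda>\<omega>. ?f A \<omega> * ?f B \<omega>) = 0" if "A \<noteq> B"
        by (rule orth1[OF AB that])
    qed
    also have "\<dots> = (\<Sum>A\<in>Pow I. ?e (qA A))"
    proof (rule sum.cong[OF refl])
      fix A assume "A \<in> Pow I"
      then have A: "A \<subseteq> I" by simp
      show "expectation (\<lambda>\<omega>. (?f A \<omega>)\<^sup>2) = ?e (qA A)"
        by (rule expectation_scrambled_square[OF sub[OF A] dep[OF A]])
    qed
    finally show ?thesis .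
  qed
  show thesis
  proof (rule that[of c])
    have "integrable M (\<lambda>\<omega>. \<Sum>A\<in>?K. \<Sum>B\<in>?K. net_sum (qA A) \<omega> * net_sum (qA B) \<omega>)"
      by (intro Bochner_Integration.integrable_sum int) auto
    then show "integrable M (\<lambda>\<omega>. (net_sum q \<omega> - real (b ^ m) * c)\<^sup>2)"
      unfolding ns power2_eq_square sum_product .
    have "(\<Sum>A\<in>?K. expectation (\<lambda>\<omega>. (net_sum (qA A) \<omega>)\<^sup>2))
        \<le> (\<Sum>A\<in>?K. real (b ^ m) * real (b ^ (t + s)) * ?e (qA A))"
    proof (rule sum_mono)
      fix A assume "A \<in> ?K"
      then have A: "A \<subseteq> I" "A \<noteq> {}" by auto
      show "expectation (\<lambda>\<omega>. (net_sum (qA A) \<omega>)\<^sup>2) \<le> real (b ^ m) * real (b ^ (t + s)) * ?e (qA A)"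
        by (rule expectation_net_sum_square_le[OF sub(1)[OF A(1)] A(2) sub(2)[OF A(1)] dep[OF A(1)] van[OF A(1)]])
    qed
    also have "\<dots> = real (b ^ m) * real (b ^ (t + s)) * (\<Sum>A\<in>?K. ?e (qA A))"
      by (simp only: sum_distrib_left)
    also have "\<dots> \<le> real (b ^ m) * real (b ^ (t + s)) * ?e q"
      unfolding e_sum using K(2) by (intro mult_left_mono sum_mono2) (auto intro!: integral_nonneg_AE)
    finally show "expectation (\<lambda>\<omega>. (net_sum q \<omega> - real (b ^ m) * c)\<^sup>2)
        \<le> real (b ^ m) * real (b ^ (t + s)) * ?e q" unfolding eq .
    fix \<omega> assume lev: "(\<Sum>j<s. level I j) \<le> m - t" and \<omega>: "\<omega> \<in> space M"
    have "net_sum (qA A) \<omega> = 0" if "A \<in> ?K" for A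
    proof -
      from that have A: "A \<subseteq> I" "A \<noteq> {}" by auto
      have "level A j \<le> level I j" for j
      proof (cases "level A j = 0")
        case False
        then have "(j, level A j - 1) \<in> I" using level_pred_in[OF sub(1)[OF A(1)]] A(1) by blast
        then show ?thesis using less_level[OF I(1)] by fastforce
      qed simp
      then have "(\<Sum>j<s. level A j) \<le> (\<Sum>j<s. level I j)" by (intro sum_mono) simp
      then have "(\<Sum>j<s. level A j) \<le> m - t" using lev by linarith
      then show ?thesis
        using net_sum_eq_0[OF sub(1)[OF A(1)] A(2) sub(2)[OF A(1)] dep[OF A(1)] van[OF A(1)] _ \<omega>] by blast
    qed
    then have "(\<Sum>A\<in>?K. net_sum (qA A) \<omega>) = 0" by (intro sum.neutral) blast
    then show "net_sum q \<omega> = real (b ^ m) * c" using ns[of \<omega>] by linarith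
  qed
qed

end

section \<open>Approximation by functions of finitely many digits\<close>

lemma power2_sum_le: "(x + y)\<^sup>2 \<le> 2 * x\<^sup>2 + 2 * y\<^sup>2" for x y :: real
  using sum_squares_bound[of x y] by (simp add: power2_sum)

lemma L2_functions_measurable: "f \<in> L2_functions N \<Longrightarrow> f \<in> borel_measurable N"
  and L2_functions_integrable: "f \<in> L2_functions N \<Longrightarrow> integrable N (\<lambda>x. (f x)\<^sup>2)"
  by (simp_all add: L2_functions_def)

lemma L2_functions_bound:
  assumes "g \<in> borel_measurable N" "integrable N h" "\<And>x. x \<in> space N \<Longrightarrow> (g x)\<^sup>2 \<le> h x"
  shows "g \<in> L2_functions N"
proof -
  have "integrable N (\<lambda>x. (g x)\<^sup>2)"
    by (rule Bochner_Integration.integrable_bound[OF assms(2)])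
      (use assms in \<open>auto intro!: AE_I2 order_trans[OF _ abs_ge_self]\<close>)
  then show ?thesis using assms(1) by (simp add: L2_functions_def)
qed

lemma L2_functions_add:
  assumes "f \<in> L2_functions N" "g \<in> L2_functions N"
  shows "(\<lambda>x. f x + g x) \<in> L2_functions N"
  by (rule L2_functions_bound[where h="\<lambda>x. 2 * (f x)\<^sup>2 + 2 * (g x)\<^sup>2"])
    (use assms power2_sum_le in \<open>auto simp: L2_functions_def\<close>)

lemma L2_functions_cmult: "f \<in> L2_functions N \<Longrightarrow> (\<lambda>x. c * f x) \<in> L2_functions N"
  by (auto simp: L2_functions_def power_mult_distrib)

lemma L2_functions_diff:
  assumes "f \<in> L2_functions N" "g \<in> L2_functions N"
  shows "(\<lambda>x. f x - g x) \<in> L2_functions N"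
  using L2_functions_add[OF assms(1) L2_functions_cmult[OF assms(2), of "-1"]] by simp

lemma integral_square_add_le:
  assumes "f \<in> L2_functions N" "g \<in> L2_functions N"
  shows "(\<integral>x. (f x + g x)\<^sup>2 \<partial>N) \<le> 2 * (\<integral>x. (f x)\<^sup>2 \<partial>N) + 2 * (\<integral>x. (g x)\<^sup>2 \<partial>N)"
proof -
  have "(\<integral>x. (f x + g x)\<^sup>2 \<partial>N) \<le> (\<integral>x. 2 * (f x)\<^sup>2 + 2 * (g x)\<^sup>2 \<partial>N)"
    using L2_functions_integrable[OF L2_functions_add[OF assms]] assms
    by (intro integral_mono power2_sum_le) (auto simp: L2_functions_def)
  also have "\<dots> = 2 * (\<integral>x. (f x)\<^sup>2 \<partial>N) + 2 * (\<integral>x. (g x)\<^sup>2 \<partial>N)"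
    using assms by (subst Bochner_Integration.integral_add) (auto simp: L2_functions_def)
  finally show ?thesis .
qed

lemma floor_eq_digit_num:
  assumes "b > 0" "x \<in> {0..<1}"
  shows "\<lfloor>x * real b ^ L\<rfloor> = int (digit_num b (\<lambda>k. digit b (Suc k) x) L)"
proof (induction L)
  case 0
  then show ?case using assms by (auto simp: floor_eq_iff)
next
  case (Suc L)
  show ?case unfolding floor_power_Suc[OF assms(1)] Suc by simp
qed

lemma digit_num_cong: "(\<And>k. k < L \<Longrightarrow> D k = D' k) \<Longrightarrow> digit_num b D L = digit_num b D' L"
  by (induction L) auto

lemma prob_space_uniform_point: "prob_space (uniform_point s)"
  unfolding uniform_point_def by (intro prob_space_PiM prob_space_unif)

lemma space_uniform_point: "space (uniform_point s) = {..<s} \<rightarrow>\<^sub>E UNIV"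
  by (simp add: uniform_point_def space_PiM)

lemma sets_uniform_point: "sets (uniform_point s) = sets (\<Pi>\<^sub>M j\<in>{..<s}. borel)"
  unfolding uniform_point_def by (intro sets_PiM_cong) auto

section \<open>Lower orthants as generators of the Borel sets\<close>

definition atMost_box :: "nat \<Rightarrow> (nat \<Rightarrow> real) \<Rightarrow> (nat \<Rightarrow> real) set" where
  "atMost_box s x = {u \<in> {..<s} \<rightarrow>\<^sub>E UNIV. \<forall>j<s. u j \<le> x j}"

lemma sets_uniform_point_eq:
  "sets (uniform_point s) = sigma_sets ({..<s} \<rightarrow>\<^sub>E UNIV) (range (atMost_box s))"
proof -
  let ?E = "\<lambda>_. range (\<lambda>a. {..a::real})"
  let ?P = "{{f\<in>(\<Pi>\<^sub>E i\<in>{..<s}. (UNIV :: real set)). \<forall>i\<in>j. f i \<in> A i} | A j. j \<in> {{..<s}} \<and> A \<in> Pi j ?E}"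
  have cover: "(UNIV :: real set) = \<Union>(range (\<lambda>n. {..real n}))"
    using real_arch_simple by auto
  have "sets (\<Pi>\<^sub>M j\<in>{..<s}. sigma (UNIV :: real set) (range atMost)) = sets (sigma ({..<s} \<rightarrow>\<^sub>E UNIV) ?P)"
  proof (rule sets_PiM_sigma)
    show "\<exists>S\<subseteq>range atMost. countable S \<and> (UNIV :: real set) = \<Union>S"
      using cover by (intro exI[of _ "range (\<lambda>n. {..real n})"]) auto
  qed auto
  also have "\<dots> = sigma_sets ({..<s} \<rightarrow>\<^sub>E UNIV) ?P"
    by (rule sets_measure_of) auto
  also have "?P = range (atMost_box s)"
  proof (intro set_eqI iffI)
    fix B assume "B \<in> ?P"
    then obtain A where A: "B = {f\<in>(\<Pi>\<^sub>E i\<in>{..<s}. UNIV). \<forall>i\<in>{..<s}. f i \<in> A i}" "A \<in> Pi {..<s} ?E"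
      by blast
    then have "\<forall>i\<in>{..<s}. \<exists>x. A i = {..x}" by (auto simp: Pi_iff)
    then obtain x where "\<forall>i\<in>{..<s}. A i = {..x i}" by metis
    then have "B = atMost_box s x" unfolding A(1) atMost_box_def by auto
    then show "B \<in> range (atMost_box s)" by simp
  next
    fix B assume "B \<in> range (atMost_box s)"
    then obtain x where "B = atMost_box s x" by auto
    then have "B = {f\<in>(\<Pi>\<^sub>E i\<in>{..<s}. UNIV). \<forall>i\<in>{..<s}. f i \<in> {..x i}}"
      unfolding atMost_box_def by auto
    then show "B \<in> ?P"
      by (intro CollectI exI[of _ "\<lambda>i. {..x i}"] exI[of _ "{..<s}"] conjI) auto
  qed
  finally show ?thesis
    unfolding sets_uniform_point borel_eq_atMost[where 'a=real] .
qed

lemma Int_stable_atMost_box: "Int_stable (range (atMost_box s))"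
proof (rule Int_stableI, safe)
  fix x y
  have "atMost_box s x \<inter> atMost_box s y = atMost_box s (\<lambda>j. min (x j) (y j))"
    unfolding atMost_box_def by auto
  then show "atMost_box s x \<inter> atMost_box s y \<in> range (atMost_box s)" by simp
qed

locale digit_approximation =
  fixes b s :: nat
  assumes b2: "b \<ge> 2"
begin

abbreviation "P \<equiv> uniform_point s"

definition digit_approximable :: "((nat \<Rightarrow> real) \<Rightarrow> real) \<Rightarrow> bool" where
  "digit_approximable g \<longleftrightarrow> g \<in> L2_functions P \<and>
    (\<forall>\<epsilon>>0. \<exists>q I. finite I \<and> I \<subseteq> {..<s} \<times> UNIV \<and> depends_on q I \<and>
      (\<lambda>u. q (digit_array b u)) \<in> L2_functions P \<and>
      (\<integral>u. (g u - q (digit_array b u))\<^sup>2 \<partial>P) < \<epsilon>)"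

lemma digit_approximable_L2: "digit_approximable g \<Longrightarrow> g \<in> L2_functions P"
  by (simp add: digit_approximable_def)

lemma digit_approximableE:
  assumes "digit_approximable g" "\<epsilon> > 0"
  obtains q I where "finite I" "I \<subseteq> {..<s} \<times> UNIV" "depends_on q I"
    "(\<lambda>u. q (digit_array b u)) \<in> L2_functions P" "(\<integral>u. (g u - q (digit_array b u))\<^sup>2 \<partial>P) < \<epsilon>"
  using assms unfolding digit_approximable_def by blast

lemma digit_approximable_cong:
  assumes "digit_approximable g" "\<And>u. u \<in> space P \<Longrightarrow> g u = h u"
  shows "digit_approximable h"
proof -
  note g = digit_approximable_L2[OF assms(1)]
  have "h \<in> borel_measurable P"
    using L2_functions_measurable[OF g] measurable_cong[of P g h borel, OF assms(2)] by blast
  then have "h \<in> L2_functions P"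
    by (rule L2_functions_bound[OF _ L2_functions_integrable[OF g]]) (simp add: assms(2))
  moreover have "(\<integral>u. (h u - q (digit_array b u))\<^sup>2 \<partial>P) = (\<integral>u. (g u - q (digit_array b u))\<^sup>2 \<partial>P)" for q
    by (intro Bochner_Integration.integral_cong refl) (simp add: assms(2))
  ultimately show ?thesis using assms(1) unfolding digit_approximable_def by simp
qed

lemma digit_approximable_const: "digit_approximable (\<lambda>_. c)"
proof -
  interpret prob_space P by (rule prob_space_uniform_point)
  have L2: "(\<lambda>_. c) \<in> L2_functions P" by (simp add: L2_functions_def)
  have "depends_on (\<lambda>_::nat \<times> nat \<Rightarrow> nat. c) {}" by (simp add: depends_on_def)
  then show ?thesis
    unfolding digit_approximable_def using L2
    by (intro conjI allI impI exI[of _ "\<lambda>_. c"] exI[of _ "{}"]) auto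
qed

lemma digit_approximable_add:
  assumes "digit_approximable f" "digit_approximable g"
  shows "digit_approximable (\<lambda>u. f u + g u)"
  unfolding digit_approximable_def
proof (intro conjI allI impI)
  note L2 = digit_approximable_L2[OF assms(1)] digit_approximable_L2[OF assms(2)]
  show "(\<lambda>u. f u + g u) \<in> L2_functions P" using L2 by (rule L2_functions_add)
  fix \<epsilon> :: real assume "\<epsilon> > 0"
  then have e: "\<epsilon> / 4 > 0" by simp
  obtain q I where q: "finite I" "I \<subseteq> {..<s} \<times> UNIV" "depends_on q I"
    "(\<lambda>u. q (digit_array b u)) \<in> L2_functions P" "(\<integral>u. (f u - q (digit_array b u))\<^sup>2 \<partial>P) < \<epsilon> / 4"
    by (rule digit_approximableE[OF assms(1) e])
  obtain r J where r: "finite J" "J \<subseteq> {..<s} \<times> UNIV" "depends_on r J"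
    "(\<lambda>u. r (digit_array b u)) \<in> L2_functions P" "(\<integral>u. (g u - r (digit_array b u))\<^sup>2 \<partial>P) < \<epsilon> / 4"
    by (rule digit_approximableE[OF assms(2) e])
  have "(\<integral>u. ((f u - q (digit_array b u)) + (g u - r (digit_array b u)))\<^sup>2 \<partial>P) < \<epsilon>"
    using integral_square_add_le[OF L2_functions_diff[OF L2(1) q(4)] L2_functions_diff[OF L2(2) r(4)]]
      q(5) r(5) by simp
  then have "(\<integral>u. (f u + g u - (q (digit_array b u) + r (digit_array b u)))\<^sup>2 \<partial>P) < \<epsilon>"
    by (simp add: algebra_simps)
  moreover have "depends_on (\<lambda>x. q x + r x) (I \<union> J)"
    unfolding depends_on_def
  proof (intro allI impI)
    fix x y :: "nat \<times> nat \<Rightarrow> nat" assume "\<forall>c\<in>I \<union> J. x c = y c"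
    then show "q x + r x = q y + r y"
      by (intro arg_cong2[where f=plus] depends_onD[OF q(3)] depends_onD[OF r(3)]) auto
  qed
  ultimately show "\<exists>q I. finite I \<and> I \<subseteq> {..<s} \<times> UNIV \<and> depends_on q I \<and>
      (\<lambda>u. q (digit_array b u)) \<in> L2_functions P \<and>
      (\<integral>u. (f u + g u - q (digit_array b u))\<^sup>2 \<partial>P) < \<epsilon>"
    using q r L2_functions_add[OF q(4) r(4)]
    by (intro exI[of _ "\<lambda>x. q x + r x"] exI[of _ "I \<union> J"]) auto
qed

text \<open>Dominated convergence, then (x + y)^2 <= 2x^2 + 2y^2, hence a quarter of the tolerance
  for each part. The factor 2 in the bound is that of the simple functions used in
  \<open>L2_digit_approximable\<close>; it gives |g - f n| <= 3|g| and the majorant 9g^2.\<close>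

lemma digit_approximable_limit:
  assumes f: "\<And>n. digit_approximable (f n)" and g: "g \<in> L2_functions P"
    and lim: "\<And>u. u \<in> space P \<Longrightarrow> (\<lambda>n. f n u) \<longlonglongrightarrow> g u"
    and bound: "\<And>n u. u \<in> space P \<Longrightarrow> \<bar>f n u\<bar> \<le> 2 * \<bar>g u\<bar>"
  shows "digit_approximable g"
  unfolding digit_approximable_def
proof (intro conjI allI impI g)
  fix \<epsilon> :: real assume "\<epsilon> > 0"
  then have e: "\<epsilon> / 4 > 0" by simp
  note L2 = digit_approximable_L2[OF f]
  have "(\<lambda>n. \<integral>u. (g u - f n u)\<^sup>2 \<partial>P) \<longlonglongrightarrow> (\<integral>u. 0 \<partial>P)"
  proof (rule integral_dominated_convergence[where w="\<lambda>u. 9 * (g u)\<^sup>2"])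
    show "(\<lambda>u. (g u - f n u)\<^sup>2) \<in> borel_measurable P" for n
      by (rule borel_measurable_integrable[OF L2_functions_integrable[OF L2_functions_diff[OF g L2]]])
    show "integrable P (\<lambda>u. 9 * (g u)\<^sup>2)" using L2_functions_integrable[OF g] by simp
    show "AE u in P. (\<lambda>n. (g u - f n u)\<^sup>2) \<longlonglongrightarrow> 0"
    proof (rule AE_I2)
      fix u assume "u \<in> space P"
      from tendsto_power[OF tendsto_diff[OF tendsto_const[of "g u"] lim[OF this]], of 2]
      show "(\<lambda>n. (g u - f n u)\<^sup>2) \<longlonglongrightarrow> 0" by simp
    qed
    show "AE u in P. norm ((g u - f n u)\<^sup>2) \<le> 9 * (g u)\<^sup>2" for n
    proof (rule AE_I2)
      fix u assume u: "u \<in> space P"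
      have "\<bar>g u - f n u\<bar> \<le> 3 * \<bar>g u\<bar>" using bound[OF u, of n] by linarith
      then have "\<bar>g u - f n u\<bar>\<^sup>2 \<le> (3 * \<bar>g u\<bar>)\<^sup>2" by (intro power_mono) auto
      then show "norm ((g u - f n u)\<^sup>2) \<le> 9 * (g u)\<^sup>2" by (simp add: power_mult_distrib)
    qed
  qed simp
  then have "(\<lambda>n. \<integral>u. (g u - f n u)\<^sup>2 \<partial>P) \<longlonglongrightarrow> 0" by simp
  from order_tendstoD(2)[OF this e] obtain n where n: "(\<integral>u. (g u - f n u)\<^sup>2 \<partial>P) < \<epsilon> / 4"
    by (auto simp: eventually_sequentially)
  obtain q I where q: "finite I" "I \<subseteq> {..<s} \<times> UNIV" "depends_on q I"
    "(\<lambda>u. q (digit_array b u)) \<in> L2_functions P" "(\<integral>u. (f n u - q (digit_array b u))\<^sup>2 \<partial>P) < \<epsilon> / 4"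
    by (rule digit_approximableE[OF f e])
  have "(\<integral>u. ((g u - f n u) + (f n u - q (digit_array b u)))\<^sup>2 \<partial>P) < \<epsilon>"
    using integral_square_add_le[OF L2_functions_diff[OF g L2] L2_functions_diff[OF L2 q(4)], of n n] q(5) n
    by linarith
  then show "\<exists>q I. finite I \<and> I \<subseteq> {..<s} \<times> UNIV \<and> depends_on q I \<and>
      (\<lambda>u. q (digit_array b u)) \<in> L2_functions P \<and>
      (\<integral>u. (g u - q (digit_array b u))\<^sup>2 \<partial>P) < \<epsilon>"
    using q by (intro exI[of _ q] exI[of _ I]) simp
qed

lemma digit_approximable_cmult:
  assumes "digit_approximable g"
  shows "digit_approximable (\<lambda>u. c * g u)"
  unfolding digit_approximable_def
proof (intro conjI allI impI)
  show "(\<lambda>u. c * g u) \<in> L2_functions P" using assms by (intro L2_functions_cmult digit_approximable_L2)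
  fix \<epsilon> :: real assume "\<epsilon> > 0"
  then have e: "\<epsilon> / (c\<^sup>2 + 1) > 0" by (simp add: add_nonneg_pos)
  obtain q I where q: "finite I" "I \<subseteq> {..<s} \<times> UNIV" "depends_on q I"
    "(\<lambda>u. q (digit_array b u)) \<in> L2_functions P" "(\<integral>u. (g u - q (digit_array b u))\<^sup>2 \<partial>P) < \<epsilon> / (c\<^sup>2 + 1)"
    by (rule digit_approximableE[OF assms e])
  have dep: "depends_on (\<lambda>x. c * q x) I"
    unfolding depends_on_def by (intro allI impI arg_cong[where f="times c"] depends_onD[OF q(3)]) auto
  have "(\<integral>u. (c * g u - c * q (digit_array b u))\<^sup>2 \<partial>P) = c\<^sup>2 * (\<integral>u. (g u - q (digit_array b u))\<^sup>2 \<partial>P)"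
    by (simp add: right_diff_distrib[symmetric] power_mult_distrib)
  also have "\<dots> \<le> c\<^sup>2 * (\<epsilon> / (c\<^sup>2 + 1))" using q(5) by (intro mult_left_mono) auto
  also have "\<dots> = \<epsilon> - \<epsilon> / (c\<^sup>2 + 1)"
  proof -
    have "c\<^sup>2 + 1 \<noteq> 0" using zero_le_power2[of c] by linarith
    then show ?thesis by (simp add: field_simps)
  qed
  also have "\<dots> < \<epsilon>" using e by simp
  finally show "\<exists>q I. finite I \<and> I \<subseteq> {..<s} \<times> UNIV \<and> depends_on q I \<and>
      (\<lambda>u. q (digit_array b u)) \<in> L2_functions P \<and>
      (\<integral>u. (c * g u - q (digit_array b u))\<^sup>2 \<partial>P) < \<epsilon>"
    using q L2_functions_cmult[OF q(4), of c] dep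
    by (intro exI[of _ "\<lambda>x. c * q x"] exI[of _ I]) simp
qed

lemma digit_approximable_sum:
  "finite K \<Longrightarrow> (\<And>k. k \<in> K \<Longrightarrow> digit_approximable (f k)) \<Longrightarrow> digit_approximable (\<lambda>u. \<Sum>k\<in>K. f k u)"
  by (induction K rule: finite_induct) (simp_all add: digit_approximable_const digit_approximable_add)

lemma indicator_L2: "A \<in> sets P \<Longrightarrow> indicator A \<in> L2_functions P"
proof -
  assume A: "A \<in> sets P"
  interpret prob_space P by (rule prob_space_uniform_point)
  have "(\<lambda>x. (indicator A x :: real)\<^sup>2) = indicator A" by (auto simp: indicator_def)
  moreover have "integrable P (indicator A :: _ \<Rightarrow> real)"
    using A by (intro integrable_real_indicator) (auto simp: less_top[symmetric])
  ultimately show ?thesis using A by (simp add: L2_functions_def)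
qed

text \<open>Comparing floors at depth \<open>L\<close> instead of the coordinates themselves errs
  only if some coordinate lies within b^-L above its threshold, an event of probability at most s
  b^-L.\<close>

lemma digit_approximable_atMost_box: "digit_approximable (indicator (atMost_box s x))"
  unfolding digit_approximable_def
proof (intro conjI allI impI)
  interpret prob_space P by (rule prob_space_uniform_point)
  have box: "atMost_box s x \<in> sets P" by (auto simp: sets_uniform_point_eq)
  then show L2: "indicator (atMost_box s x) \<in> L2_functions P" by (rule indicator_L2)
  fix \<epsilon> :: real assume "\<epsilon> > 0"
  have b_pos: "b > 0" using b2 by simp
  have "(\<lambda>L. (1 / real b) ^ L) \<longlonglongrightarrow> 0" using b2 by (intro LIMSEQ_realpow_zero) auto
  then have "(\<lambda>L. real s * (1 / real b) ^ L) \<longlonglongrightarrow> real s * 0" by (rule tendsto_mult_left)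
  then have "\<forall>\<^sub>F L in sequentially. real s * (1 / real b) ^ L < \<epsilon>"
    using \<open>\<epsilon> > 0\<close> by (intro order_tendstoD(2)) auto
  then obtain L where L: "real s * (1 / real b ^ L) < \<epsilon>"
    by (auto simp: eventually_sequentially power_one_over)
  define q :: "(nat \<times> nat \<Rightarrow> nat) \<Rightarrow> real" where
    "q y = of_bool (\<forall>j<s. int (digit_num b (\<lambda>k. y (j, k)) L) \<le> \<lfloor>x j * real b ^ L\<rfloor>)" for y
  let ?I = "{..<s} \<times> {..<L}"
  let ?S = "\<lambda>j. {u\<in>space P. u j \<in> {x j..x j + 1 / real b ^ L}}"
  have I: "finite ?I" "?I \<subseteq> {..<s} \<times> UNIV" by auto
  have q: "depends_on q ?I"
    unfolding depends_on_def
  proof (intro allI impI)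
    fix y z :: "nat \<times> nat \<Rightarrow> nat" assume "\<forall>c\<in>?I. y c = z c"
    then have "digit_num b (\<lambda>k. y (j, k)) L = digit_num b (\<lambda>k. z (j, k)) L" if "j < s" for j
      using that by (intro digit_num_cong) auto
    then show "q y = q z" by (simp add: q_def cong: conj_cong)
  qed
  have qm: "(\<lambda>u. q (digit_array b u)) \<in> borel_measurable P"
    using measurable_digit_array_fun[OF I q, of b] by (simp add: measurable_cong_sets[OF sets_uniform_point refl])
  have qL2: "(\<lambda>u. q (digit_array b u)) \<in> L2_functions P"
    by (rule L2_functions_bound[OF qm, of "\<lambda>_. 1"]) (auto simp: q_def)
  have comp: "(\<lambda>u. u j) \<in> P \<rightarrow>\<^sub>M borel" if "j < s" for j
    unfolding uniform_point_def using that measurable_component_singleton[of j "{..<s}" "\<lambda>_. unif"]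
    by (simp add: measurable_cong_sets[OF refl sets_unif])
  have S: "?S j \<in> sets P" if "j < s" for j
  proof -
    have "(\<lambda>u. u j) -` {x j..x j + 1 / real b ^ L} \<inter> space P \<in> sets P"
      by (rule measurable_sets[OF comp[OF that]]) simp
    then show ?thesis by (simp add: vimage_def Int_def conj_commute)
  qed
  have prob_S: "prob (?S j) \<le> 1 / real b ^ L" if j: "j < s" for j
  proof -
    have "distr P unif (\<lambda>u. u j) = unif"
      unfolding uniform_point_def using j by (intro distr_PiM_component prob_space_unif) auto
    then have "measure unif {x j..x j + 1 / real b ^ L} = measure (distr P unif (\<lambda>u. u j)) {x j..x j + 1 / real b ^ L}"
      by simp
    also have "\<dots> = prob ((\<lambda>u. u j) -` {x j..x j + 1 / real b ^ L} \<inter> space P)"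
      using comp[OF j] by (intro measure_distr) (auto simp: measurable_cong_sets[OF refl sets_unif])
    also have "(\<lambda>u. u j) -` {x j..x j + 1 / real b ^ L} \<inter> space P = ?S j" by auto
    finally have "prob (?S j) = measure lborel ({0..1} \<inter> {x j..x j + 1 / real b ^ L})"
      by (simp add: measure_unif)
    also have "\<dots> \<le> measure lborel {x j..x j + 1 / real b ^ L}"
      by (intro measure_mono_fmeasurable) (auto simp: fmeasurable_def)
    also have "\<dots> = 1 / real b ^ L" by simp
    finally show ?thesis .
  qed
  \<comment> \<open>The value 1 must be excluded: digits ignore the integer part, so they determine
    the floor only on the half-open interval.\<close>
  have AE01: "AE u in P. \<forall>j\<in>{..<s}. u j \<in> {0..<1}"
  proof (rule AE_finite_allI)
    fix j assume "j \<in> {..<s}"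
    have "AE v in lborel. v \<noteq> (1::real)" by (rule AE_lborel_singleton)
    then have "AE v in unif. v \<in> {0..<1::real}"
      unfolding unif_def by (intro AE_uniform_measureI) auto
    then show "AE u in P. u j \<in> {0..<1}"
      unfolding uniform_point_def using \<open>j \<in> {..<s}\<close> by (intro AE_PiM_component prob_space_unif)
  qed simp
  have AE_le: "AE u in P. (indicator (atMost_box s x) u - q (digit_array b u))\<^sup>2
      \<le> (\<Sum>j<s. indicator (?S j) u)"
    using AE01 AE_space
  proof eventually_elim
    case (elim u)
    have fl: "int (digit_num b (\<lambda>k. digit_array b u (j, k)) L) = \<lfloor>u j * real b ^ L\<rfloor>" if "j < s" for j
      using floor_eq_digit_num[OF b_pos, of "u j" L] elim that by (simp add: digit_array_def)
    have q_u: "q (digit_array b u) = of_bool (\<forall>j<s. \<lfloor>u j * real b ^ L\<rfloor> \<le> \<lfloor>x j * real b ^ L\<rfloor>)"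
      unfolding q_def using fl by (simp cong: conj_cong)
    have pos: "real b ^ L > 0" using b_pos by simp
    have u: "u \<in> {..<s} \<rightarrow>\<^sub>E UNIV" using elim space_uniform_point by blast
    show ?case
    proof (cases "\<exists>j<s. u \<in> ?S j")
      case True
      then obtain j where j: "j < s" "u \<in> ?S j" by blast
      have "(indicator (atMost_box s x) u - q (digit_array b u))\<^sup>2 \<le> 1"
        by (auto simp: q_u indicator_def)
      also have "1 = indicator (?S j) u" using j by simp
      also have "\<dots> \<le> (\<Sum>j<s. indicator (?S j) u :: real)"
        using j(1) by (intro member_le_sum) auto
      finally show ?thesis .
    next
      case False
      have "u j \<le> x j \<longleftrightarrow> \<lfloor>u j * real b ^ L\<rfloor> \<le> \<lfloor>x j * real b ^ L\<rfloor>" if j: "j < s" for j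
      proof
        assume "u j \<le> x j"
        then show "\<lfloor>u j * real b ^ L\<rfloor> \<le> \<lfloor>x j * real b ^ L\<rfloor>"
          using pos by (intro floor_mono mult_right_mono) auto
      next
        assume le: "\<lfloor>u j * real b ^ L\<rfloor> \<le> \<lfloor>x j * real b ^ L\<rfloor>"
        have "u j * real b ^ L < real_of_int \<lfloor>u j * real b ^ L\<rfloor> + 1" by linarith
        also have "\<dots> \<le> x j * real b ^ L + 1" using le by linarith
        finally have "u j < (x j * real b ^ L + 1) / real b ^ L" using pos by (simp add: pos_less_divide_eq)
        also have "\<dots> = x j + 1 / real b ^ L" using pos by (simp add: field_simps)
        finally have "u j < x j + 1 / real b ^ L" .
        then show "u j \<le> x j" using False j elim(2) by force
      qed
      then have "indicator (atMost_box s x) u = q (digit_array b u)"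
        using u unfolding q_u atMost_box_def by (auto simp: indicator_def)
      then show ?thesis by (simp add: sum_nonneg)
    qed
  qed
  have "(\<integral>u. (indicator (atMost_box s x) u - q (digit_array b u))\<^sup>2 \<partial>P) \<le> (\<integral>u. (\<Sum>j<s. indicator (?S j) u) \<partial>P)"
  proof (rule integral_mono_AE[OF _ _ AE_le])
    show "integrable P (\<lambda>u. (indicator (atMost_box s x) u - q (digit_array b u))\<^sup>2)"
      by (rule L2_functions_integrable[OF L2_functions_diff[OF L2 qL2]])
    show "integrable P (\<lambda>u. \<Sum>j<s. indicator (?S j) u :: real)"
      using S by (intro Bochner_Integration.integrable_sum integrable_real_indicator) (auto simp: less_top[symmetric])
  qed
  also have "\<dots> = (\<Sum>j<s. prob (?S j))"
    using S by (subst Bochner_Integration.integral_sum) (auto simp: less_top[symmetric])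
  also have "\<dots> \<le> (\<Sum>j<s. 1 / real b ^ L)" by (intro sum_mono prob_S) simp
  also have "\<dots> = real s * (1 / real b ^ L)" by simp
  also note L
  finally show "\<exists>q I. finite I \<and> I \<subseteq> {..<s} \<times> UNIV \<and> depends_on q I \<and>
      (\<lambda>u. q (digit_array b u)) \<in> L2_functions P \<and>
      (\<integral>u. (indicator (atMost_box s x) u - q (digit_array b u))\<^sup>2 \<partial>P) < \<epsilon>"
    using I q qL2 by (intro exI[of _ q] exI[of _ ?I]) simp
qed

text \<open>The sets with approximable indicator form a Dynkin system: complements by linearity,
  disjoint unions by dominated convergence. It contains the lower orthants, which are closed under
  intersection.\<close>

lemma digit_approximable_indicator:
  assumes "A \<in> sets P"
  shows "digit_approximable (indicator A)"
proof -
  have A: "A \<in> sigma_sets ({..<s} \<rightarrow>\<^sub>E UNIV) (range (atMost_box s))"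
    using assms by (simp add: sets_uniform_point_eq)
  have Pow: "range (atMost_box s) \<subseteq> Pow ({..<s} \<rightarrow>\<^sub>E UNIV)" unfolding atMost_box_def by auto
  from Int_stable_atMost_box Pow A show ?thesis
  proof (induct A rule: sigma_sets_induct_disjoint)
    case (basic A)
    then show ?case using digit_approximable_atMost_box by auto
  next
    case empty
    then show ?case using digit_approximable_const[of 0] by (simp add: indicator_def)
  next
    case (compl A)
    have "digit_approximable (\<lambda>u. 1 + (-1) * indicator A u)"
      by (intro digit_approximable_add digit_approximable_const digit_approximable_cmult compl)
    then show ?case
      by (rule digit_approximable_cong) (auto simp: indicator_def space_uniform_point)
  next
    case (union A)
    have sets: "A n \<in> sets P" for n using union(2) by (auto simp: sets_uniform_point_eq)
    show ?case
    proof (rule digit_approximable_limit[where f="\<lambda>N u. \<Sum>n<N. indicator (A n) u"])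
      show "digit_approximable (\<lambda>u. \<Sum>n<N. indicator (A n) u)" for N
        by (intro digit_approximable_sum union) auto
      show "indicator (\<Union>n. A n) \<in> L2_functions P"
        using sets by (intro indicator_L2) auto
      have sums: "(\<lambda>n. indicator (A n) u) sums (indicator (\<Union>n. A n) u :: real)" for u
        by (rule indicator_sums) (use union(1) in \<open>auto simp: disjoint_family_on_def\<close>)
      then show "(\<lambda>N. \<Sum>n<N. indicator (A n) u) \<longlonglongrightarrow> (indicator (\<Union>n. A n) u :: real)" for u
        unfolding sums_def .
      show "\<bar>\<Sum>n<N. indicator (A n) u\<bar> \<le> 2 * \<bar>indicator (\<Union>n. A n) u :: real\<bar>" for N u
      proof -
        have "(\<Sum>n<N. indicator (A n) u) \<le> (indicator (\<Union>n. A n) u :: real)"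
          using sum_le_suminf[OF sums_summable[OF sums[of u]], of "{..<N}"] sums_unique[OF sums[of u]] by auto
        moreover have "0 \<le> (\<Sum>n<N. indicator (A n) u :: real)" by (intro sum_nonneg) auto
        ultimately show ?thesis by linarith
      qed
    qed
  qed
qed

lemma L2_digit_approximable:
  assumes g: "g \<in> L2_functions P"
  shows "digit_approximable g"
proof -
  from borel_measurable_implies_sequence_metric[OF L2_functions_measurable[OF g], of 0]
  obtain F where "(\<forall>i. simple_function P (F i)) \<and> (\<forall>u\<in>space P. (\<lambda>i. F i u) \<longlonglongrightarrow> g u) \<and>
      (\<forall>i. \<forall>u\<in>space P. dist (F i u) 0 \<le> 2 * dist (g u) 0)" ..
  then have F: "simple_function P (F i)" "u \<in> space P \<Longrightarrow> (\<lambda>i. F i u) \<longlonglongrightarrow> g u"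
      "u \<in> space P \<Longrightarrow> \<bar>F i u\<bar> \<le> 2 * \<bar>g u\<bar>" for i u
    by (simp_all add: dist_real_def)
  have "digit_approximable (F i)" for i
  proof -
    have fin: "finite (F i ` space P)" using F(1) by (rule simple_functionD)
    have "digit_approximable (\<lambda>u. \<Sum>y\<in>F i ` space P. y * indicator (F i -` {y} \<inter> space P) u)"
      by (intro digit_approximable_sum digit_approximable_cmult digit_approximable_indicator fin
          simple_functionD(2)[OF F(1)])
    then show ?thesis
    proof (rule digit_approximable_cong)
      fix u assume u: "u \<in> space P"
      have "(\<Sum>y\<in>F i ` space P. y * indicator (F i -` {y} \<inter> space P) u)
          = (\<Sum>y\<in>F i ` space P. if y = F i u then y else 0)"
        using u by (intro sum.cong) (auto simp: indicator_def)
      then show "(\<Sum>y\<in>F i ` space P. y * indicator (F i -` {y} \<inter> space P) u) = F i u"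
        using fin u by simp
    qed
  qed
  from digit_approximable_limit[OF this g F(2,3)] show ?thesis .
qed

end

section \<open>Mean square errors\<close>

text \<open>The two functions differ only inside a null set, all of whose subsets the completion
  contains. Composing a Lebesgue measurable integrand with the sample points may give a function
  that is not measurable for \<open>M\<close> itself.\<close>

lemma measurable_completion_AE:
  assumes h: "h \<in> M \<rightarrow>\<^sub>M N" and AE: "AE \<omega> in M. F \<omega> = h \<omega>" and F: "F \<in> space M \<rightarrow> space N"
  shows "F \<in> completion M \<rightarrow>\<^sub>M N"
proof (rule measurableI)
  from AE obtain Z where Z: "Z \<in> null_sets M" "{\<omega>\<in>space M. F \<omega> \<noteq> h \<omega>} \<subseteq> Z"
    by (auto elim!: AE_E)
  fix A assume A: "A \<in> sets N"
  show "F -` A \<inter> space (completion M) \<in> sets (completion M)"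
  proof (rule sets_completionI)
    show "F -` A \<inter> space (completion M) = (h -` A \<inter> space M - Z) \<union> (F -` A \<inter> space M \<inter> Z)"
      using Z(2) by auto
    show "F -` A \<inter> space M \<inter> Z \<subseteq> Z" by auto
    show "h -` A \<inter> space M - Z \<in> sets M"
      using measurable_sets[OF h A] Z(1) by auto
  qed (rule Z(1))
qed (use F in auto)

text \<open>The mean square error about \<open>c\<close> exceeds the variance by the squared
  distance from \<open>c\<close> to the mean. Error bounds may therefore use any convenient centre,
  and the expectation of the estimate is never computed.\<close>

lemma (in prob_space) variance_le_mean_square:
  assumes X: "X \<in> L2_functions M"
  shows "variance X \<le> expectation (\<lambda>\<omega>. (X \<omega> - c)\<^sup>2)"
proof -
  let ?\<mu> = "expectation X"
  have m: "X \<in> borel_measurable M" and i2: "integrable M (\<lambda>\<omega>. (X \<omega>)\<^sup>2)"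
    using X by (simp_all add: L2_functions_def)
  have i1: "integrable M X" using m i2 by (rule square_integrable_imp_integrable)
  have *: "expectation (\<lambda>\<omega>. (X \<omega> - e)\<^sup>2) = expectation (\<lambda>\<omega>. (X \<omega>)\<^sup>2) - 2 * e * ?\<mu> + e\<^sup>2" for e
  proof -
    have "expectation (\<lambda>\<omega>. (X \<omega> - e)\<^sup>2) = expectation (\<lambda>\<omega>. (X \<omega>)\<^sup>2 - 2 * e * X \<omega> + e\<^sup>2)"
      by (intro Bochner_Integration.integral_cong refl) (simp add: power2_diff)
    then show ?thesis using i1 i2 by (simp add: prob_space)
  qed
  have "expectation (\<lambda>\<omega>. (X \<omega> - c)\<^sup>2) = variance X + (?\<mu> - c)\<^sup>2"
    unfolding *[of c] *[of ?\<mu>] by (simp add: power2_eq_square algebra_simps)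
  then show ?thesis by simp
qed

lemma L2_functions_sum:
  "finite K \<Longrightarrow> (\<And>k. k \<in> K \<Longrightarrow> f k \<in> L2_functions N) \<Longrightarrow> (\<lambda>x. \<Sum>k\<in>K. f k x) \<in> L2_functions N"
proof (induction K rule: finite_induct)
  case empty
  show ?case by (simp add: L2_functions_def)
next
  case (insert k K)
  then show ?case using L2_functions_add[of "f k" N "\<lambda>x. \<Sum>k\<in>K. f k x"] by simp
qed

context random_scramble
begin

lemma scrambled_point_L2:
  assumes h: "h \<in> L2_functions (uniform_point s)"
  shows "(\<lambda>\<omega>. h (scrambled_point x \<omega>)) \<in> L2_functions M"
    and "expectation (\<lambda>\<omega>. (h (scrambled_point x \<omega>))\<^sup>2) = (\<integral>u. (h u)\<^sup>2 \<partial>uniform_point s)"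
proof -
  have m: "h \<in> borel_measurable (\<Pi>\<^sub>M j\<in>{..<s}. borel)"
    using L2_functions_measurable[OF h] by (simp add: measurable_cong_sets[OF sets_uniform_point refl])
  then have m2: "(\<lambda>u. (h u)\<^sup>2) \<in> borel_measurable (\<Pi>\<^sub>M j\<in>{..<s}. borel)" by measurable
  have "integrable M (\<lambda>\<omega>. (h (scrambled_point x \<omega>))\<^sup>2)"
    using L2_functions_integrable[OF h] integrable_distr_eq[OF measurable_scrambled_point m2, of x]
    unfolding distr_scrambled_point by simp
  then show "(\<lambda>\<omega>. h (scrambled_point x \<omega>)) \<in> L2_functions M"
    using measurable_compose[OF measurable_scrambled_point m] by (simp add: L2_functions_def)
  show "expectation (\<lambda>\<omega>. (h (scrambled_point x \<omega>))\<^sup>2) = (\<integral>u. (h u)\<^sup>2 \<partial>uniform_point s)"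
    using integral_distr[OF measurable_scrambled_point m2, of x] unfolding distr_scrambled_point by simp
qed

end

context scrambled_net
begin

definition point_sum :: "((nat \<Rightarrow> real) \<Rightarrow> real) \<Rightarrow> 'w \<Rightarrow> real" where
  "point_sum h \<omega> = (\<Sum>i<b ^ m. h (scrambled_point (a i) \<omega>))"

lemma point_sum_L2: "h \<in> L2_functions (uniform_point s) \<Longrightarrow> point_sum h \<in> L2_functions M"
  unfolding point_sum_def by (intro L2_functions_sum scrambled_point_L2) auto

text \<open>Cauchy-Schwarz without any cancellation between points: after division by n^2 the full
  squared norm remains.\<close>

lemma expectation_point_sum_square_le:
  assumes h: "h \<in> L2_functions (uniform_point s)"
  shows "expectation (\<lambda>\<omega>. (point_sum h \<omega>)\<^sup>2) \<le> (real (b ^ m))\<^sup>2 * (\<integral>u. (h u)\<^sup>2 \<partial>uniform_point s)"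
proof -
  note L2 = scrambled_point_L2[OF h]
  have "expectation (\<lambda>\<omega>. (point_sum h \<omega>)\<^sup>2)
      \<le> expectation (\<lambda>\<omega>. (\<Sum>i<b ^ m. (h (scrambled_point (a i) \<omega>))\<^sup>2) * real (b ^ m))"
  proof (rule integral_mono)
    show "integrable M (\<lambda>\<omega>. (point_sum h \<omega>)\<^sup>2)"
      by (rule L2_functions_integrable[OF point_sum_L2[OF h]])
    show "integrable M (\<lambda>\<omega>. (\<Sum>i<b ^ m. (h (scrambled_point (a i) \<omega>))\<^sup>2) * real (b ^ m))"
      using L2_functions_integrable[OF L2(1)]
      by (intro integrable_mult_left Bochner_Integration.integrable_sum) auto
    show "(point_sum h \<omega>)\<^sup>2 \<le> (\<Sum>i<b ^ m. (h (scrambled_point (a i) \<omega>))\<^sup>2) * real (b ^ m)" for \<omega>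
      unfolding point_sum_def
      using sum_squared_le_sum_of_squares[of "\<lambda>i. h (scrambled_point (a i) \<omega>)" "{..<b ^ m}"] by simp
  qed
  also have "\<dots> = (\<Sum>i<b ^ m. expectation (\<lambda>\<omega>. (h (scrambled_point (a i) \<omega>))\<^sup>2)) * real (b ^ m)"
    using L2_functions_integrable[OF L2(1)]
    by (subst integral_mult_left_zero) (subst Bochner_Integration.integral_sum, auto)
  also have "\<dots> = (real (b ^ m))\<^sup>2 * (\<integral>u. (h u)\<^sup>2 \<partial>uniform_point s)"
    unfolding L2(2) by (simp add: power2_eq_square)
  finally show ?thesis .
qed

lemma net_sum_L2:
  assumes I: "finite I" "I \<subseteq> {..<s} \<times> UNIV" and q: "depends_on q I"
  shows "net_sum q \<in> L2_functions M"
proof -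
  \<comment> \<open>The constant 1 as second factor makes the product lemma yield measurability of
    the first factor alone.\<close>
  have "finite ({} :: (nat \<times> nat) set)" "({} :: (nat \<times> nat) set) \<subseteq> {..<s} \<times> UNIV"
    "depends_on (\<lambda>_ :: nat \<times> nat \<Rightarrow> nat. 1 :: real) {}"
    by (simp_all add: depends_on_def)
  from borel_measurable_integrable[OF integrable_scrambled_product[OF I q this]]
  have "(\<lambda>\<omega>. q (scrambled_digits b (perm_at \<omega>) x)) \<in> borel_measurable M" for x by simp
  then have "net_sum q \<in> borel_measurable M"
    unfolding net_sum_def by (intro borel_measurable_sum)
  then show ?thesis using integrable_net_sum_mult[OF I q I q] by (simp add: L2_functions_def power2_eq_square)
qed

text \<open>
  \<open>q\<close> is a cylinder function that the net integrates exactly. What remains of \<open>g\<close> is split into a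
  second cylinder function, to which the variance bound applies, and a remainder so small that the
  trivial bound suffices.
\<close>

lemma mean_square_error_le:
  assumes g: "g \<in> L2_functions (uniform_point s)" and \<epsilon>: "\<epsilon> > 0"
    and I: "finite I" "I \<subseteq> {..<s} \<times> UNIV" and q: "depends_on q I"
    and qL2: "(\<lambda>u. q (digit_array b u)) \<in> L2_functions (uniform_point s)"
    and close: "(\<integral>u. (g u - q (digit_array b u))\<^sup>2 \<partial>uniform_point s) < \<epsilon>"
    and level: "(\<Sum>j<s. level I j) \<le> m - t"
  shows "\<exists>c. expectation (\<lambda>\<omega>. (point_sum g \<omega> / real (b ^ m) - c)\<^sup>2)
    \<le> (8 * real (b ^ (t + s)) + 2) * \<epsilon> / real (b ^ m)"
proof -
  interpret digit_approximation b s by standard (rule b)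
  let ?P = "uniform_point s" and ?n = "real (b ^ m)" and ?C = "real (b ^ (t + s))"
  let ?h = "\<lambda>u. g u - q (digit_array b u)"
  have n: "?n \<ge> 1" using b_pos by (simp add: Suc_le_eq)
  have hL2: "?h \<in> L2_functions ?P" using g qL2 by (rule L2_functions_diff)
  \<comment> \<open>The trivial bound gives the remainder no factor 1/n, so its squared norm has to
    supply it.\<close>
  have "\<epsilon> / ?n > 0" using \<epsilon> b_pos by simp
  then obtain r J where J: "finite J" "J \<subseteq> {..<s} \<times> UNIV" and r: "depends_on r J"
    and rL2: "(\<lambda>u. r (digit_array b u)) \<in> L2_functions ?P"
    and rclose: "(\<integral>u. (?h u - r (digit_array b u))\<^sup>2 \<partial>?P) < \<epsilon> / ?n"
    by (rule digit_approximableE[OF L2_digit_approximable[OF hL2]])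
  let ?e = "\<lambda>u. ?h u - r (digit_array b u)"
  have eL2: "?e \<in> L2_functions ?P" using hL2 rL2 by (rule L2_functions_diff)
  \<comment> \<open>The integrand on the left is the square of \<open>r\<close>, since
    \<open>?e\<close> is the difference of \<open>?h\<close> and \<open>r\<close>; both squared
    norms on the right are below epsilon.\<close>
  have "(\<integral>u. (?h u + (-1) * ?e u)\<^sup>2 \<partial>?P) \<le> 2 * (\<integral>u. (?h u)\<^sup>2 \<partial>?P) + 2 * (\<integral>u. ((-1) * ?e u)\<^sup>2 \<partial>?P)"
    by (rule integral_square_add_le[OF hL2 L2_functions_cmult[OF eL2]])
  then have "(\<integral>u. (r (digit_array b u))\<^sup>2 \<partial>?P) \<le> 2 * (\<integral>u. (?h u)\<^sup>2 \<partial>?P) + 2 * (\<integral>u. (?e u)\<^sup>2 \<partial>?P)"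
    by (simp add: power2_commute)
  also have "\<dots> \<le> 2 * \<epsilon> + 2 * \<epsilon>"
  proof -
    have "\<epsilon> / ?n \<le> \<epsilon> / 1" using n \<epsilon> b_pos by (intro divide_left_mono) auto
    then show ?thesis using close rclose by linarith
  qed
  finally have r_norm: "(\<integral>u. (r (digit_array b u))\<^sup>2 \<partial>?P) \<le> 4 * \<epsilon>" by simp
  obtain c1 where c1: "\<And>\<omega>. \<omega> \<in> space M \<Longrightarrow> net_sum q \<omega> = ?n * c1"
    by (rule cylinder_bound[OF I q]) (use level in blast)
  obtain c2 where c2: "integrable M (\<lambda>\<omega>. (net_sum r \<omega> - ?n * c2)\<^sup>2)"
    "expectation (\<lambda>\<omega>. (net_sum r \<omega> - ?n * c2)\<^sup>2) \<le> ?n * ?C * (\<integral>u. (r (digit_array b u))\<^sup>2 \<partial>?P)"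
    by (rule cylinder_bound[OF J r]) blast
  have cL2: "(\<lambda>\<omega>. net_sum r \<omega> - ?n * c2) \<in> L2_functions M"
    using L2_functions_measurable[OF net_sum_L2[OF J r]] c2(1) by (simp add: L2_functions_def)
  note psL2 = point_sum_L2[OF eL2]
  have "AE \<omega> in M. \<forall>i\<in>{..<b ^ m}. q (digit_array b (scrambled_point (a i) \<omega>)) = q (scrambled_digits b (perm_at \<omega>) (a i))
      \<and> r (digit_array b (scrambled_point (a i) \<omega>)) = r (scrambled_digits b (perm_at \<omega>) (a i))"
    using AE_scrambled_digits_eq[OF I(2) q] AE_scrambled_digits_eq[OF J(2) r]
    by (intro AE_finite_allI AE_conjI) auto
  then have AE: "AE \<omega> in M. (point_sum g \<omega> / ?n - (c1 + c2))\<^sup>2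
      = ((net_sum r \<omega> - ?n * c2) + point_sum ?e \<omega>)\<^sup>2 / ?n\<^sup>2"
    using AE_space
  proof eventually_elim
    case (elim \<omega>)
    have "point_sum g \<omega> = net_sum q \<omega> + net_sum r \<omega> + point_sum ?e \<omega>"
      unfolding point_sum_def net_sum_def sum.distrib[symmetric]
      using elim(1) by (intro sum.cong refl) simp
    then have "point_sum g \<omega> = ?n * (c1 + c2) + ((net_sum r \<omega> - ?n * c2) + point_sum ?e \<omega>)"
      using c1[OF elim(2)] by (simp add: algebra_simps)
    then have "point_sum g \<omega> / ?n - (c1 + c2) = ((net_sum r \<omega> - ?n * c2) + point_sum ?e \<omega>) / ?n"
      using b_pos by (simp add: add_divide_distrib)
    then show ?case by (simp add: power_divide)
  qed
  have "expectation (\<lambda>\<omega>. (point_sum g \<omega> / ?n - (c1 + c2))\<^sup>2)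
      = expectation (\<lambda>\<omega>. ((net_sum r \<omega> - ?n * c2) + point_sum ?e \<omega>)\<^sup>2 / ?n\<^sup>2)"
  proof (rule integral_cong_AE[OF _ _ AE])
    show "(\<lambda>\<omega>. (point_sum g \<omega> / ?n - (c1 + c2))\<^sup>2) \<in> borel_measurable M"
      using L2_functions_measurable[OF point_sum_L2[OF g]] by measurable
    show "(\<lambda>\<omega>. ((net_sum r \<omega> - ?n * c2) + point_sum ?e \<omega>)\<^sup>2 / ?n\<^sup>2) \<in> borel_measurable M"
      using L2_functions_measurable[OF L2_functions_add[OF cL2 psL2]] by measurable
  qed
  also have "\<dots> = expectation (\<lambda>\<omega>. ((net_sum r \<omega> - ?n * c2) + point_sum ?e \<omega>)\<^sup>2) / ?n\<^sup>2"
    by simp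
  \<comment> \<open>The outer factors 2 come from (x + y)^2 <= 2x^2 + 2y^2, and
    \<open>4 * \<epsilon>\<close> bounds the squared norm of \<open>r\<close>; together they give
    the constant \<open>8 * ?C + 2\<close>.\<close>
  also have "\<dots> \<le> (2 * (?n * ?C * (4 * \<epsilon>)) + 2 * (?n\<^sup>2 * (\<epsilon> / ?n))) / ?n\<^sup>2"
  proof (rule divide_right_mono)
    have 1: "expectation (\<lambda>\<omega>. (net_sum r \<omega> - ?n * c2)\<^sup>2) \<le> ?n * ?C * (4 * \<epsilon>)"
      using r_norm by (intro order_trans[OF c2(2)] mult_left_mono) auto
    have 2: "expectation (\<lambda>\<omega>. (point_sum ?e \<omega>)\<^sup>2) \<le> ?n\<^sup>2 * (\<epsilon> / ?n)"
      using rclose by (intro order_trans[OF expectation_point_sum_square_le[OF eL2]] mult_left_mono) auto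
    show "expectation (\<lambda>\<omega>. ((net_sum r \<omega> - ?n * c2) + point_sum ?e \<omega>)\<^sup>2)
        \<le> 2 * (?n * ?C * (4 * \<epsilon>)) + 2 * (?n\<^sup>2 * (\<epsilon> / ?n))"
      using integral_square_add_le[OF cL2 psL2] 1 2 by linarith
  qed simp
  also have "\<dots> = (8 * ?C + 2) * \<epsilon> / ?n"
  proof -
    have "?n \<noteq> 0" using n by linarith
    then have "(2 * (N * ?C * (4 * \<epsilon>)) + 2 * (N\<^sup>2 * (\<epsilon> / N))) / N\<^sup>2 = (8 * ?C + 2) * \<epsilon> / N"
      if "N = ?n" for N using that by (simp add: field_simps power2_eq_square)
    then show ?thesis by blast
  qed
  finally show ?thesis by blast
qed

end

section \<open>Products of uniform measures\<close>

lemma sigma_finite_vol: "sigma_finite_measure (vol d)"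
proof -
  interpret product_sigma_finite "\<lambda>_. lborel :: real measure"
    by (simp add: product_sigma_finite_def sigma_finite_lborel)
  show ?thesis unfolding vol_def by (rule sigma_finite) simp
qed

lemma sigma_finite_null_measure: "sigma_finite_measure (null_measure M)"
proof -
  interpret finite_measure "null_measure M" by (rule finite_measureI) simp
  show ?thesis ..
qed

text \<open>Both sides agree on boxes. Uniqueness of product measures wants a sigma-finite factor at
  every index; outside \<open>I\<close> nothing is known of \<open>X j\<close>, so the null measure
  stands in there.\<close>

lemma PiM_uniform_measure:
  assumes vol: "\<And>j. sigma_finite_measure (V j)" and I: "finite I"
    and X: "\<And>j. j \<in> I \<Longrightarrow> X j \<in> sets (V j)" "\<And>j. j \<in> I \<Longrightarrow> emeasure (V j) (X j) = 1"
  shows "uniform_measure (\<Pi>\<^sub>M j\<in>I. V j) (\<Pi>\<^sub>E j\<in>I. X j)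
    = (\<Pi>\<^sub>M j\<in>I. if j \<in> I then uniform_measure (V j) (X j) else null_measure (V j))"
proof -
  interpret V: product_sigma_finite V using vol by (simp add: product_sigma_finite_def)
  let ?N = "\<lambda>j. if j \<in> I then uniform_measure (V j) (X j) else null_measure (V j)"
  have "sigma_finite_measure (?N j)" for j
  proof (cases "j \<in> I")
    case True
    interpret prob_space "uniform_measure (V j) (X j)"
      using X True by (intro prob_space_uniform_measure) auto
    show ?thesis using True sigma_finite_measure_axioms by simp
  qed (simp add: sigma_finite_null_measure)
  then interpret N: product_sigma_finite ?N by (simp add: product_sigma_finite_def)
  have X1: "emeasure (\<Pi>\<^sub>M j\<in>I. V j) (\<Pi>\<^sub>E j\<in>I. X j) = 1"
    using X by (subst V.emeasure_PiM[OF I]) auto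
  have XS: "(\<Pi>\<^sub>E j\<in>I. X j) \<in> sets (\<Pi>\<^sub>M j\<in>I. V j)"
    using X I by (intro sets_PiM_I_finite) auto
  show ?thesis
  proof (rule N.PiM_eqI[OF I])
    show "sets (uniform_measure (\<Pi>\<^sub>M j\<in>I. V j) (\<Pi>\<^sub>E j\<in>I. X j)) = sets (\<Pi>\<^sub>M j\<in>I. ?N j)"
      by (simp, intro sets_PiM_cong) auto
    fix A assume "\<And>j. j \<in> I \<Longrightarrow> A j \<in> sets (?N j)"
    then have A: "A j \<in> sets (V j)" if "j \<in> I" for j using that by force
    have "emeasure (uniform_measure (\<Pi>\<^sub>M j\<in>I. V j) (\<Pi>\<^sub>E j\<in>I. X j)) (Pi\<^sub>E I A)
        = emeasure (\<Pi>\<^sub>M j\<in>I. V j) ((\<Pi>\<^sub>E j\<in>I. X j) \<inter> Pi\<^sub>E I A)"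
      using XS A I by (subst emeasure_uniform_measure) (auto simp: X1 divide_ennreal_def intro!: sets_PiM_I_finite)
    also have "(\<Pi>\<^sub>E j\<in>I. X j) \<inter> Pi\<^sub>E I A = (\<Pi>\<^sub>E j\<in>I. X j \<inter> A j)" by (auto simp: PiE_iff)
    also have "emeasure (\<Pi>\<^sub>M j\<in>I. V j) (\<Pi>\<^sub>E j\<in>I. X j \<inter> A j) = (\<Prod>j\<in>I. emeasure (V j) (X j \<inter> A j))"
      using X A by (intro V.emeasure_PiM I) auto
    also have "\<dots> = (\<Prod>j\<in>I. emeasure (?N j) (A j))"
      using X A by (intro prod.cong) (auto simp: divide_ennreal_def)
    finally show "emeasure (uniform_measure (\<Pi>\<^sub>M j\<in>I. V j) (\<Pi>\<^sub>E j\<in>I. X j)) (Pi\<^sub>E I A)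
        = (\<Prod>j\<in>I. emeasure (?N j) (A j))" .
  qed
qed

lemma distr_PiM_components:
  assumes N: "\<And>j. j \<in> I \<Longrightarrow> distr (M j) (V j) (\<phi> j) = N j" and I: "finite I"
    and \<phi>: "\<And>j. j \<in> I \<Longrightarrow> \<phi> j \<in> M j \<rightarrow>\<^sub>M V j"
    and M: "\<And>j. sigma_finite_measure (M j)" and N_fin: "\<And>j. sigma_finite_measure (N j)"
  shows "distr (\<Pi>\<^sub>M j\<in>I. M j) (\<Pi>\<^sub>M j\<in>I. V j) (\<lambda>u. \<lambda>j\<in>I. \<phi> j (u j)) = (\<Pi>\<^sub>M j\<in>I. N j)"
    and "(\<lambda>u. \<lambda>j\<in>I. \<phi> j (u j)) \<in> (\<Pi>\<^sub>M j\<in>I. M j) \<rightarrow>\<^sub>M (\<Pi>\<^sub>M j\<in>I. V j)"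
proof -
  interpret M: product_sigma_finite M using M by (simp add: product_sigma_finite_def)
  interpret N: product_sigma_finite N using N_fin by (simp add: product_sigma_finite_def)
  let ?\<Phi> = "\<lambda>u. \<lambda>j\<in>I. \<phi> j (u j)"
  show \<Phi>: "?\<Phi> \<in> (\<Pi>\<^sub>M j\<in>I. M j) \<rightarrow>\<^sub>M (\<Pi>\<^sub>M j\<in>I. V j)"
    by (intro measurable_restrict measurable_compose[OF measurable_component_singleton] \<phi>)
  have setsN: "sets (N j) = sets (V j)" if "j \<in> I" for j using N[OF that, symmetric] by simp
  show "distr (\<Pi>\<^sub>M j\<in>I. M j) (\<Pi>\<^sub>M j\<in>I. V j) ?\<Phi> = (\<Pi>\<^sub>M j\<in>I. N j)"
  proof (rule N.PiM_eqI[OF I])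
    show "sets (distr (\<Pi>\<^sub>M j\<in>I. M j) (\<Pi>\<^sub>M j\<in>I. V j) ?\<Phi>) = sets (\<Pi>\<^sub>M j\<in>I. N j)"
      by (simp, intro sets_PiM_cong) (auto simp: setsN)
    fix A assume "\<And>j. j \<in> I \<Longrightarrow> A j \<in> sets (N j)"
    then have A: "A j \<in> sets (V j)" if "j \<in> I" for j using that setsN by auto
    have "emeasure (distr (\<Pi>\<^sub>M j\<in>I. M j) (\<Pi>\<^sub>M j\<in>I. V j) ?\<Phi>) (Pi\<^sub>E I A)
        = emeasure (\<Pi>\<^sub>M j\<in>I. M j) (?\<Phi> -` Pi\<^sub>E I A \<inter> space (\<Pi>\<^sub>M j\<in>I. M j))"
      using A I by (intro emeasure_distr \<Phi> sets_PiM_I_finite) auto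
    also have "?\<Phi> -` Pi\<^sub>E I A \<inter> space (\<Pi>\<^sub>M j\<in>I. M j) = (\<Pi>\<^sub>E j\<in>I. \<phi> j -` A j \<inter> space (M j))"
      by (auto simp: space_PiM PiE_iff)
    also have "emeasure (\<Pi>\<^sub>M j\<in>I. M j) \<dots> = (\<Prod>j\<in>I. emeasure (M j) (\<phi> j -` A j \<inter> space (M j)))"
      using A \<phi> by (intro M.emeasure_PiM I) auto
    also have "\<dots> = (\<Prod>j\<in>I. emeasure (N j) (A j))"
      using A \<phi> N[symmetric] by (intro prod.cong refl) (simp add: emeasure_distr)
    finally show "emeasure (distr (\<Pi>\<^sub>M j\<in>I. M j) (\<Pi>\<^sub>M j\<in>I. V j) ?\<Phi>) (Pi\<^sub>E I A)
        = (\<Prod>j\<in>I. emeasure (N j) (A j))" .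
  qed
qed

section \<open>Transfer to the product of the split sets\<close>

lemma L2_functions_completion_AE:
  assumes h: "h \<in> L2_functions M" and AE: "AE \<omega> in M. F \<omega> = h \<omega>"
  shows "F \<in> L2_functions (completion M)"
    and "prob_space.variance (completion M) F = prob_space.variance M h"
proof -
  note m = L2_functions_measurable[OF h]
  have F: "F \<in> borel_measurable (completion M)"
    by (rule measurable_completion_AE[OF m AE]) simp
  have hc: "h \<in> borel_measurable (completion M)" using m by (rule measurable_completion)
  note AEc = AE_completion[OF AE]
  have sq: "integrable (completion M) (\<lambda>\<omega>. (h \<omega>)\<^sup>2)"
    using L2_functions_integrable[OF h] m by (subst integrable_completion) measurable
  have "integrable (completion M) (\<lambda>\<omega>. (F \<omega>)\<^sup>2)"
  proof (rule integrable_cong_AE_imp[OF sq])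
    show "(\<lambda>\<omega>. (F \<omega>)\<^sup>2) \<in> borel_measurable (completion M)" using F by measurable
    show "AE \<omega> in completion M. (h \<omega>)\<^sup>2 = (F \<omega>)\<^sup>2" using AEc by eventually_elim simp
  qed
  then show "F \<in> L2_functions (completion M)" using F by (simp add: L2_functions_def)
  have E: "integral\<^sup>L (completion M) F = integral\<^sup>L M h"
    using integral_cong_AE[OF F hc AEc] integral_completion[OF m] by simp
  have "(\<integral>\<omega>. (F \<omega> - integral\<^sup>L M h)\<^sup>2 \<partial>completion M) = (\<integral>\<omega>. (h \<omega> - integral\<^sup>L M h)\<^sup>2 \<partial>completion M)"
  proof (rule integral_cong_AE)
    show "AE \<omega> in completion M. (F \<omega> - integral\<^sup>L M h)\<^sup>2 = (h \<omega> - integral\<^sup>L M h)\<^sup>2"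
      using AEc by eventually_elim simp
    show "(\<lambda>\<omega>. (F \<omega> - integral\<^sup>L M h)\<^sup>2) \<in> borel_measurable (completion M)"
      by (intro borel_measurable_power borel_measurable_diff borel_measurable_const F)
    show "(\<lambda>\<omega>. (h \<omega> - integral\<^sup>L M h)\<^sup>2) \<in> borel_measurable (completion M)"
      by (intro borel_measurable_power borel_measurable_diff borel_measurable_const hc)
  qed
  also have "\<dots> = (\<integral>\<omega>. (h \<omega> - integral\<^sup>L M h)\<^sup>2 \<partial>M)"
    by (intro integral_completion borel_measurable_power borel_measurable_diff borel_measurable_const m)
  finally show "prob_space.variance (completion M) F = prob_space.variance M h"
    unfolding E .
qed

definition split_map_product ::
    "nat \<Rightarrow> (nat \<Rightarrow> nat) \<Rightarrow> (nat \<Rightarrow> nat) \<Rightarrow> (nat \<Rightarrow> nat list \<Rightarrow> (nat \<Rightarrow> real) set) \<Rightarrow>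
     (nat \<Rightarrow> real) \<Rightarrow> nat \<Rightarrow> nat \<Rightarrow> real" where
  "split_map_product s d bs Y u = (\<lambda>j\<in>{..<s}. split_map (d j) (bs j) (Y j) (u j))"

lemma (in random_scramble) sample_point_eq:
  "sample_point b s d bs Y \<pi> x \<omega> = split_map_product s d bs Y (scrambled_point x \<omega>)"
  unfolding sample_point_def split_map_product_def scrambled_point_def by auto

lemma split_map_product_distr:
  assumes split: "\<forall>j<s. convergent_recursive_split (d j) (bs j) (X j) (Y j)"
  shows "split_map_product s d bs Y \<in> uniform_point s \<rightarrow>\<^sub>M (\<Pi>\<^sub>M j\<in>{..<s}. vol (d j))"
    and "distr (uniform_point s) (\<Pi>\<^sub>M j\<in>{..<s}. vol (d j)) (split_map_product s d bs Y)
      = uniform_measure (\<Pi>\<^sub>M j\<in>{..<s}. vol (d j)) (product_set s X)"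
    and "product_set s X \<in> sets (\<Pi>\<^sub>M j\<in>{..<s}. vol (d j))"
    and "emeasure (\<Pi>\<^sub>M j\<in>{..<s}. vol (d j)) (product_set s X) = 1"
proof -
  let ?V = "\<lambda>j. vol (d j)"
  let ?N = "\<lambda>j. if j \<in> {..<s} then uniform_measure (?V j) (X j) else null_measure (?V j)"
  have X: "X j \<in> sets (?V j)" "emeasure (?V j) (X j) = 1" if "j \<in> {..<s}" for j
    using split that convergent_recursive_split.sets_X convergent_recursive_split.vol_X by blast+
  have distr: "distr unif (?V j) (split_map (d j) (bs j) (Y j)) = ?N j" if "j \<in> {..<s}" for j
    using convergent_recursive_split.distr_split_map[of "d j" "bs j" "X j" "Y j"] split that by simp
  have meas: "split_map (d j) (bs j) (Y j) \<in> unif \<rightarrow>\<^sub>M ?V j" if "j \<in> {..<s}" for j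
    using convergent_recursive_split.measurable_split_map[of "d j" "bs j" "X j" "Y j"] split that
    by (simp add: measurable_cong_sets[OF sets_unif refl])
  have unif: "sigma_finite_measure unif"
  proof -
    interpret prob_space unif by (rule prob_space_unif)
    show ?thesis ..
  qed
  have N: "sigma_finite_measure (?N j)" for j
  proof (cases "j \<in> {..<s}")
    case True
    interpret prob_space "uniform_measure (?V j) (X j)"
      using X[OF True] by (intro prob_space_uniform_measure) auto
    show ?thesis using True sigma_finite_measure_axioms by simp
  qed (simp add: sigma_finite_null_measure)
  have \<Phi>: "split_map_product s d bs Y = (\<lambda>u. \<lambda>j\<in>{..<s}. split_map (d j) (bs j) (Y j) (u j))"
    by (auto simp: split_map_product_def)
  note dp = distr_PiM_components[where I="{..<s}" and M="\<lambda>_. unif" and V="?V" and N="?N"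
      and \<phi>="\<lambda>j. split_map (d j) (bs j) (Y j)", OF distr finite_lessThan meas unif N]
  show "split_map_product s d bs Y \<in> uniform_point s \<rightarrow>\<^sub>M (\<Pi>\<^sub>M j\<in>{..<s}. ?V j)"
    unfolding uniform_point_def \<Phi> by (rule dp(2))
  have "distr (uniform_point s) (\<Pi>\<^sub>M j\<in>{..<s}. ?V j) (split_map_product s d bs Y) = (\<Pi>\<^sub>M j\<in>{..<s}. ?N j)"
    unfolding uniform_point_def \<Phi> by (rule dp(1))
  also have "\<dots> = uniform_measure (\<Pi>\<^sub>M j\<in>{..<s}. ?V j) (product_set s X)"
    unfolding product_set_def by (rule PiM_uniform_measure[symmetric]) (use X sigma_finite_vol in auto)
  finally show "distr (uniform_point s) (\<Pi>\<^sub>M j\<in>{..<s}. ?V j) (split_map_product s d bs Y)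
      = uniform_measure (\<Pi>\<^sub>M j\<in>{..<s}. ?V j) (product_set s X)" .
  show "product_set s X \<in> sets (\<Pi>\<^sub>M j\<in>{..<s}. ?V j)"
    unfolding product_set_def using X by (intro sets_PiM_I_finite) auto
  interpret product_sigma_finite ?V by (simp add: product_sigma_finite_def sigma_finite_vol)
  show "emeasure (\<Pi>\<^sub>M j\<in>{..<s}. ?V j) (product_set s X) = 1"
    unfolding product_set_def using X by (subst emeasure_PiM) auto
qed

text \<open>A Lebesgue measurable function composed with a Borel map need not be measurable, so
  \<open>f\<close> is first replaced by a Borel function \<open>f'\<close>. The exceptional null set
  stays null under pullback because the product of the transformations carries the uniform
  distribution to that on the product set.\<close>

lemma pullback_L2:
  assumes split: "\<forall>j<s. convergent_recursive_split (d j) (bs j) (X j) (Y j)"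
    and f: "f \<in> L2_functions (product_measure s d X)"
  obtains g where "g \<in> L2_functions (uniform_point s)"
    "AE u in uniform_point s. f (split_map_product s d bs Y u) = g u"
proof -
  let ?V = "\<Pi>\<^sub>M j\<in>{..<s}. vol (d j)" and ?X = "product_set s X" and ?\<Phi> = "split_map_product s d bs Y"
  note \<Phi> = split_map_product_distr[OF split]
  have X: "?X \<inter> space (completion ?V) \<in> sets (completion ?V)" using \<Phi>(3) by auto
  \<comment> \<open>Extension by zero passes from the product set to the whole space, where the
    completion supplies a Borel version.\<close>
  have "(\<lambda>x. indicator ?X x *\<^sub>R f x) \<in> borel_measurable (completion ?V)"
    using L2_functions_measurable[OF f] borel_measurable_restrict_space_iff[OF X, of f]
    unfolding product_measure_def by simp
  from completion_ex_borel_measurable_real[OF this] obtain f' where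
    f': "f' \<in> borel_measurable ?V" and AE: "AE x in ?V. indicator ?X x *\<^sub>R f x = f' x" by blast
  have "integrable (completion ?V) (\<lambda>x. indicator ?X x *\<^sub>R (f x)\<^sup>2)"
    using L2_functions_integrable[OF f] integrable_restrict_space[OF X, of "\<lambda>x. (f x)\<^sup>2"]
    unfolding product_measure_def by simp
  then have "integrable (completion ?V) (\<lambda>x. indicator ?X x *\<^sub>R (f' x)\<^sup>2)"
  proof (rule integrable_cong_AE_imp)
    have "(\<lambda>x. indicator ?X x *\<^sub>R (f' x)\<^sup>2) \<in> borel_measurable ?V" 
      using f' \<Phi>(3) by (intro borel_measurable_scaleR borel_measurable_indicator borel_measurable_power)
    then show "(\<lambda>x. indicator ?X x *\<^sub>R (f' x)\<^sup>2) \<in> borel_measurable (completion ?V)"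
      by (rule measurable_completion)
    show "AE x in completion ?V. indicator ?X x *\<^sub>R (f x)\<^sup>2 = indicator ?X x *\<^sub>R (f' x)\<^sup>2"
      using AE_completion[OF AE] by eventually_elim (auto simp: indicator_def split: if_splits)
  qed
  then have int: "integrable ?V (\<lambda>x. indicator ?X x *\<^sub>R (f' x)\<^sup>2)"
    using f' \<Phi>(3)
    by (subst (asm) integrable_completion)
      (auto intro!: borel_measurable_scaleR borel_measurable_indicator borel_measurable_power)
  \<comment> \<open>The product set has measure 1, so its indicator is already the density.\<close>
  have dens: "uniform_measure ?V ?X = density ?V (\<lambda>x. ennreal (indicator ?X x))"
    unfolding uniform_measure_def \<Phi>(4) by (simp add: divide_ennreal_def ennreal_indicator)
  have sq: "(\<lambda>x. (f' x)\<^sup>2) \<in> borel_measurable ?V" using f' by (rule borel_measurable_power)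
  have "integrable (uniform_measure ?V ?X) (\<lambda>x. (f' x)\<^sup>2)"
    unfolding dens using int \<Phi>(3) sq by (subst integrable_density) auto
  then have "integrable (uniform_point s) (\<lambda>u. (f' (?\<Phi> u))\<^sup>2)"
    unfolding \<Phi>(2)[symmetric] using integrable_distr_eq[OF \<Phi>(1) sq] by simp
  then have L2: "(\<lambda>u. f' (?\<Phi> u)) \<in> L2_functions (uniform_point s)"
    using measurable_compose[OF \<Phi>(1) f'] by (simp add: L2_functions_def)
  have "AE x in uniform_measure ?V ?X. f x = f' x"
  proof (rule AE_uniform_measureI[OF \<Phi>(3)])
    show "AE x in ?V. x \<in> ?X \<longrightarrow> f x = f' x"
      using AE by eventually_elim (auto simp: indicator_def)
  qed
  then have "AE u in uniform_point s. f (?\<Phi> u) = f' (?\<Phi> u)"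
    unfolding \<Phi>(2)[symmetric] by (rule AE_distrD[OF \<Phi>(1)])
  with L2 show thesis by (rule that)
qed

lemma (in scrambled_net) estimate_AE_eq:
  assumes AE: "AE u in uniform_point s. f (split_map_product s d bs Y u) = g u"
  shows "AE \<omega> in M. estimate b m s d bs Y f \<pi> a \<omega> = point_sum g \<omega> / real (b ^ m)"
proof -
  have "AE \<omega> in M. f (split_map_product s d bs Y (scrambled_point x \<omega>)) = g (scrambled_point x \<omega>)" for x
    using AE unfolding distr_scrambled_point[of x, symmetric]
    by (rule AE_distrD[OF measurable_scrambled_point])
  then have "AE \<omega> in M. \<forall>i\<in>{..<b ^ m}.
      f (split_map_product s d bs Y (scrambled_point (a i) \<omega>)) = g (scrambled_point (a i) \<omega>)"
    by (intro AE_finite_allI) auto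
  then show ?thesis
    by eventually_elim (simp add: estimate_def point_sum_def sample_point_eq)
qed

text \<open>The limit is taken along any sequence of nets with \<open>m k\<close> tending to
  infinity and \<open>t\<close> fixed, each with its own permutations. Square integrability is part
  of the conclusion because the variance is a total function: without it the second claim could hold
  through a default value of the integral.\<close>

theorem theorem4:
  fixes s t b :: nat
    and m d bs :: "nat \<Rightarrow> nat"
    and X :: "nat \<Rightarrow> (nat \<Rightarrow> real) set"
    and Y :: "nat \<Rightarrow> nat list \<Rightarrow> (nat \<Rightarrow> real) set"
    and a :: "nat \<Rightarrow> nat \<Rightarrow> nat \<Rightarrow> real"
    and M :: "'w measure"
    and \<pi> :: "nat \<Rightarrow> nat \<Rightarrow> nat list \<Rightarrow> 'w \<Rightarrow> nat \<Rightarrow> nat"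
    and f :: "(nat \<Rightarrow> nat \<Rightarrow> real) \<Rightarrow> real"
  assumes "s \<ge> 1" and "b \<ge> 2"
    and "\<And>j. j < s \<Longrightarrow> bs j \<ge> 2"
    and "\<And>j. j < s \<Longrightarrow> bounded_vec (d j) (X j)"
    and "\<And>j. j < s \<Longrightarrow> emeasure (vol (d j)) (X j) = 1"
    and "\<And>j. j < s \<Longrightarrow> recursive_split (d j) (bs j) (X j) (Y j)"
    and "\<And>j. j < s \<Longrightarrow> convergent_split (d j) (bs j) (Y j)"
    and "filterlim m at_top sequentially"
    and "\<And>k. is_net b t (m k) s (a k)"
    and "prob_space M"
    and "\<And>k. uniform_permutations M b s (\<pi> k)"
    and "f \<in> L2_functions (product_measure s d X)"
  shows "(\<forall>k. estimate b (m k) s d bs Y f (\<pi> k) (a k) \<in> L2_functions (completion M)) \<and>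
    (\<lambda>k. prob_space.variance (completion M) (estimate b (m k) s d bs Y f (\<pi> k) (a k)))
      \<in> o(\<lambda>k. 1 / real (b ^ m k))"
proof -
  have split: "\<forall>j<s. convergent_recursive_split (d j) (bs j) (X j) (Y j)"
    using assms(3,5,6,7) by (intro allI impI convergent_recursive_split.intro) auto
  have net: "scrambled_net b t (m k) s (a k) M (\<pi> k)" for k
    using assms by (intro scrambled_net.intro digital_net.intro random_scramble.intro
        random_scramble_axioms.intro) auto
  obtain g where g: "g \<in> L2_functions (uniform_point s)"
    and AE_g: "AE u in uniform_point s. f (split_map_product s d bs Y u) = g u"
    by (rule pullback_L2[OF split assms(12)])
  let ?n = "\<lambda>k. real (b ^ m k)"
  let ?F = "\<lambda>k. estimate b (m k) s d bs Y f (\<pi> k) (a k)"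
  let ?S = "\<lambda>k \<omega>. scrambled_net.point_sum b (m k) s (a k) (\<pi> k) g \<omega> / ?n k"
  have S: "?S k \<in> L2_functions M" for k
    using L2_functions_cmult[OF scrambled_net.point_sum_L2[OF net g], of "1 / ?n k" k] by simp
  note F = L2_functions_completion_AE[OF S scrambled_net.estimate_AE_eq[OF net AE_g]]
  interpret prob_space M by fact
  have "(\<lambda>k. variance (?S k)) \<in> o(\<lambda>k. 1 / ?n k)"
  proof (rule landau_o.smallI)
    fix c :: real assume c: "c > 0"
    \<comment> \<open>The constant of \<open>mean_square_error_le\<close>; dividing the tolerance by
      it makes the final factor exactly \<open>c\<close>.\<close>
    let ?C = "8 * real (b ^ (t + s)) + 2"
    have C: "?C > 0" by (simp add: add_nonneg_pos)
    then have \<epsilon>: "c / ?C > 0" using c by simp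
    interpret digit_approximation b s by standard (rule assms(2))
    \<comment> \<open>These are chosen from \<open>c\<close> alone, before \<open>k\<close>, so that
      \<open>m k - t\<close> eventually reaches the total level of \<open>I\<close>.\<close>
    obtain q I where I: "finite I" "I \<subseteq> {..<s} \<times> UNIV" and q: "depends_on q I"
      and qL2: "(\<lambda>u. q (digit_array b u)) \<in> L2_functions (uniform_point s)"
      and close: "(\<integral>u. (g u - q (digit_array b u))\<^sup>2 \<partial>uniform_point s) < c / ?C"
      by (rule digit_approximableE[OF L2_digit_approximable[OF g] \<epsilon>])
    have "\<forall>\<^sub>F k in sequentially. m k \<ge> t + (\<Sum>j<s. level I j)"
      using assms(8) by (simp add: filterlim_at_top)
    then show "\<forall>\<^sub>F k in sequentially. norm (variance (?S k)) \<le> c * norm (1 / ?n k)"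
    proof eventually_elim
      case (elim k)
      then have "(\<Sum>j<s. level I j) \<le> m k - t" by simp
      from scrambled_net.mean_square_error_le[OF net g \<epsilon> I q qL2 close this]
      obtain e where "expectation (\<lambda>\<omega>. (?S k \<omega> - e)\<^sup>2) \<le> ?C * (c / ?C) / ?n k" ..
      then have "variance (?S k) \<le> ?C * (c / ?C) / ?n k"
        by (rule order_trans[OF variance_le_mean_square[OF S]])
      also have "\<dots> = c * norm (1 / ?n k)" using C by simp
      finally show ?case using variance_positive by simp
    qed
  qed
  then show ?thesis using F by simp
qed

end
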